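(* Fix $N\in\mathbb{N}$, $m\in\mathbb{N}$ and let $\{(\alpha^{(k)},t^{(k)})\}_{k=1}^m\subset\mathbb{N}_0\times(0,\infty)$ be a time-like path. Let $\vec X^{(k)}=\{X^N_j(\alpha^{(k)},t^{(k)})\}_{j=1}^N$. Then $\vec X^{(k)}$, $k=1,\dots,m$, is a Markov process in $k$.
   Context: $\mathbb{N}=\{1,2,\dots\}$, $\mathbb{N}_0=\mathbb{N}\cup\{0\}$. Let $B_{ij}(t)$, $i,j\in\mathbb{N}$, $t\ge 0$, be i.i.d. complex Brownian motions, $B_{ij}=\frac{1}{\sqrt2}b_{ij}+\frac{\mathrm i}{\sqrt2}\tilde b_{ij}$ with $b_{ij},\tilde b_{ij}$ independent standard real Brownian motions started at $0$. For $\alpha\in\mathbb{N}_0$, $t\ge 0$ let $A^N(\alpha,t)=(B_{ij}(t))_{1\le i\le N+\alpha,\,1\le j\le N}$ and let $0\le X_1^N(\alpha,t)\le\dots\le X_N^N(\alpha,t)$ be the ordered eigenvalues of $A^N(\alpha,t)^*A^N(\alpha,t)$ (all defined from the same family $B_{ij}$). A sequence $\{(\alpha^{(k)},t^{(k)})\}_{k=1}^m$ is a time-like path if for each $k<m$: $\alpha^{(k)}\le\alpha^{(k+1)}$, $t^{(k)}\le t^{(k+1)}$ and $(\alpha^{(k)},t^{(k)})\ne(\alpha^{(k+1)},t^{(k+1)})$. Markov processes here may be time-inhomogeneous. *)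

theory Defs
  imports
    "HOL-Probability.Probability"
    "HOL-Computational_Algebra.Fundamental_Theorem_Algebra"
    "Jordan_Normal_Form.Schur_Decomposition"
    "Jordan_Normal_Form.Char_Poly"
begin

text \<open>Only the times \<open>t \<ge> 0\<close> of a process \<open>real \<Rightarrow> 'w \<Rightarrow> _\<close> are relevant.  The initial value and
  the continuity of the paths are required almost surely.\<close>

definition standard_brownian_motion :: "'w measure \<Rightarrow> (real \<Rightarrow> 'w \<Rightarrow> real) \<Rightarrow> bool" where
  "standard_brownian_motion M b \<longleftrightarrow>
     (\<forall>t\<ge>0. b t \<in> borel_measurable M) \<and>
     (AE \<omega> in M. b 0 \<omega> = 0) \<and>
     (\<forall>(n::nat) \<tau>. 0 \<le> \<tau> 0 \<and> (\<forall>i<n. \<tau> i < \<tau> (Suc i)) \<longrightarrow>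
        prob_space.indep_vars M (\<lambda>_. borel) (\<lambda>i \<omega>. b (\<tau> (Suc i)) \<omega> - b (\<tau> i) \<omega>) {..<n}) \<and>
     (\<forall>s t. 0 \<le> s \<and> s < t \<longrightarrow>
        distributed M lborel (\<lambda>\<omega>. b t \<omega> - b s \<omega>) (normal_density 0 (sqrt (t - s)))) \<and>
     (AE \<omega> in M. continuous_on {0..} (\<lambda>t. b t \<omega>))"

text \<open>A process as a single random element of the path space, with the product \<open>\<sigma>\<close>-algebra;
  independence of processes is independence of these random elements.\<close>

definition path_of :: "(real \<Rightarrow> 'w \<Rightarrow> 'a) \<Rightarrow> 'w \<Rightarrow> real \<Rightarrow> 'a" where
  "path_of b = (\<lambda>\<omega>. \<lambda>t\<in>{0..}. b t \<omega>)"

abbreviation path_space :: "(real \<Rightarrow> 'a::topological_space) measure" where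
  "path_space \<equiv> PiM {0..} (\<lambda>_. borel)"

definition complex_brownian_motion :: "'w measure \<Rightarrow> (real \<Rightarrow> 'w \<Rightarrow> complex) \<Rightarrow> bool" where
  "complex_brownian_motion M B \<longleftrightarrow>
     (\<exists>b b'. standard_brownian_motion M b \<and> standard_brownian_motion M b' \<and>
        prob_space.indep_var M path_space (path_of b) path_space (path_of b') \<and>
        (\<forall>t\<ge>0. \<forall>\<omega>\<in>space M.
           B t \<omega> = complex_of_real (b t \<omega>) / complex_of_real (sqrt 2)
                 + \<i> * complex_of_real (b' t \<omega>) / complex_of_real (sqrt 2)))"

text \<open>All complex Brownian motions have the same law, so ``identically distributed'' needs no
  clause of its own.\<close>

definition iid_complex_brownian_motions ::
    "'w measure \<Rightarrow> (nat \<Rightarrow> nat \<Rightarrow> real \<Rightarrow> 'w \<Rightarrow> complex) \<Rightarrow> bool" where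
  "iid_complex_brownian_motions M B \<longleftrightarrow>
     (\<forall>i\<ge>1. \<forall>j\<ge>1. complex_brownian_motion M (B i j)) \<and>
     prob_space.indep_vars M (\<lambda>_. path_space) (\<lambda>(i, j). path_of (B i j)) ({1..} \<times> {1..})"

text \<open>Matrix entries are indexed from \<open>0\<close>, the Brownian motions from \<open>1\<close>.\<close>

definition brownian_matrix ::
    "(nat \<Rightarrow> nat \<Rightarrow> real \<Rightarrow> 'w \<Rightarrow> complex) \<Rightarrow> nat \<Rightarrow> nat \<Rightarrow> real \<Rightarrow> 'w \<Rightarrow> complex mat" where
  "brownian_matrix B N \<alpha> t \<omega> = Matrix.mat (N + \<alpha>) N (\<lambda>(i, j). B (Suc i) (Suc j) t \<omega>)"

text \<open>Eigenvalues are repeated according to multiplicity.  Taking real parts changes only the type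
  for matrices with real eigenvalues, in particular for \<open>A\<^sup>* A\<close>; see the lemmas below.\<close>

definition ordered_eigenvalues :: "complex mat \<Rightarrow> real list" where
  "ordered_eigenvalues A = sorted_list_of_multiset (image_mset Re (proots (char_poly A)))"

lemma mat_adjoint_sprod:
  fixes A :: "complex mat"
  assumes v: "v \<in> carrier_vec (dim_col A)" and w: "w \<in> carrier_vec (dim_row A)"
  shows "(mat_adjoint A *\<^sub>v w) \<bullet>c v = w \<bullet>c (A *\<^sub>v v)"
proof -
  have "(mat_adjoint A *\<^sub>v w) \<bullet>c v =
      (\<Sum>j<dim_col A. (\<Sum>i<dim_row A. cnj (A $$ (i, j)) * vec_index w i) * cnj (vec_index v j))"
    using v w
    by (simp add: scalar_prod_def mat_adjoint_def mat_of_rows_def lessThan_atLeast0 conjugate_complex_def)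
  also have "\<dots> = (\<Sum>i<dim_row A. vec_index w i * cnj (\<Sum>j<dim_col A. A $$ (i, j) * vec_index v j))"
    unfolding sum_distrib_left sum_distrib_right cnj_sum by (subst sum.swap) (simp add: mult_ac)
  also have "\<dots> = w \<bullet>c (A *\<^sub>v v)"
    using v w by (simp add: scalar_prod_def lessThan_atLeast0 conjugate_complex_def)
  finally show ?thesis .
qed

lemma adjoint_mult_carrier:
  fixes A :: "complex mat"
  shows "mat_adjoint A * A \<in> carrier_mat (dim_col A) (dim_col A)"
  by (rule carrier_matI) (simp_all add: mat_adjoint_def)

lemma proots_adjoint_mult:
  fixes A :: "complex mat"
  assumes x: "x \<in># proots (char_poly (mat_adjoint A * A))"
  shows "complex_of_real (Re x) = x" and "0 \<le> Re x"
proof -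
  let ?H = "mat_adjoint A * A" and ?n = "dim_col A"
  note H = adjoint_mult_carrier[of A]
  have "char_poly ?H \<noteq> 0" using degree_monic_char_poly[OF H] by auto
  with x have "eigenvalue ?H x" by (simp add: eigenvalue_root_char_poly[OF H])
  then obtain v where v: "v \<in> carrier_vec ?n" "v \<noteq> 0\<^sub>v ?n" and ev: "?H *\<^sub>v v = x \<cdot>\<^sub>v v"
    using H unfolding eigenvalue_def eigenvector_def by auto
  have Av: "A *\<^sub>v v \<in> carrier_vec (dim_row A)" by (rule carrier_vecI) simp
  have "x * (v \<bullet>c v) = (?H *\<^sub>v v) \<bullet>c v" using v unfolding ev by simp
  also have "?H *\<^sub>v v = mat_adjoint A *\<^sub>v (A *\<^sub>v v)"
    by (rule assoc_mult_mat_vec[OF _ _ v(1)]) (auto simp: mat_adjoint_def intro!: carrier_matI)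
  also have "\<dots> \<bullet>c v = (A *\<^sub>v v) \<bullet>c (A *\<^sub>v v)" by (rule mat_adjoint_sprod[OF v(1) Av])
  finally have eq: "x * (v \<bullet>c v) = (A *\<^sub>v v) \<bullet>c (A *\<^sub>v v)" .
  have "v \<bullet>c v > 0" using v by simp
  then have p: "v \<bullet>c v = complex_of_real p" "p > 0" if "p = Re (v \<bullet>c v)" for p
    unfolding that by (simp_all add: complex_eq_iff less_complex_def)
  have "(A *\<^sub>v v) \<bullet>c (A *\<^sub>v v) \<ge> 0" by (rule conjugate_square_ge_0_vec)
  then have q: "(A *\<^sub>v v) \<bullet>c (A *\<^sub>v v) = complex_of_real q" "q \<ge> 0"
    if "q = Re ((A *\<^sub>v v) \<bullet>c (A *\<^sub>v v))" for q
    unfolding that by (simp_all add: complex_eq_iff less_eq_complex_def)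
  obtain p q where pq: "p > 0" "q \<ge> 0" "x * complex_of_real p = complex_of_real q"
    using p[OF refl] q[OF refl] eq by metis
  then have "x = complex_of_real (q / p)" by (simp add: field_simps)
  with pq show "complex_of_real (Re x) = x" "0 \<le> Re x" by simp_all
qed

lemma char_poly_ordered_eigenvalues:
  fixes A :: "complex mat"
  shows "char_poly (mat_adjoint A * A) =
      (\<Prod>x\<leftarrow>ordered_eigenvalues (mat_adjoint A * A). [:- complex_of_real x, 1:])"
    and "length (ordered_eigenvalues (mat_adjoint A * A)) = dim_col A"
proof -
  let ?p = "char_poly (mat_adjoint A * A)"
  note p = degree_monic_char_poly[OF adjoint_mult_carrier[of A]]
  have "(\<Prod>x\<leftarrow>ordered_eigenvalues (mat_adjoint A * A). [:- complex_of_real x, 1:]) =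
      (\<Prod>x\<in>#proots ?p. [:- complex_of_real (Re x), 1:])"
    unfolding prod_mset_prod_list[symmetric] mset_map
    by (simp add: ordered_eigenvalues_def image_mset.compositionality comp_def)
  also have "\<dots> = (\<Prod>x\<in>#proots ?p. [:- x, 1:])"
    by (intro arg_cong[where f = prod_mset] image_mset_cong) (simp only: proots_adjoint_mult)
  also have "\<dots> = ?p" using complex_poly_decompose_multiset[of ?p] p by simp
  finally show "?p = (\<Prod>x\<leftarrow>ordered_eigenvalues (mat_adjoint A * A). [:- complex_of_real x, 1:])" ..
  have "length (ordered_eigenvalues (mat_adjoint A * A)) = size (proots ?p)"
    by (metis ordered_eigenvalues_def mset_sorted_list_of_multiset size_image_mset size_mset)
  then show "length (ordered_eigenvalues (mat_adjoint A * A)) = dim_col A"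
    using p by (simp add: size_proots_complex)
qed

definition squared_singular_values ::
    "(nat \<Rightarrow> nat \<Rightarrow> real \<Rightarrow> 'w \<Rightarrow> complex) \<Rightarrow> nat \<Rightarrow> nat \<Rightarrow> real \<Rightarrow> 'w \<Rightarrow> nat \<Rightarrow> real" where
  "squared_singular_values B N \<alpha> t \<omega> =
     (\<lambda>j\<in>{1..N}. ordered_eigenvalues
        (mat_adjoint (brownian_matrix B N \<alpha> t \<omega>) * brownian_matrix B N \<alpha> t \<omega>) ! (j - 1))"

definition time_like_path :: "nat \<Rightarrow> (nat \<Rightarrow> nat) \<Rightarrow> (nat \<Rightarrow> real) \<Rightarrow> bool" where
  "time_like_path m \<alpha> t \<longleftrightarrow>
     (\<forall>k\<in>{1..<m}. \<alpha> k \<le> \<alpha> (Suc k) \<and> t k \<le> t (Suc k) \<and> (\<alpha> k, t k) \<noteq> (\<alpha> (Suc k), t (Suc k)))"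

definition generated_algebra :: "'w measure \<Rightarrow> 's measure \<Rightarrow> (nat \<Rightarrow> 'w \<Rightarrow> 's) \<Rightarrow> nat set \<Rightarrow> 'w measure" where
  "generated_algebra M S X I =
     sigma (space M) (\<Union>i\<in>I. {X i -` E \<inter> space M | E. E \<in> sets S})"

text \<open>A possibly time-inhomogeneous Markov process \<open>X 1, \<dots>, X m\<close> with state space \<open>S\<close>, with respect
  to its natural filtration: \<open>P (X\<^sub>k\<^sub>+\<^sub>1 \<in> E | X\<^sub>1, \<dots>, X\<^sub>k) = P (X\<^sub>k\<^sub>+\<^sub>1 \<in> E | X\<^sub>k)\<close> almost surely.\<close>

definition markov_process :: "'w measure \<Rightarrow> 's measure \<Rightarrow> nat \<Rightarrow> (nat \<Rightarrow> 'w \<Rightarrow> 's) \<Rightarrow> bool" where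
  "markov_process M S m X \<longleftrightarrow>
     (\<forall>k\<in>{1..m}. X k \<in> measurable M S) \<and>
     (\<forall>k\<in>{1..<m}. \<forall>E\<in>sets S. AE \<omega> in M.
        real_cond_exp M (generated_algebra M S X {1..k}) (\<lambda>\<omega>. indicator E (X (Suc k) \<omega>)) \<omega> =
        real_cond_exp M (generated_algebra M S X {k}) (\<lambda>\<omega>. indicator E (X (Suc k) \<omega>)) \<omega>)"

end

theory Submission
  imports Defs "Jordan_Normal_Form.Spectral_Radius"
begin

text \<open>Fix a step of the path, from \<open>(\<alpha>, s)\<close> to \<open>(\<alpha>', u)\<close>, and let \<open>A\<close> be the matrix before the step, extended
  by zero rows to the size \<open>(N + \<alpha>') \<times> N\<close> of the matrix after the step.  The latter is \<open>A + D\<close>, where \<open>D\<close>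
  consists of the Brownian increments between \<open>s\<close> and \<open>u\<close> in the old rows, and of the values at time
  \<open>u\<close> in the new rows.  All matrices up to the present are functions of the paths of the old rows up
  to time \<open>s\<close>, and \<open>D\<close> is independent of these (\<open>past_innovation_indep\<close>).  Its entries are independent
  centred complex Gaussian variables whose variance depends only on whether the row is old or new
  (\<open>innovation_gaussian\<close>).

  Hence \<open>D\<close> and \<open>U\<^sup>* D V\<close> have the same law whenever \<open>U\<close> and \<open>V\<close> are unitary and \<open>U\<close> does not mix old
  rows with new ones (\<open>gaussian_rotation_invariant\<close>).  The singular value decomposition writes
  \<open>A V = U \<Sigma>\<close> with such \<open>U\<close> and \<open>V\<close>, where \<open>\<Sigma>\<close> is the diagonal matrix of the singular values.  The
  squared singular values of \<open>A + D\<close> are those of \<open>U\<^sup>* (A + D) V = \<Sigma> + U\<^sup>* D V\<close>, so for a fixed \<open>A\<close> they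
  have the same law as those of \<open>\<Sigma> + D\<close>: the conditional law of the next spectrum, given the whole
  Brownian past, is a function of the current spectrum only (\<open>spectrum_kernel_diagonal\<close>).

  The conditional expectation with respect to any \<open>\<sigma>\<close>-algebra that lies between the one of the current
  spectrum and the one of the Brownian past is then given by that same function
  (\<open>real_cond_exp_squared_singular_values\<close>).  The \<open>\<sigma>\<close>-algebras in the Markov property, of all spectra so
  far and of the current one, are two instances.

  Two facts of independent interest are needed on the way: ordered eigenvalues are measurable in the
  matrix entries, because they can be recovered from the traces of the powers of the matrix; and the
  law of a random vector is determined by its characteristic function, which reduces to the
  one-dimensional theorem of Levy one coordinate at a time.\<close>

section \<open>Unitary matrices and orthonormal systems\<close>

lemma dim_mat_adjoint [simp]:
  "dim_row (mat_adjoint A) = dim_col A" "dim_col (mat_adjoint A) = dim_row A"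
  by (simp_all add: mat_adjoint_def)

lemma mat_adjoint_carrier [simp]:
  "A \<in> carrier_mat m n \<Longrightarrow> mat_adjoint A \<in> carrier_mat n m"
  by auto

lemma index_mat_adjoint [simp]:
  fixes A :: "complex mat"
  shows "i < dim_col A \<Longrightarrow> j < dim_row A \<Longrightarrow> mat_adjoint A $$ (i, j) = cnj (A $$ (j, i))"
  by (simp add: mat_adjoint_def mat_of_rows_def)

lemma mat_adjoint_adjoint [simp]:
  fixes A :: "complex mat"
  shows "mat_adjoint (mat_adjoint A) = A"
  by (rule eq_matI) simp_all

lemma mat_adjoint_mult:
  fixes A :: "complex mat"
  assumes "A \<in> carrier_mat m n" "B \<in> carrier_mat n k"
  shows "mat_adjoint (A * B) = mat_adjoint B * mat_adjoint A"
  using assms by (intro eq_matI) (auto simp: scalar_prod_def mult.commute)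

definition unitary :: "nat \<Rightarrow> complex mat \<Rightarrow> bool" where
  "unitary n U \<longleftrightarrow> U \<in> carrier_mat n n \<and> mat_adjoint U * U = 1\<^sub>m n \<and> U * mat_adjoint U = 1\<^sub>m n"

lemma unitaryI:
  assumes "U \<in> carrier_mat n n" "mat_adjoint U * U = 1\<^sub>m n"
  shows "unitary n U"
  using assms mat_mult_left_right_inverse[of "mat_adjoint U" n U] by (simp add: unitary_def)

definition orthonormal_on :: "nat set \<Rightarrow> nat \<Rightarrow> (nat \<Rightarrow> complex vec) \<Rightarrow> bool" where
  "orthonormal_on S n u \<longleftrightarrow> (\<forall>i\<in>S. u i \<in> carrier_vec n) \<and>
     (\<forall>i\<in>S. \<forall>j\<in>S. u i \<bullet>c u j = (if i = j then 1 else 0))"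

lemma cscalar_prod_commute:
  fixes v w :: "complex vec"
  assumes "v \<in> carrier_vec n" "w \<in> carrier_vec n"
  shows "w \<bullet>c v = cnj (v \<bullet>c w)"
  using assms by (simp add: scalar_prod_def conjugate_complex_def mult.commute)

lemma exists_normalized:
  fixes v :: "complex vec"
  assumes "v \<in> carrier_vec n" "v \<noteq> 0\<^sub>v n"
  obtains c where "c \<noteq> 0" "(c \<cdot>\<^sub>v v) \<bullet>c (c \<cdot>\<^sub>v v) = 1"
proof -
  define p where "p = Re (v \<bullet>c v)"
  have "v \<bullet>c v > 0" using assms by simp
  then have p: "v \<bullet>c v = complex_of_real p" "p > 0"
    unfolding p_def by (simp_all add: complex_eq_iff less_complex_def)
  let ?c = "complex_of_real (1 / sqrt p)"
  have "(?c \<cdot>\<^sub>v v) \<bullet>c (?c \<cdot>\<^sub>v v) = ?c * ?c * (v \<bullet>c v)"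
    using assms by (simp add: conjugate_smult_vec)
  also have "\<dots> = complex_of_real (1 / sqrt p * (1 / sqrt p) * p)"
    unfolding p(1) by (simp only: of_real_mult)
  also have "1 / sqrt p * (1 / sqrt p) * p = 1"
    using p(2) by (simp add: field_simps)
  finally show thesis using p(2) by (intro that[of ?c]) auto
qed

text \<open>A vector orthogonal to the given ones exists because the matrix with their conjugates as rows, and
  zero rows at the missing indices, is singular.  Adding one index after the other fills the gaps of an
  orthonormal system at any prescribed positions.\<close>

lemma orthonormal_extension:
  assumes "S \<subseteq> {..<n}" "orthonormal_on S n u"
  shows "\<exists>u'. orthonormal_on {..<n} n u' \<and> (\<forall>i\<in>S. u' i = u i)"
  using assms
proof (induction "n - card S" arbitrary: S u)
  case 0
  have "card S \<ge> n" using 0 by simp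
  then have "S = {..<n}" using 0(2) by (metis card_lessThan card_seteq finite_lessThan)
  then show ?case using 0 by blast
next
  case (Suc k)
  have finS: "finite S" using Suc.prems(1) finite_subset by blast
  have "S \<noteq> {..<n}" using Suc.hyps(2) by auto
  then obtain l where l: "l < n" "l \<notin> S" using Suc.prems(1) by auto
  let ?A = "Matrix.mat n n (\<lambda>(i, j). if i \<in> S then cnj (u i $ j) else 0)"
  have "det ?A = 0"
  proof -
    have "?A = mat\<^sub>r n n (\<lambda>i. if i = l then 0\<^sub>v n else row ?A i)"
      using l by (intro eq_matI) auto
    also have "det \<dots> = 0" by (rule det_row_0[OF l(1)]) auto
    finally show ?thesis .
  qed
  then obtain v where v: "v \<in> carrier_vec n" "v \<noteq> 0\<^sub>v n" "?A *\<^sub>v v = 0\<^sub>v n"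
    using det_0_iff_vec_prod_zero[of ?A n] by auto
  obtain c where c: "(c \<cdot>\<^sub>v v) \<bullet>c (c \<cdot>\<^sub>v v) = 1" using exists_normalized[OF v(1,2)] by blast
  have perp: "v \<bullet>c u i = 0" if "i \<in> S" for i
  proof -
    have i: "i < n" and ui: "u i \<in> carrier_vec n"
      using that Suc.prems by (auto simp: orthonormal_on_def)
    have "v \<bullet>c u i = (?A *\<^sub>v v) $ i"
      using i that v(1) ui by (auto simp: scalar_prod_def conjugate_complex_def mult.commute)
    then show ?thesis using v(3) i by simp
  qed
  have perp': "u i \<bullet>c v = 0" if "i \<in> S" for i
    using perp[OF that] that Suc.prems(2) cscalar_prod_commute[OF v(1), of "u i"]
    by (auto simp: orthonormal_on_def)
  let ?u = "u(l := c \<cdot>\<^sub>v v)"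
  have on: "orthonormal_on (insert l S) n ?u"
    using Suc.prems(2) l v(1) c perp perp'
    by (auto simp: orthonormal_on_def conjugate_smult_vec)
  have "k = n - card (insert l S)" using Suc.hyps(2) l finS by simp
  then obtain u' where "orthonormal_on {..<n} n u'" "\<forall>i\<in>insert l S. u' i = ?u i"
    using Suc.hyps(1)[of "insert l S" ?u] on Suc.prems(1) l by auto
  then show ?case using l by (metis fun_upd_other insertI2)
qed

lemma unitary_of_orthonormal:
  assumes "orthonormal_on {..<n} n u"
  shows "unitary n (Matrix.mat n n (\<lambda>(i, j). u j $ i))" (is "unitary n ?U")
proof (rule unitaryI)
  show "mat_adjoint ?U * ?U = 1\<^sub>m n"
  proof (rule eq_matI)
    fix i j assume "i < dim_row (1\<^sub>m n :: complex mat)" "j < dim_col (1\<^sub>m n :: complex mat)"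
    then have ij: "i < n" "j < n" by auto
    then have c: "u i \<in> carrier_vec n" "u j \<in> carrier_vec n" using assms by (auto simp: orthonormal_on_def)
    have "(mat_adjoint ?U * ?U) $$ (i, j) = u j \<bullet>c u i"
      using ij c by (simp add: scalar_prod_def conjugate_complex_def mult.commute)
    then show "(mat_adjoint ?U * ?U) $$ (i, j) = 1\<^sub>m n $$ (i, j)"
      using ij assms by (auto simp: orthonormal_on_def)
  qed auto
qed simp

section \<open>Spectral theorem and singular value decomposition\<close>

text \<open>In an orthonormal basis that starts with the first \<open>k\<close> eigenvectors, a Hermitian matrix is block
  diagonal.  An eigenvector of the lower block gives the next eigenvector.\<close>

lemma hermitian_partial_eigenbasis:
  assumes H: "H \<in> carrier_mat n n" and herm: "mat_adjoint H = (H :: complex mat)" and "k \<le> n"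
  shows "\<exists>u d. orthonormal_on {..<k} n u \<and> (\<forall>i<k. H *\<^sub>v u i = d i \<cdot>\<^sub>v u i)"
  using \<open>k \<le> n\<close>
proof (induction k)
  case 0
  show ?case by (simp add: orthonormal_on_def)
next
  case (Suc k)
  then obtain u d where u: "orthonormal_on {..<k} n u" and ev: "\<And>i. i < k \<Longrightarrow> H *\<^sub>v u i = d i \<cdot>\<^sub>v u i"
    by auto
  have k: "k < n" using Suc.prems by simp
  obtain u' where u': "orthonormal_on {..<n} n u'" and u'_eq: "\<And>i. i < k \<Longrightarrow> u' i = u i"
    using orthonormal_extension[OF _ u] k by auto
  define Q where "Q = Matrix.mat n n (\<lambda>(i, j). u' j $ i)"
  have uQ: "unitary n Q" unfolding Q_def by (rule unitary_of_orthonormal[OF u'])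
  then have Q: "Q \<in> carrier_mat n n" "mat_adjoint Q \<in> carrier_mat n n"
    and QQ: "mat_adjoint Q * Q = 1\<^sub>m n" "Q * mat_adjoint Q = 1\<^sub>m n" by (auto simp: unitary_def)
  have Qe: "Q *\<^sub>v unit_vec n j = u j" if "j < k" for j
  proof -
    have "Q *\<^sub>v unit_vec n j = col Q j" using that k Q by (intro eq_vecI) auto
    also have "\<dots> = u' j"
    proof -
      have "u' j \<in> carrier_vec n" using that k u' by (simp add: orthonormal_on_def)
      then show ?thesis using that k by (intro eq_vecI) (auto simp: Q_def)
    qed
    finally show ?thesis using u'_eq[OF that] by simp
  qed
  define G where "G = mat_adjoint Q * (H * Q)"
  have G: "G \<in> carrier_mat n n" unfolding G_def by (intro mult_carrier_mat[of _ n n] Q H)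
  have G_vec: "G *\<^sub>v y = mat_adjoint Q *\<^sub>v (H *\<^sub>v (Q *\<^sub>v y))" if "y \<in> carrier_vec n" for y
  proof -
    have "G *\<^sub>v y = mat_adjoint Q *\<^sub>v ((H * Q) *\<^sub>v y)"
      unfolding G_def by (rule assoc_mult_mat_vec) (use Q H that in auto)
    also have "(H * Q) *\<^sub>v y = H *\<^sub>v (Q *\<^sub>v y)"
      by (rule assoc_mult_mat_vec) (use Q H that in auto)
    finally show ?thesis .
  qed
  have G_herm: "mat_adjoint G = G"
  proof -
    have "mat_adjoint G = mat_adjoint (H * Q) * mat_adjoint (mat_adjoint Q)"
      unfolding G_def by (rule mat_adjoint_mult) (use Q H in auto)
    also have "mat_adjoint (H * Q) = mat_adjoint Q * H"
      using mat_adjoint_mult[OF H Q(1)] herm by simp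
    finally show ?thesis unfolding G_def using assoc_mult_mat[OF Q(2) H Q(1)] by simp
  qed
  have G_low: "G $$ (i, j) = (if i = j then d j else 0)" if "i < n" "j < k" for i j
  proof -
    have "G *\<^sub>v unit_vec n j = mat_adjoint Q *\<^sub>v (d j \<cdot>\<^sub>v (Q *\<^sub>v unit_vec n j))"
      using that k by (simp add: G_vec Qe ev)
    also have "\<dots> = d j \<cdot>\<^sub>v (mat_adjoint Q *\<^sub>v (Q *\<^sub>v unit_vec n j))"
      by (rule mult_mat_vec[OF Q(2)]) (use Q in auto)
    also have "mat_adjoint Q *\<^sub>v (Q *\<^sub>v unit_vec n j) = (mat_adjoint Q * Q) *\<^sub>v unit_vec n j"
      by (rule assoc_mult_mat_vec[symmetric]) (use Q in auto)
    also have "\<dots> = unit_vec n j" unfolding QQ by simp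
    finally have "(G *\<^sub>v unit_vec n j) $ i = (d j \<cdot>\<^sub>v unit_vec n j) $ i" by simp
    then show ?thesis using that k G by (auto split: if_splits)
  qed
  have G_up: "G $$ (i, j) = 0" if "i < k" "k \<le> j" "j < n" for i j
  proof -
    have "G $$ (i, j) = mat_adjoint G $$ (i, j)" by (simp add: G_herm)
    also have "\<dots> = cnj (G $$ (j, i))" using that k G by simp
    finally show ?thesis using G_low[of j i] that by simp
  qed
  \<comment> \<open>The compression of \<open>H\<close> to the orthogonal complement of the first \<open>k\<close> eigenvectors.\<close>
  define H2 where "H2 = Matrix.mat (n - k) (n - k) (\<lambda>(i, j). G $$ (i + k, j + k))"
  have H2: "H2 \<in> carrier_mat (n - k) (n - k)" by (simp add: H2_def)
  obtain \<mu> y where y: "y \<in> carrier_vec (n - k)" "y \<noteq> 0\<^sub>v (n - k)" "H2 *\<^sub>v y = \<mu> \<cdot>\<^sub>v y"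
    using spectrum_non_empty[OF H2] k H2 unfolding spectrum_def eigenvalue_def eigenvector_def by auto
  define y' where "y' = vec n (\<lambda>i. if i < k then 0 else y $ (i - k))"
  have y': "y' \<in> carrier_vec n" by (simp add: y'_def)
  have Gy': "G *\<^sub>v y' = \<mu> \<cdot>\<^sub>v y'"
  proof (rule eq_vecI)
    fix i assume "i < dim_vec (\<mu> \<cdot>\<^sub>v y')"
    then have i: "i < n" by (simp add: y'_def)
    have "(G *\<^sub>v y') $ i = (\<Sum>j\<in>{0..<n}. G $$ (i, j) * y' $ j)"
      using i G y' by (simp add: scalar_prod_def)
    also have "\<dots> = (\<Sum>j\<in>{k..<n}. G $$ (i, j) * y $ (j - k))"
      by (rule sum.mono_neutral_cong_right) (auto simp: y'_def)
    also have "\<dots> = (\<Sum>j\<in>{0..<n - k}. G $$ (i, j + k) * y $ j)"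
      using sum.shift_bounds_nat_ivl[of "\<lambda>j. G $$ (i, j) * y $ (j - k)" 0 k "n - k"] k by simp
    also have "\<dots> = \<mu> * y' $ i"
    proof (cases "i < k")
      case True
      then show ?thesis by (simp add: y'_def i G_up)
    next
      case False
      then have "(\<Sum>j\<in>{0..<n - k}. G $$ (i, j + k) * y $ j) = (H2 *\<^sub>v y) $ (i - k)"
        using i y(1) H2 by (simp add: scalar_prod_def H2_def)
      also have "\<dots> = \<mu> * y' $ i" using False i y(1) unfolding y(3) by (simp add: y'_def)
      finally show ?thesis .
    qed
    finally show "(G *\<^sub>v y') $ i = (\<mu> \<cdot>\<^sub>v y') $ i" using i y' by simp
  qed (use G y' in auto)
  define v where "v = Q *\<^sub>v y'"
  have v: "v \<in> carrier_vec n" using Q y' by (simp add: v_def)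
  have Qv: "mat_adjoint Q *\<^sub>v v = y'"
  proof -
    have "mat_adjoint Q *\<^sub>v v = (mat_adjoint Q * Q) *\<^sub>v y'"
      unfolding v_def by (rule assoc_mult_mat_vec[symmetric]) (use Q y' in auto)
    then show ?thesis unfolding QQ using y' by simp
  qed
  have Hv: "H *\<^sub>v v = \<mu> \<cdot>\<^sub>v v"
  proof -
    have Hvc: "H *\<^sub>v v \<in> carrier_vec n" using H v by simp
    have "H *\<^sub>v v = (Q * mat_adjoint Q) *\<^sub>v (H *\<^sub>v v)" unfolding QQ using Hvc by simp
    also have "\<dots> = Q *\<^sub>v (mat_adjoint Q *\<^sub>v (H *\<^sub>v v))"
      by (rule assoc_mult_mat_vec) (use Q Hvc in auto)
    also have "mat_adjoint Q *\<^sub>v (H *\<^sub>v v) = \<mu> \<cdot>\<^sub>v y'" using G_vec[OF y'] Gy' by (simp add: v_def)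
    also have "Q *\<^sub>v (\<mu> \<cdot>\<^sub>v y') = \<mu> \<cdot>\<^sub>v v" unfolding v_def by (rule mult_mat_vec[OF Q(1) y'])
    finally show ?thesis .
  qed
  have "v \<noteq> 0\<^sub>v n"
  proof
    assume "v = 0\<^sub>v n"
    then have "y' = mat_adjoint Q *\<^sub>v 0\<^sub>v n" using Qv by simp
    then have "y' = 0\<^sub>v n" using Q(1) by (auto intro!: eq_vecI simp: scalar_prod_def)
    have "y = 0\<^sub>v (n - k)"
    proof (rule eq_vecI)
      fix i assume "i < dim_vec (0\<^sub>v (n - k) :: complex vec)"
      then have i: "i < n - k" by simp
      have "y' $ (i + k) = 0" using i \<open>y' = 0\<^sub>v n\<close> by simp
      then show "y $ i = 0\<^sub>v (n - k) $ i" using i by (simp add: y'_def)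
    qed (use y in auto)
    then show False using y(2) by simp
  qed
  then obtain c where c: "(c \<cdot>\<^sub>v v) \<bullet>c (c \<cdot>\<^sub>v v) = 1" using exists_normalized[OF v] by blast
  have perp: "v \<bullet>c u j = 0" if "j < k" for j
  proof -
    have "v \<bullet>c u j = (mat_adjoint Q *\<^sub>v v) \<bullet>c unit_vec n j"
      using mat_adjoint_sprod[of "unit_vec n j" Q v] Q v that by (simp add: Qe)
    also have "\<dots> = y' $ j" unfolding Qv using that k y'
      by (simp add: scalar_prod_def conjugate_complex_def unit_vec_def if_distrib sum.delta cong: if_cong)
    finally show ?thesis using that k by (simp add: y'_def)
  qed
  have perp': "u j \<bullet>c v = 0" if "j < k" for j
    using perp[OF that] that u cscalar_prod_commute[OF v, of "u j"] by (auto simp: orthonormal_on_def)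
  have "orthonormal_on {..<Suc k} n (u(k := c \<cdot>\<^sub>v v))"
    using u v c perp perp' by (auto simp: orthonormal_on_def conjugate_smult_vec less_Suc_eq)
  moreover have "H *\<^sub>v (c \<cdot>\<^sub>v v) = \<mu> \<cdot>\<^sub>v (c \<cdot>\<^sub>v v)"
    using mult_mat_vec[OF H v, of c] by (simp add: Hv smult_smult_assoc mult.commute)
  ultimately have "orthonormal_on {..<Suc k} n (u(k := c \<cdot>\<^sub>v v)) \<and>
      (\<forall>i<Suc k. H *\<^sub>v (u(k := c \<cdot>\<^sub>v v)) i = (d(k := \<mu>)) i \<cdot>\<^sub>v (u(k := c \<cdot>\<^sub>v v)) i)"
    using ev less_Suc_eq by simp
  then show ?case by blast
qed

lemma proots_prod_linear_factors:
  fixes xs :: "'a::idom list"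
  shows "proots (\<Prod>x\<leftarrow>xs. [:- x, 1:]) = mset xs"
proof (induction xs)
  case (Cons x xs)
  have "(\<Prod>x\<leftarrow>xs. [:- x, 1:]) \<noteq> 0" by (auto simp: prod_list_zero_iff)
  then have "proots ([:- x, 1:] * (\<Prod>x\<leftarrow>xs. [:- x, 1:])) = {#x#} + mset xs"
    by (subst proots_mult) (simp_all add: Cons.IH)
  then show ?case by simp
qed simp

text \<open>Diagonalisation determines the eigenvalues only as a multiset, by comparison of the characteristic
  polynomials.  A permutation puts them into any prescribed order.\<close>

lemma permutation_of_eigenvalues:
  assumes H: "H \<in> carrier_mat n n" and u: "orthonormal_on {..<n} n u"
    and ev: "\<And>i. i < n \<Longrightarrow> H *\<^sub>v u i = d i \<cdot>\<^sub>v u i"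
    and es: "char_poly H = (\<Prod>x\<leftarrow>es. [:- x, 1:])"
  obtains \<pi> where "\<pi> permutes {..<n}" "\<And>i. i < n \<Longrightarrow> d (\<pi> i) = es ! i" "length es = n"
proof -
  define Q where "Q = Matrix.mat n n (\<lambda>(i, j). u j $ i)"
  have "unitary n Q" unfolding Q_def by (rule unitary_of_orthonormal[OF u])
  then have Q: "Q \<in> carrier_mat n n" "mat_adjoint Q \<in> carrier_mat n n"
    and QQ: "mat_adjoint Q * Q = 1\<^sub>m n" "Q * mat_adjoint Q = 1\<^sub>m n" by (auto simp: unitary_def)
  define D where "D = Matrix.mat n n (\<lambda>(i, j). if i = j then d j else 0)"
  have D: "D \<in> carrier_mat n n" by (simp add: D_def)
  have HQ: "H * Q = Q * D"
  proof (rule eq_matI)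
    fix i j assume "i < dim_row (Q * D)" "j < dim_col (Q * D)"
    then have ij: "i < n" "j < n" using Q D by auto
    have uj: "u j \<in> carrier_vec n" using u ij by (simp add: orthonormal_on_def)
    have "col Q j = u j" using ij uj by (intro eq_vecI) (auto simp: Q_def)
    then have "(H * Q) $$ (i, j) = (H *\<^sub>v u j) $ i" using ij H Q by simp
    also have "\<dots> = u j $ i * d j" unfolding ev[OF ij(2)] using ij uj by (simp add: mult.commute)
    also have "\<dots> = (Q * D) $$ (i, j)"
      using ij by (simp add: Q_def D_def scalar_prod_def if_distrib sum.delta cong: if_cong)
    finally show "(H * Q) $$ (i, j) = (Q * D) $$ (i, j)" .
  qed (use H Q D in auto)
  have "H = H * (Q * mat_adjoint Q)" using H by (simp add: QQ)
  also have "\<dots> = Q * D * mat_adjoint Q"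
    using assoc_mult_mat[OF H Q] by (simp add: HQ)
  finally have "similar_mat_wit H D Q (mat_adjoint Q)" using H D Q QQ
    by (auto simp: similar_mat_wit_def Let_def simp del: assoc_mult_mat)
  then have "similar_mat H D" unfolding similar_mat_def by blast
  then have "char_poly H = char_poly D" by (rule char_poly_similar)
  also have "\<dots> = (\<Prod>a\<leftarrow>diag_mat D. [:- a, 1:])"
    by (rule char_poly_upper_triangular[OF D]) (auto simp: D_def)
  also have "diag_mat D = map d [0..<n]" by (auto simp: diag_mat_def D_def)
  finally have "(\<Prod>a\<leftarrow>map d [0..<n]. [:- a, 1:]) = (\<Prod>x\<leftarrow>es. [:- x, 1:])" using es by simp
  then have ms: "mset es = mset (map d [0..<n])" 
    using proots_prod_linear_factors[of "map d [0..<n]"] proots_prod_linear_factors[of es] by metis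
  then have len: "length es = n" by (metis length_map length_upt minus_nat.diff_0 size_mset)
  obtain \<pi> where \<pi>: "\<pi> permutes {..<length (map d [0..<n])}" "permute_list \<pi> (map d [0..<n]) = es"
    using mset_eq_permutation[OF ms] by auto
  show thesis
  proof (rule that[of \<pi>])
    show p: "\<pi> permutes {..<n}" using \<pi>(1) by simp
    fix i assume i: "i < n"
    then have "\<pi> i < n" using permutes_in_image[OF p, of i] by simp
    then show "d (\<pi> i) = es ! i"
      using i permute_list_nth[OF \<pi>(1), of i] by (simp add: \<pi>(2))
  qed (rule len)
qed

lemma ordered_eigenvalues_nonneg:
  "x \<in> set (ordered_eigenvalues (mat_adjoint A * A)) \<Longrightarrow> 0 \<le> x"
  using proots_adjoint_mult(2)[of _ A] by (auto simp: ordered_eigenvalues_def)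

lemma gram_eigenbasis:
  fixes A :: "complex mat"
  assumes A: "A \<in> carrier_mat m n"
  defines "es \<equiv> ordered_eigenvalues (mat_adjoint A * A)"
  obtains v where "orthonormal_on {..<n} n v" "length es = n"
    "\<And>i. i < n \<Longrightarrow> (mat_adjoint A * A) *\<^sub>v v i = complex_of_real (es ! i) \<cdot>\<^sub>v v i"
proof -
  let ?H = "mat_adjoint A * A"
  have Ad: "mat_adjoint A \<in> carrier_mat n m" using A by simp
  have H: "?H \<in> carrier_mat n n" by (rule mult_carrier_mat[OF Ad A])
  have herm: "mat_adjoint ?H = ?H" using mat_adjoint_mult[OF Ad A] by simp
  obtain u d where u: "orthonormal_on {..<n} n u" and ev: "\<And>i. i < n \<Longrightarrow> ?H *\<^sub>v u i = d i \<cdot>\<^sub>v u i"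
    using hermitian_partial_eigenbasis[OF H herm, of n] by auto
  have cp: "char_poly ?H = (\<Prod>x\<leftarrow>map complex_of_real es. [:- x, 1:])"
    unfolding es_def by (subst char_poly_ordered_eigenvalues(1)) (simp add: comp_def)
  obtain \<pi> where \<pi>: "\<pi> permutes {..<n}" and d\<pi>: "\<And>i. i < n \<Longrightarrow> d (\<pi> i) = map complex_of_real es ! i"
    and len: "length es = n"
    using permutation_of_eigenvalues[OF H u ev cp] by auto
  have \<pi>_less: "\<pi> i < n \<longleftrightarrow> i < n" for i using permutes_in_image[OF \<pi>, of i] by simp
  show thesis
  proof (rule that[of "u \<circ> \<pi>"])
    show "orthonormal_on {..<n} n (u \<circ> \<pi>)"
      using u permutes_inj[OF \<pi>] by (auto simp: orthonormal_on_def \<pi>_less inj_eq)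
    show "?H *\<^sub>v (u \<circ> \<pi>) i = complex_of_real (es ! i) \<cdot>\<^sub>v (u \<circ> \<pi>) i" if "i < n" for i
      using ev[of "\<pi> i"] that by (simp add: \<pi>_less d\<pi> len)
  qed (rule len)
qed

text \<open>The trace, computed in the eigenbasis.  Power sums of the eigenvalues are thus polynomials in the
  matrix entries and their conjugates, which is the source of measurability.\<close>

lemma trace_power_gram:
  fixes A :: "complex mat"
  assumes A: "A \<in> carrier_mat m n"
  defines "es \<equiv> ordered_eigenvalues (mat_adjoint A * A)"
  shows "(\<Sum>r<n. ((mat_adjoint A * A) ^\<^sub>m k) $$ (r, r)) = complex_of_real (\<Sum>i<n. (es ! i) ^ k)"
proof -
  let ?H = "mat_adjoint A * A"
  obtain v where v: "orthonormal_on {..<n} n v"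
    and ev: "\<And>i. i < n \<Longrightarrow> ?H *\<^sub>v v i = complex_of_real (es ! i) \<cdot>\<^sub>v v i"
    using gram_eigenbasis[OF A] unfolding es_def by blast
  have H: "?H \<in> carrier_mat n n" using A by (intro mult_carrier_mat[of _ _ m]) auto
  have Hk: "?H ^\<^sub>m k \<in> carrier_mat n n" for k using H by simp
  have vc: "v i \<in> carrier_vec n" if "i < n" for i using that v by (simp add: orthonormal_on_def)
  have evk: "(?H ^\<^sub>m k) *\<^sub>v v i = complex_of_real ((es ! i) ^ k) \<cdot>\<^sub>v v i" if i: "i < n" for i
  proof (induction k)
    case 0
    show ?case using vc[OF i] A H by simp
  next
    case (Suc k)
    have "(?H ^\<^sub>m Suc k) *\<^sub>v v i = (?H ^\<^sub>m k) *\<^sub>v (?H *\<^sub>v v i)"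
      using assoc_mult_mat_vec[OF Hk H vc[OF i]] by simp
    also have "\<dots> = complex_of_real (es ! i) \<cdot>\<^sub>v ((?H ^\<^sub>m k) *\<^sub>v v i)"
      unfolding ev[OF i] by (rule mult_mat_vec[OF Hk vc[OF i]])
    finally show ?case by (simp add: Suc.IH smult_smult_assoc)
  qed
  define V where "V = Matrix.mat n n (\<lambda>(i, j). v j $ i)"
  have V: "unitary n V" unfolding V_def by (rule unitary_of_orthonormal[OF v])
  have VV: "(\<Sum>i<n. v i $ s * cnj (v i $ r)) = (if s = r then 1 else 0)" if "r < n" "s < n" for r s
  proof -
    have "(\<Sum>i<n. v i $ s * cnj (v i $ r)) = (V * mat_adjoint V) $$ (s, r)"
      using that by (simp add: V_def scalar_prod_def lessThan_atLeast0)
    then show ?thesis using V that by (simp add: unitary_def)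
  qed
  have quad: "(K *\<^sub>v w) \<bullet>c w = (\<Sum>r<n. \<Sum>s<n. K $$ (r, s) * (w $ s * cnj (w $ r)))"
    if "K \<in> carrier_mat n n" "w \<in> carrier_vec n" for K and w :: "complex vec"
    using that by (simp add: scalar_prod_def conjugate_complex_def lessThan_atLeast0 sum_distrib_right mult.assoc)
  have "complex_of_real (\<Sum>i<n. (es ! i) ^ k) = (\<Sum>i<n. ((?H ^\<^sub>m k) *\<^sub>v v i) \<bullet>c v i)"
    unfolding of_real_sum
  proof (rule sum.cong[OF refl])
    fix i assume "i \<in> {..<n}"
    then have i: "i < n" by simp
    show "complex_of_real ((es ! i) ^ k) = ((?H ^\<^sub>m k) *\<^sub>v v i) \<bullet>c v i"
      unfolding evk[OF i] using vc[OF i] v i by (simp add: orthonormal_on_def)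
  qed
  also have "\<dots> = (\<Sum>i<n. \<Sum>r<n. \<Sum>s<n. (?H ^\<^sub>m k) $$ (r, s) * (v i $ s * cnj (v i $ r)))"
  proof (rule sum.cong[OF refl])
    fix i assume "i \<in> {..<n}"
    then show "((?H ^\<^sub>m k) *\<^sub>v v i) \<bullet>c v i = (\<Sum>r<n. \<Sum>s<n. (?H ^\<^sub>m k) $$ (r, s) * (v i $ s * cnj (v i $ r)))"
      using quad[OF Hk vc] by simp
  qed
  also have "\<dots> = (\<Sum>r<n. \<Sum>s<n. (?H ^\<^sub>m k) $$ (r, s) * (\<Sum>i<n. v i $ s * cnj (v i $ r)))"
    by (subst sum.swap, subst sum.swap[of _ "{..<n}" "{..<n}"]) (simp add: sum_distrib_left)
  also have "\<dots> = (\<Sum>r<n. (?H ^\<^sub>m k) $$ (r, r))"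
    by (simp add: VV if_distrib sum.delta cong: if_cong)
  finally show ?thesis ..
qed

lemma gram_unitary_left:
  assumes "A \<in> carrier_mat m n" "unitary m U"
  shows "mat_adjoint (U * A) * (U * A) = mat_adjoint A * A"
proof -
  have U: "U \<in> carrier_mat m m" "mat_adjoint U \<in> carrier_mat m m" and UU: "mat_adjoint U * U = 1\<^sub>m m"
    using assms(2) by (auto simp: unitary_def)
  have Ad: "mat_adjoint A \<in> carrier_mat n m" using assms(1) by simp
  have "mat_adjoint (U * A) * (U * A) = mat_adjoint A * (mat_adjoint U * (U * A))"
    unfolding mat_adjoint_mult[OF U(1) assms(1)]
    by (rule assoc_mult_mat[OF Ad U(2)]) (use U assms(1) in auto)
  also have "mat_adjoint U * (U * A) = A"
    using assoc_mult_mat[OF U(2,1) assms(1)] assms(1) by (simp add: UU)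
  finally show ?thesis .
qed

lemma ordered_eigenvalues_gram_unitary_right:
  assumes A: "A \<in> carrier_mat m n" and "unitary n V"
  shows "ordered_eigenvalues (mat_adjoint (A * V) * (A * V)) = ordered_eigenvalues (mat_adjoint A * A)"
proof -
  have V: "V \<in> carrier_mat n n" "mat_adjoint V \<in> carrier_mat n n"
    and VV: "mat_adjoint V * V = 1\<^sub>m n" "V * mat_adjoint V = 1\<^sub>m n"
    using assms(2) by (auto simp: unitary_def)
  have Ad: "mat_adjoint A \<in> carrier_mat n m" using A by simp
  have H: "mat_adjoint A * A \<in> carrier_mat n n" using mult_carrier_mat[OF Ad A] .
  have eq: "mat_adjoint (A * V) * (A * V) = mat_adjoint V * (mat_adjoint A * A) * V"
  proof -
    have "mat_adjoint (A * V) * (A * V) = mat_adjoint V * (mat_adjoint A * (A * V))"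
      unfolding mat_adjoint_mult[OF A V(1)]
      by (rule assoc_mult_mat[OF V(2) Ad]) (use V A in auto)
    also have "mat_adjoint A * (A * V) = (mat_adjoint A * A) * V"
      using assoc_mult_mat[OF Ad A V(1)] by simp
    also have "mat_adjoint V * ((mat_adjoint A * A) * V) = mat_adjoint V * (mat_adjoint A * A) * V"
      using assoc_mult_mat[OF V(2) H V(1)] by simp
    finally show ?thesis .
  qed
  have "mat_adjoint V * (mat_adjoint A * A) * V \<in> carrier_mat n n"
    by (intro mult_carrier_mat[of _ n n] V H)
  then have "similar_mat_wit (mat_adjoint (A * V) * (A * V)) (mat_adjoint A * A) (mat_adjoint V) V"
    unfolding eq using V VV H by (auto simp: similar_mat_wit_def Let_def)
  then show ?thesis
    unfolding ordered_eigenvalues_def by (metis char_poly_similar similar_mat_def)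
qed

text \<open>The vectors \<open>A v\<^sub>i\<close>, for an eigenbasis \<open>v\<close> of \<open>A\<^sup>* A\<close>, are orthogonal; those that do not vanish are
  normalised and completed to the columns of \<open>U\<close>.  If the rows of \<open>A\<close> from \<open>p\<close> on vanish, then the
  unit vectors with index at least \<open>p\<close> are orthogonal to all of them and can be fixed as columns
  beforehand.  This makes \<open>U\<close> block diagonal, so that it commutes with diagonal matrices that are
  constant on each of the two blocks of rows.\<close>

lemma singular_value_decomposition:
  fixes A :: "complex mat"
  assumes A: "A \<in> carrier_mat m n" and np: "n \<le> p" and pm: "p \<le> m"
    and zero: "\<And>i j. p \<le> i \<Longrightarrow> i < m \<Longrightarrow> j < n \<Longrightarrow> A $$ (i, j) = 0"
  defines "es \<equiv> ordered_eigenvalues (mat_adjoint A * A)"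
  obtains U V where "unitary m U" "unitary n V"
    "\<And>i j. i < m \<Longrightarrow> j < m \<Longrightarrow> (i < p) \<noteq> (j < p) \<Longrightarrow> U $$ (i, j) = 0"
    "A * V = U * Matrix.mat m n (\<lambda>(i, j). if i = j then complex_of_real (sqrt (es ! j)) else 0)"
proof -
  have Ad: "mat_adjoint A \<in> carrier_mat n m" using A by simp
  obtain v where v: "orthonormal_on {..<n} n v" and len: "length es = n"
    and evv: "\<And>i. i < n \<Longrightarrow> (mat_adjoint A * A) *\<^sub>v v i = complex_of_real (es ! i) \<cdot>\<^sub>v v i"
    using gram_eigenbasis[OF A] unfolding es_def by blast
  have vc: "v i \<in> carrier_vec n" if "i < n" for i using that v by (simp add: orthonormal_on_def)
  have es0: "0 \<le> es ! i" if "i < n" for i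
    using that ordered_eigenvalues_nonneg[of "es ! i" A] len by (simp add: es_def)
  define a where "a i = A *\<^sub>v v i" for i
  have a: "a i \<in> carrier_vec m" if "i < n" for i using A vc that by (simp add: a_def)
  have a_zero: "a i $ r = 0" if "i < n" "p \<le> r" "r < m" for i r
    using that A vc[OF that(1)] by (auto simp: a_def scalar_prod_def zero intro!: sum.neutral)
  have aa: "a i \<bullet>c a j = (if i = j then complex_of_real (es ! i) else 0)" if "i < n" "j < n" for i j
  proof -
    have "a i \<bullet>c a j = (mat_adjoint A *\<^sub>v a i) \<bullet>c v j"
      using mat_adjoint_sprod[of "v j" A "a i"] A vc a that by (simp add: a_def)
    also have "mat_adjoint A *\<^sub>v a i = complex_of_real (es ! i) \<cdot>\<^sub>v v i"
      unfolding evv[OF that(1), symmetric] a_def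
      by (rule assoc_mult_mat_vec[symmetric, OF Ad A vc[OF that(1)]])
    also have "(complex_of_real (es ! i) \<cdot>\<^sub>v v i) \<bullet>c v j = complex_of_real (es ! i) * (v i \<bullet>c v j)"
      using vc[OF that(1)] vc[OF that(2)] by simp
    finally show ?thesis using v that by (simp add: orthonormal_on_def)
  qed
  define w where "w i = (if i < n then complex_of_real (1 / sqrt (es ! i)) \<cdot>\<^sub>v a i else unit_vec m i)" for i
  \<comment> \<open>The indices whose column of \<open>U\<close> is prescribed: nonzero singular values, and the zero rows of \<open>A\<close>.\<close>
  define S where "S = {i. i < n \<and> es ! i \<noteq> 0} \<union> {p..<m}"
  have w_carrier: "w i \<in> carrier_vec m" for i using a by (simp add: w_def)
  have unit_w: "w i \<bullet>c unit_vec m r = w i $ r" if "r < m" for i r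
    using that w_carrier[of i]
    by (simp add: scalar_prod_def conjugate_complex_def unit_vec_def if_distrib sum.delta cong: if_cong)
  have ww: "w i \<bullet>c w j = (if i = j then 1 else 0)" if "i \<in> S" "j \<in> S" for i j
  proof -
    have "i < n \<or> p \<le> i \<and> i < m" "j < n \<or> p \<le> j \<and> j < m" using that by (auto simp: S_def)
    then consider "i < n" "j < n" | "i < n" "p \<le> j" "j < m" | "p \<le> i" "i < m" "j < n" 
      | "p \<le> i" "i < m" "p \<le> j" "j < m"
      by blast
    then show ?thesis
    proof cases
      case 1
      then have pos: "es ! i > 0" using that es0[of i] np by (auto simp: S_def)
      have "w i \<bullet>c w j = complex_of_real (1 / sqrt (es ! i)) * complex_of_real (1 / sqrt (es ! j)) * (a i \<bullet>c a j)"
        using 1 a[OF 1(1)] a[OF 1(2)] by (simp add: w_def conjugate_smult_vec)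
      also have "\<dots> = (if i = j then complex_of_real (1 / sqrt (es ! i) * (1 / sqrt (es ! i)) * es ! i) else 0)"
        by (simp only: aa[OF 1] of_real_mult mult_zero_right if_distrib[of "(*) _"] cong: if_cong)
      also have "1 / sqrt (es ! i) * (1 / sqrt (es ! i)) * es ! i = 1" using pos by (simp add: field_simps)
      finally show ?thesis by simp
    next
      case 2
      then have "w j = unit_vec m j" using np by (simp add: w_def)
      then show ?thesis using 2 np unit_w[of j i] a_zero[of i j] a[of i] by (simp add: w_def)
    next
      case 3
      then have "w i = unit_vec m i" using np by (simp add: w_def)
      then have "w j \<bullet>c w i = 0" using 3 np unit_w[of i j] a_zero[of j i] a[of j] by (simp add: w_def)
      then show ?thesis using 3 np cscalar_prod_commute[OF w_carrier[of j] w_carrier[of i]] by auto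
    next
      case 4
      then show ?thesis using np unit_w[of j i] by (simp add: w_def)
    qed
  qed
  have "orthonormal_on S m w" using w_carrier ww by (simp add: orthonormal_on_def)
  moreover have "S \<subseteq> {..<m}" using np pm by (auto simp: S_def)
  ultimately obtain w' where w': "orthonormal_on {..<m} m w'" and w'_eq: "\<And>i. i \<in> S \<Longrightarrow> w' i = w i"
    using orthonormal_extension[of S m w] by auto
  have w'c: "w' i \<in> carrier_vec m" if "i < m" for i using that w' by (simp add: orthonormal_on_def)
  have w'_unit: "w' i = unit_vec m i" if "p \<le> i" "i < m" for i
    using that np w'_eq[of i] by (simp add: S_def w_def)
  define U where "U = Matrix.mat m m (\<lambda>(i, j). w' j $ i)"
  define V where "V = Matrix.mat n n (\<lambda>(i, j). v j $ i)"
  let ?S = "Matrix.mat m n (\<lambda>(i, j). if i = j then complex_of_real (sqrt (es ! j)) else 0)"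
  show thesis
  proof (rule that[of U V])
    show "unitary m U" unfolding U_def by (rule unitary_of_orthonormal[OF w'])
    show "unitary n V" unfolding V_def by (rule unitary_of_orthonormal[OF v])
    show "U $$ (i, j) = 0" if ij: "i < m" "j < m" "(i < p) \<noteq> (j < p)" for i j
    proof (cases "p \<le> j")
      case True
      then show ?thesis using ij by (simp add: U_def w'_unit)
    next
      case False
      then have i: "p \<le> i" using ij by simp
      have "w' j $ i = w' j \<bullet>c unit_vec m i"
        using ij w'c[of j]
        by (simp add: scalar_prod_def conjugate_complex_def unit_vec_def if_distrib sum.delta cong: if_cong)
      also have "\<dots> = w' j \<bullet>c w' i" using ij i w'_unit[of i] by simp
      also have "\<dots> = 0" using w' ij False i by (auto simp: orthonormal_on_def)
      finally show ?thesis using ij by (simp add: U_def)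
    qed
    show "A * V = U * ?S"
    proof (rule eq_matI)
      fix i j assume "i < dim_row (U * ?S)" "j < dim_col (U * ?S)"
      then have ij: "i < m" "j < n" by (simp_all add: U_def)
      have "col V j = v j" using ij vc[of j] by (intro eq_vecI) (auto simp: V_def)
      then have "(A * V) $$ (i, j) = a j $ i" using ij A by (simp add: a_def V_def)
      also have "\<dots> = w' j $ i * complex_of_real (sqrt (es ! j))"
      proof (cases "es ! j = 0")
        case True
        then have "a j \<bullet>c a j = 0" using aa ij by simp
        then have "a j = 0\<^sub>v m" using a[OF ij(2)] by simp
        then show ?thesis using True ij by simp
      next
        case False
        then have "w' j = w j" using ij w'_eq by (simp add: S_def)
        then show ?thesis using False ij a[of j] by (simp add: w_def)
      qed
      also have "\<dots> = (U * ?S) $$ (i, j)"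
        using ij np pm by (simp add: U_def scalar_prod_def if_distrib sum.delta cong: if_cong)
      finally show "(A * V) $$ (i, j) = (U * ?S) $$ (i, j)" .
    qed (use A in \<open>auto simp: U_def V_def\<close>)
  qed
qed

section \<open>Measurability of the ordered eigenvalues\<close>

text \<open>The maximum norm is the limit of the \<open>k\<close>-norms.\<close>

lemma tendsto_root_power_sum:
  fixes a :: "nat \<Rightarrow> real"
  assumes a: "\<And>l. l \<le> i \<Longrightarrow> 0 \<le> a l" "\<And>l. l \<le> i \<Longrightarrow> a l \<le> a i"
  shows "(\<lambda>k. root (Suc k) (\<Sum>l\<le>i. a l ^ Suc k)) \<longlonglongrightarrow> a i"
proof (rule tendsto_sandwich)
  show "\<forall>\<^sub>F k in sequentially. a i \<le> root (Suc k) (\<Sum>l\<le>i. a l ^ Suc k)"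
  proof (intro always_eventually allI)
    fix k
    have "a i = root (Suc k) (a i ^ Suc k)" using real_root_power_cancel[of "Suc k" "a i"] a(1)[of i] by (simp only: order_refl simp_thms zero_less_Suc)
    also have "\<dots> \<le> root (Suc k) (\<Sum>l\<le>i. a l ^ Suc k)"
      using a by (intro real_root_le_mono member_le_sum) auto
    finally show "a i \<le> root (Suc k) (\<Sum>l\<le>i. a l ^ Suc k)" .
  qed
  show "\<forall>\<^sub>F k in sequentially. root (Suc k) (\<Sum>l\<le>i. a l ^ Suc k) \<le> root (Suc k) (real (Suc i)) * a i"
  proof (intro always_eventually allI)
    fix k
    have "(\<Sum>l\<le>i. a l ^ Suc k) \<le> (\<Sum>l\<le>i. a i ^ Suc k)" using a by (intro sum_mono power_mono) auto
    then have "root (Suc k) (\<Sum>l\<le>i. a l ^ Suc k) \<le> root (Suc k) (real (Suc i) * a i ^ Suc k)"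
      by (intro real_root_le_mono) auto
    also have "\<dots> = root (Suc k) (real (Suc i)) * a i"
      unfolding real_root_mult using real_root_power_cancel[of "Suc k" "a i"] a(1)[of i]
      by (simp only: order_refl simp_thms zero_less_Suc)
    finally show "root (Suc k) (\<Sum>l\<le>i. a l ^ Suc k) \<le> root (Suc k) (real (Suc i)) * a i" .
  qed
  have "(\<lambda>k. root k (real (Suc i))) \<longlonglongrightarrow> 1" by (rule LIMSEQ_root_const) simp
  then have "(\<lambda>k. root (Suc k) (real (Suc i))) \<longlonglongrightarrow> 1" by (rule LIMSEQ_Suc)
  from tendsto_mult[OF this tendsto_const]
  show "(\<lambda>k. root (Suc k) (real (Suc i)) * a i) \<longlonglongrightarrow> a i" by simp
qed simp

text \<open>The largest of the functions is the limit of the \<open>k\<close>-th roots of the power sums.  Once it is known to be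
  measurable, subtracting its powers leaves the power sums of the others, so the functions are treated
  from the largest to the smallest.\<close>

lemma measurable_of_power_sums:
  fixes f :: "nat \<Rightarrow> 'a \<Rightarrow> real"
  assumes nonneg: "\<And>i x. i < n \<Longrightarrow> x \<in> space M \<Longrightarrow> 0 \<le> f i x"
    and mono: "\<And>i j x. i \<le> j \<Longrightarrow> j < n \<Longrightarrow> x \<in> space M \<Longrightarrow> f i x \<le> f j x"
    and pow: "\<And>k. (\<lambda>x. \<Sum>i<n. f i x ^ k) \<in> borel_measurable M"
    and "i < n"
  shows "f i \<in> borel_measurable M"
  using \<open>i < n\<close>
proof (induction "n - i" arbitrary: i rule: less_induct)
  case less
  have larger: "f l \<in> borel_measurable M" if "l \<in> {i<..<n}" for l
    using less(1)[of l] that less(2) by auto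
  have meas: "(\<lambda>x. \<Sum>l\<le>i. f l x ^ k) \<in> borel_measurable M" for k
  proof -
    have "(\<lambda>x. (\<Sum>l<n. f l x ^ k) - (\<Sum>l\<in>{i<..<n}. f l x ^ k)) \<in> borel_measurable M"
      using larger by (intro borel_measurable_diff pow borel_measurable_sum borel_measurable_power) auto
    moreover have "(\<Sum>l\<le>i. f l x ^ k) = (\<Sum>l<n. f l x ^ k) - (\<Sum>l\<in>{i<..<n}. f l x ^ k)" for x
    proof -
      have "{..<n} = {..i} \<union> {i<..<n}" using less(2) by auto
      moreover have "{..i} \<inter> {i<..<n} = {}" by auto
      ultimately show ?thesis by (simp add: sum.union_disjoint)
    qed
    ultimately show ?thesis by simp
  qed
  show ?case
  proof (rule borel_measurable_LIMSEQ_real)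
    show "(\<lambda>k. root (Suc k) (\<Sum>l\<le>i. f l x ^ Suc k)) \<longlonglongrightarrow> f i x" if "x \<in> space M" for x
      using that less(2) by (intro tendsto_root_power_sum nonneg mono) auto
    show "(\<lambda>x. root (Suc k) (\<Sum>l\<le>i. f l x ^ Suc k)) \<in> borel_measurable M" for k
      using meas[of "Suc k"] by measurable
  qed
qed

lemma borel_measurable_cnj [measurable]: "cnj \<in> borel_measurable borel"
  by (intro borel_measurable_continuous_onI continuous_intros)

definition entry_measurable :: "'a measure \<Rightarrow> nat \<Rightarrow> nat \<Rightarrow> ('a \<Rightarrow> complex mat) \<Rightarrow> bool" where
  "entry_measurable M m n F \<longleftrightarrow> (\<forall>x. F x \<in> carrier_mat m n) \<and>
     (\<forall>i<m. \<forall>j<n. (\<lambda>x. F x $$ (i, j)) \<in> borel_measurable M)"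

lemma entry_measurable_mult:
  assumes "entry_measurable M a b F" "entry_measurable M b c G"
  shows "entry_measurable M a c (\<lambda>x. F x * G x)"
proof -
  have car: "F x \<in> carrier_mat a b" "G x \<in> carrier_mat b c" for x
    using assms by (auto simp: entry_measurable_def)
  have "(\<lambda>x. (F x * G x) $$ (i, j)) \<in> borel_measurable M" if "i < a" "j < c" for i j
  proof -
    have "(F x * G x) $$ (i, j) = (\<Sum>l<b. F x $$ (i, l) * G x $$ (l, j))" for x
      using car[of x] that by (simp add: scalar_prod_def lessThan_atLeast0)
    then show ?thesis using assms that by (auto simp: entry_measurable_def intro!: borel_measurable_sum borel_measurable_times)
  qed
  then show ?thesis using mult_carrier_mat[OF car] by (simp add: entry_measurable_def)
qed

lemma entry_measurable_adjoint:
  assumes "entry_measurable M a b F"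
  shows "entry_measurable M b a (\<lambda>x. mat_adjoint (F x))"
proof -
  have car: "F x \<in> carrier_mat a b" for x using assms by (auto simp: entry_measurable_def)
  have "(\<lambda>x. mat_adjoint (F x) $$ (i, j)) \<in> borel_measurable M" if "i < b" "j < a" for i j
  proof -
    have "mat_adjoint (F x) $$ (i, j) = cnj (F x $$ (j, i))" for x using car[of x] that by simp
    moreover have "(\<lambda>x. F x $$ (j, i)) \<in> borel_measurable M" 
      using assms that by (simp add: entry_measurable_def)
    ultimately show ?thesis by simp
  qed
  then show ?thesis using car by (simp add: entry_measurable_def)
qed

lemma entry_measurable_power:
  assumes F: "entry_measurable M n n F"
  shows "entry_measurable M n n (\<lambda>x. F x ^\<^sub>m k)"
proof (induction k)
  case 0
  have car: "F x \<in> carrier_mat n n" for x using F by (auto simp: entry_measurable_def)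
  then have "F x ^\<^sub>m 0 = 1\<^sub>m n" for x by (metis carrier_matD(1) pow_mat.simps(1))
  then show ?case by (simp add: entry_measurable_def)
next
  case (Suc k)
  then show ?case using entry_measurable_mult[OF Suc F] by simp
qed

text \<open>Random matrices are handled as families of entries in a product space.  The indices start from 1,
  like those of the Brownian motions.\<close>

definition matrix_of :: "nat \<Rightarrow> nat \<Rightarrow> (nat \<times> nat \<Rightarrow> complex) \<Rightarrow> complex mat" where
  "matrix_of m n z = Matrix.mat m n (\<lambda>(i, j). z (Suc i, Suc j))"

abbreviation entry_space :: "nat \<Rightarrow> nat \<Rightarrow> (nat \<times> nat \<Rightarrow> complex) measure" where
  "entry_space m n \<equiv> PiM ({1..m} \<times> {1..n}) (\<lambda>_. borel)"

definition gram_spectrum :: "nat \<Rightarrow> nat \<Rightarrow> (nat \<times> nat \<Rightarrow> complex) \<Rightarrow> nat \<Rightarrow> real" where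
  "gram_spectrum m n z =
     (\<lambda>j\<in>{1..n}. ordered_eigenvalues (mat_adjoint (matrix_of m n z) * matrix_of m n z) ! (j - 1))"

lemma matrix_of_carrier [simp]: "matrix_of m n z \<in> carrier_mat m n"
  by (simp add: matrix_of_def)

lemma matrix_of_index [simp]: "i < m \<Longrightarrow> j < n \<Longrightarrow> matrix_of m n z $$ (i, j) = z (Suc i, Suc j)"
  by (simp add: matrix_of_def)

lemma dim_matrix_of [simp]: "dim_row (matrix_of m n z) = m" "dim_col (matrix_of m n z) = n"
  by (simp_all add: matrix_of_def)

lemma gram_spectrum_measurable [measurable]:
  "gram_spectrum m n \<in> measurable (entry_space m n) (PiM {1..n} (\<lambda>_. borel))"
proof -
  let ?es = "\<lambda>z. ordered_eigenvalues (mat_adjoint (matrix_of m n z) * matrix_of m n z)"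
  have len: "length (?es z) = n" for z using char_poly_ordered_eigenvalues(2)[of "matrix_of m n z"] by simp
  have "(\<lambda>z. matrix_of m n z $$ (i, j)) \<in> borel_measurable (entry_space m n)" if "i < m" "j < n" for i j
    using that by simp
  then have "entry_measurable (entry_space m n) m n (matrix_of m n)"
    by (simp add: entry_measurable_def)
  then have *: "entry_measurable (entry_space m n) n n (\<lambda>z. (mat_adjoint (matrix_of m n z) * matrix_of m n z) ^\<^sub>m k)" for k
    by (intro entry_measurable_power entry_measurable_mult entry_measurable_adjoint)
  have "(\<lambda>z. ?es z ! i) \<in> borel_measurable (entry_space m n)" if "i < n" for i
  proof (rule measurable_of_power_sums[OF _ _ _ that])
    show "0 \<le> ?es z ! i" if "i < n" for i z
      using that len[of z] by (intro ordered_eigenvalues_nonneg[of _ "matrix_of m n z"] nth_mem) simp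
    show "?es z ! i \<le> ?es z ! j" if "i \<le> j" "j < n" for i j z
      using that len[of z] by (intro sorted_nth_mono) (auto simp: ordered_eigenvalues_def)
    show "(\<lambda>z. \<Sum>i<n. (?es z ! i) ^ k) \<in> borel_measurable (entry_space m n)" for k
    proof -
      have "(\<Sum>i<n. (?es z ! i) ^ k) =
          Re (\<Sum>r<n. ((mat_adjoint (matrix_of m n z) * matrix_of m n z) ^\<^sub>m k) $$ (r, r))" for z
        by (subst trace_power_gram[OF matrix_of_carrier]) simp
      moreover have "(\<lambda>z. Re (\<Sum>r<n. ((mat_adjoint (matrix_of m n z) * matrix_of m n z) ^\<^sub>m k) $$ (r, r)))
          \<in> borel_measurable (entry_space m n)"
        using *[of k] by (intro measurable_compose[OF _ borel_measurable_Re] borel_measurable_sum) (auto simp: entry_measurable_def)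
      ultimately show ?thesis by (simp only:)
    qed
  qed
  then show ?thesis unfolding gram_spectrum_def[abs_def] by (intro measurable_restrict) auto
qed

section \<open>Uniqueness of characteristic functions of random vectors\<close>

text \<open>After normalisation, the weight is a probability density, and this is the uniqueness theorem for the
  law of \<open>X\<close> under the changed measure.\<close>

lemma weighted_law_eqI_nonneg:
  fixes X :: "'a \<Rightarrow> real" and Y :: "'b \<Rightarrow> real" and f :: "'a \<Rightarrow> real" and g :: "'b \<Rightarrow> real"
  assumes M: "prob_space M" and M': "prob_space M'"
    and X [measurable]: "X \<in> borel_measurable M" and Y [measurable]: "Y \<in> borel_measurable M'"
    and f [measurable]: "f \<in> borel_measurable M" and g [measurable]: "g \<in> borel_measurable M'"
    and f0: "\<And>x. 0 \<le> f x" "\<And>x. f x \<le> C" and g0: "\<And>x. 0 \<le> g x" "\<And>x. g x \<le> C"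
    and eq: "\<And>t. (\<integral>x. complex_of_real (f x) * iexp (t * X x) \<partial>M) = (\<integral>x. complex_of_real (g x) * iexp (t * Y x) \<partial>M')"
    and A [measurable]: "A \<in> sets borel"
  shows "(\<integral>x. f x * indicator A (X x) \<partial>M) = (\<integral>x. g x * indicator A (Y x) \<partial>M')"
proof -
  interpret M: prob_space M by fact
  interpret M': prob_space M' by fact
  have fint: "integrable M f" using f0 by (intro M.integrable_const_bound[of _ C]) auto
  have gint: "integrable M' g" using g0 by (intro M'.integrable_const_bound[of _ C]) auto
  define c where "c = (\<integral>x. f x \<partial>M)"
  have "complex_of_real c = complex_of_real (\<integral>x. g x \<partial>M')" using eq[of 0] by (simp add: c_def)
  then have c': "c = (\<integral>x. g x \<partial>M')" by simp
  show ?thesis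
  proof (cases "c = 0")
    case True
    have "AE x in M. f x = 0" "AE x in M'. g x = 0"
      using integral_nonneg_eq_0_iff_AE[OF fint] integral_nonneg_eq_0_iff_AE[OF gint] f0 g0 True c'
      by (auto simp: c_def)
    then have "(\<integral>x. f x * indicator A (X x) \<partial>M) = 0"
      and "(\<integral>x. g x * indicator A (Y x) \<partial>M') = 0"
      by (auto intro!: integral_eq_zero_AE)
    then show ?thesis by simp
  next
    case False
    have "c \<ge> 0" unfolding c_def using f0 by (intro integral_nonneg_AE) auto
    with False have c: "c > 0" by simp
    define P where "P = distr (density M (\<lambda>x. ennreal (f x / c))) borel X"
    define Q where "Q = distr (density M' (\<lambda>x. ennreal (g x / c))) borel Y"
    have "(\<integral>\<^sup>+x. ennreal (f x / c) \<partial>M) = ennreal (\<integral>x. f x / c \<partial>M)"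
      using fint f0 c by (intro nn_integral_eq_integral) auto
    then have pf: "prob_space (density M (\<lambda>x. ennreal (f x / c)))"
      using c by (intro prob_spaceI) (simp add: emeasure_density c_def[symmetric] cong: nn_integral_cong)
    have "(\<integral>\<^sup>+x. ennreal (g x / c) \<partial>M') = ennreal (\<integral>x. g x / c \<partial>M')"
      using gint g0 c by (intro nn_integral_eq_integral) auto
    then have pg: "prob_space (density M' (\<lambda>x. ennreal (g x / c)))"
      using c by (intro prob_spaceI) (simp add: emeasure_density c'[symmetric] cong: nn_integral_cong)
    have P: "real_distribution P" unfolding P_def
      by (rule prob_space.real_distribution_distr[OF pf]) simp
    have Q: "real_distribution Q" unfolding Q_def
      by (rule prob_space.real_distribution_distr[OF pg]) simp
    have cP: "char P t = (\<integral>x. complex_of_real (f x) * iexp (t * X x) \<partial>M) / c" for t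
    proof -
      have "char P t = (\<integral>x. iexp (t * X x) \<partial>density M (\<lambda>x. ennreal (f x / c)))"
        unfolding char_def P_def by (rule integral_distr) auto
      also have "\<dots> = (\<integral>x. (f x / c) *\<^sub>R iexp (t * X x) \<partial>M)"
        using f0 c by (intro integral_density) auto
      also have "\<dots> = (\<integral>x. complex_of_real (f x) * iexp (t * X x) / c \<partial>M)"
        by (simp add: scaleR_conv_of_real)
      finally show ?thesis by simp
    qed
    have cQ: "char Q t = (\<integral>x. complex_of_real (g x) * iexp (t * Y x) \<partial>M') / c" for t
    proof -
      have "char Q t = (\<integral>x. iexp (t * Y x) \<partial>density M' (\<lambda>x. ennreal (g x / c)))"
        unfolding char_def Q_def by (rule integral_distr) auto
      also have "\<dots> = (\<integral>x. (g x / c) *\<^sub>R iexp (t * Y x) \<partial>M')"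
        using g0 c by (intro integral_density) auto
      also have "\<dots> = (\<integral>x. complex_of_real (g x) * iexp (t * Y x) / c \<partial>M')"
        by (simp add: scaleR_conv_of_real)
      finally show ?thesis by simp
    qed
    have PQ: "P = Q" by (rule Levy_uniqueness[OF P Q]) (rule ext, simp only: cP cQ eq)
    have "(\<integral>x. indicator A x \<partial>P) = (\<integral>x. f x * indicator A (X x) \<partial>M) / c"
    proof -
      have "(\<integral>x. indicator A x \<partial>P) = (\<integral>x. (indicator A (X x) :: real) \<partial>density M (\<lambda>x. ennreal (f x / c)))"
        unfolding P_def by (rule integral_distr) auto
      also have "\<dots> = (\<integral>x. (f x / c) *\<^sub>R indicator A (X x) \<partial>M)"
        using f0 c by (intro integral_density) auto
      finally show ?thesis by simp
    qed
    moreover have "(\<integral>x. indicator A x \<partial>Q) = (\<integral>x. g x * indicator A (Y x) \<partial>M') / c"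
    proof -
      have "(\<integral>x. indicator A x \<partial>Q) = (\<integral>x. (indicator A (Y x) :: real) \<partial>density M' (\<lambda>x. ennreal (g x / c)))"
        unfolding Q_def by (rule integral_distr) auto
      also have "\<dots> = (\<integral>x. (g x / c) *\<^sub>R indicator A (Y x) \<partial>M')"
        using g0 c by (intro integral_density) auto
      finally show ?thesis by simp
    qed
    ultimately show ?thesis using PQ c by simp
  qed
qed

lemma (in prob_space) integrable_mult_bounded:
  fixes h k :: "'a \<Rightarrow> 'b::{real_normed_algebra, second_countable_topology, banach}"
  assumes [measurable]: "h \<in> borel_measurable M" "k \<in> borel_measurable M"
    and "\<And>x. norm (h x) \<le> 1" "\<And>x. norm (k x) \<le> 1"
  shows "integrable M (\<lambda>x. h x * k x)"
  using assms(3,4)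
  by (intro integrable_const_bound[of _ 1] AE_I2 order_trans[OF norm_mult_ineq] mult_le_one) auto

lemma integral_add_Re_mult:
  fixes p :: "'a \<Rightarrow> real" and f k :: "'a \<Rightarrow> complex"
  assumes L: "prob_space L"
    and [measurable]: "p \<in> borel_measurable L" "f \<in> borel_measurable L" "k \<in> borel_measurable L"
    and "\<And>x. \<bar>p x\<bar> \<le> 1" "\<And>x. norm (f x) \<le> 1" "\<And>x. norm (k x) \<le> 1"
  shows "(\<integral>x. complex_of_real (p x + Re (u * f x)) * k x \<partial>L) =
    (\<integral>x. of_real (p x) * k x \<partial>L) + (u / 2) * (\<integral>x. f x * k x \<partial>L) + (cnj u / 2) * (\<integral>x. cnj (f x) * k x \<partial>L)"
proof -
  interpret prob_space L by fact
  have "integrable L (\<lambda>x. of_real (p x) * k x)" "integrable L (\<lambda>x. f x * k x)" "integrable L (\<lambda>x. cnj (f x) * k x)"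
    using assms(5-7) by (intro integrable_mult_bounded; simp)+
  moreover have "complex_of_real (p x + Re (u * f x)) * k x =
      of_real (p x) * k x + (u / 2) * (f x * k x) + (cnj u / 2) * (cnj (f x) * k x)" for x
  proof -
    have "complex_of_real (Re (u * f x)) = (u * f x + cnj (u * f x)) / 2" by (simp add: complex_eq_iff)
    then show ?thesis unfolding of_real_add by (simp only:) (simp add: algebra_simps add_divide_distrib)
  qed
  ultimately show ?thesis by simp
qed

text \<open>For a complex weight \<open>f\<close> dominated by \<open>p\<close>, the real functions \<open>p + Re (u f)\<close> with \<open>u\<close> of modulus 1 are
  nonnegative weights, and \<open>u = 1, -1, \<i>, -\<i>\<close> recover \<open>f\<close>.  The hypothesis for the conjugate of \<open>f\<close> comes
  from conjugating the one for \<open>f\<close> and replacing \<open>t\<close> by \<open>-t\<close>.\<close>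

lemma weighted_law_eqI:
  fixes X :: "'a \<Rightarrow> real" and Y :: "'b \<Rightarrow> real" and f :: "'a \<Rightarrow> complex" and g :: "'b \<Rightarrow> complex"
  assumes M: "prob_space M" and M': "prob_space M'"
    and X [measurable]: "X \<in> borel_measurable M" and Y [measurable]: "Y \<in> borel_measurable M'"
    and f [measurable]: "f \<in> borel_measurable M" and g [measurable]: "g \<in> borel_measurable M'"
    and p [measurable]: "p \<in> borel_measurable M" and q [measurable]: "q \<in> borel_measurable M'"
    and f0: "\<And>x. norm (f x) \<le> p x" "\<And>x. p x \<le> 1" and g0: "\<And>x. norm (g x) \<le> q x" "\<And>x. q x \<le> 1"
    and eq: "\<And>t. (\<integral>x. f x * iexp (t * X x) \<partial>M) = (\<integral>x. g x * iexp (t * Y x) \<partial>M')"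
    and eq': "\<And>t. (\<integral>x. complex_of_real (p x) * iexp (t * X x) \<partial>M) = (\<integral>x. complex_of_real (q x) * iexp (t * Y x) \<partial>M')"
    and A [measurable]: "A \<in> sets borel"
  shows "(\<integral>x. f x * indicator A (X x) \<partial>M) = (\<integral>x. g x * indicator A (Y x) \<partial>M')"
proof -
  interpret M: prob_space M by fact
  interpret M': prob_space M' by fact
  have norm_f: "norm (f x) \<le> 1" for x using f0[of x] by simp
  have norm_g: "norm (g x) \<le> 1" for x using g0[of x] by simp
  have p0: "0 \<le> p x" for x using f0(1)[of x] norm_ge_zero[of "f x"] by linarith
  have q0: "0 \<le> q x" for x using g0(1)[of x] norm_ge_zero[of "g x"] by linarith
  have abs_p: "\<bar>p x\<bar> \<le> 1" for x using p0[of x] f0(2)[of x] by simp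
  have abs_q: "\<bar>q x\<bar> \<le> 1" for x using q0[of x] g0(2)[of x] by simp
  note ints = M.integrable_mult_bounded M'.integrable_mult_bounded abs_p abs_q norm_f norm_g
  have cnj_eq: "(\<integral>x. cnj (f x) * iexp (t * X x) \<partial>M) = (\<integral>x. cnj (g x) * iexp (t * Y x) \<partial>M')" for t
  proof -
    have "(\<integral>x. cnj (f x) * iexp (t * X x) \<partial>M) = (\<integral>x. cnj (f x * iexp (- t * X x)) \<partial>M)"
      by (simp add: exp_cnj)
    also have "\<dots> = cnj (\<integral>x. f x * iexp (- t * X x) \<partial>M)" by (rule Bochner_Integration.integral_cnj)
    also have "\<dots> = cnj (\<integral>x. g x * iexp (- t * Y x) \<partial>M')" by (simp only: eq)
    also have "\<dots> = (\<integral>x. cnj (g x * iexp (- t * Y x)) \<partial>M')" by (rule Bochner_Integration.integral_cnj[symmetric])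
    also have "\<dots> = (\<integral>x. cnj (g x) * iexp (t * Y x) \<partial>M')"
      by (simp add: exp_cnj)
    finally show ?thesis .
  qed
  have weight: "(\<integral>x. (p x + Re (u * f x)) * indicator A (X x) \<partial>M) = (\<integral>x. (q x + Re (u * g x)) * indicator A (Y x) \<partial>M')"
    if u: "norm u = 1" for u
  proof (rule weighted_law_eqI_nonneg[OF M M' X Y, where C = 2])
    have nf: "\<bar>Re (u * f x)\<bar> \<le> p x" for x
      using abs_Re_le_cmod[of "u * f x"] f0(1)[of x] u by (simp add: norm_mult)
    have ng: "\<bar>Re (u * g x)\<bar> \<le> q x" for x
      using abs_Re_le_cmod[of "u * g x"] g0(1)[of x] u by (simp add: norm_mult)
    show "0 \<le> p x + Re (u * f x)" "p x + Re (u * f x) \<le> 2" for x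
      using nf[of x] f0(2)[of x] by linarith+
    show "0 \<le> q x + Re (u * g x)" "q x + Re (u * g x) \<le> 2" for x
      using ng[of x] g0(2)[of x] by linarith+
    fix t
    have "(\<integral>x. complex_of_real (p x + Re (u * f x)) * iexp (t * X x) \<partial>M) =
        (\<integral>x. of_real (p x) * iexp (t * X x) \<partial>M) + (u / 2) * (\<integral>x. f x * iexp (t * X x) \<partial>M)
        + (cnj u / 2) * (\<integral>x. cnj (f x) * iexp (t * X x) \<partial>M)"
      by (rule integral_add_Re_mult[OF M]) (use ints in auto)
    also have "\<dots> = (\<integral>x. of_real (q x) * iexp (t * Y x) \<partial>M') + (u / 2) * (\<integral>x. g x * iexp (t * Y x) \<partial>M')
        + (cnj u / 2) * (\<integral>x. cnj (g x) * iexp (t * Y x) \<partial>M')"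
      by (simp only: eq eq' cnj_eq)
    also have "\<dots> = (\<integral>x. complex_of_real (q x + Re (u * g x)) * iexp (t * Y x) \<partial>M')"
      by (rule integral_add_Re_mult[OF M', symmetric]) (use ints in auto)
    finally show "(\<integral>x. complex_of_real (p x + Re (u * f x)) * iexp (t * X x) \<partial>M) =
        (\<integral>x. complex_of_real (q x + Re (u * g x)) * iexp (t * Y x) \<partial>M')" .
  qed (use A in auto)
  have ind1: "integrable M (\<lambda>x. p x * indicator A (X x))" "integrable M (\<lambda>x. f x * indicator A (X x))"
    by (auto intro!: ints simp: indicator_def)
  have ind2: "integrable M' (\<lambda>x. q x * indicator A (Y x))" "integrable M' (\<lambda>x. g x * indicator A (Y x))"
    by (auto intro!: ints simp: indicator_def)
  have split1: "(\<integral>x. (p x + Re (u * f x)) * indicator A (X x) \<partial>M) =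
      (\<integral>x. p x * indicator A (X x) \<partial>M) + Re (u * (\<integral>x. f x * indicator A (X x) \<partial>M))" for u
  proof -
    have "(p x + Re (u * f x)) * indicator A (X x) = p x * indicator A (X x) + Re (u * (f x * indicator A (X x)))" for x
      by (simp add: indicator_def)
    then have "(\<integral>x. (p x + Re (u * f x)) * indicator A (X x) \<partial>M) =
        (\<integral>x. p x * indicator A (X x) \<partial>M) + (\<integral>x. Re (u * (f x * indicator A (X x))) \<partial>M)"
      by (simp only:) (intro Bochner_Integration.integral_add integrable_Re integrable_mult_right ind1)
    also have "(\<integral>x. Re (u * (f x * indicator A (X x))) \<partial>M) = Re (\<integral>x. u * (f x * indicator A (X x)) \<partial>M)"
      by (intro integral_Re integrable_mult_right ind1)
    finally show ?thesis by (simp only: integral_mult_right_zero)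
  qed
  have split2: "(\<integral>x. (q x + Re (u * g x)) * indicator A (Y x) \<partial>M') =
      (\<integral>x. q x * indicator A (Y x) \<partial>M') + Re (u * (\<integral>x. g x * indicator A (Y x) \<partial>M'))" for u
  proof -
    have "(q x + Re (u * g x)) * indicator A (Y x) = q x * indicator A (Y x) + Re (u * (g x * indicator A (Y x)))" for x
      by (simp add: indicator_def)
    then have "(\<integral>x. (q x + Re (u * g x)) * indicator A (Y x) \<partial>M') =
        (\<integral>x. q x * indicator A (Y x) \<partial>M') + (\<integral>x. Re (u * (g x * indicator A (Y x))) \<partial>M')"
      by (simp only:) (intro Bochner_Integration.integral_add integrable_Re integrable_mult_right ind2)
    also have "(\<integral>x. Re (u * (g x * indicator A (Y x))) \<partial>M') = Re (\<integral>x. u * (g x * indicator A (Y x)) \<partial>M')"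
      by (intro integral_Re integrable_mult_right ind2)
    finally show ?thesis by (simp only: integral_mult_right_zero)
  qed
  show ?thesis
    using weight[of 1] weight[of "-1"] weight[of \<i>] weight[of "-\<i>"]
    unfolding split1 split2 by (simp add: complex_eq_iff)
qed

lemma prod_indicator_eq_indicator_PiE:
  assumes "finite J"
  shows "(\<Prod>j\<in>J. indicator (A j) (x j)) = (indicator (Pi\<^sub>E J A) (\<lambda>j\<in>J. x j) :: 'b::comm_semiring_1)"
proof (cases "\<forall>j\<in>J. x j \<in> A j")
  case True
  then show ?thesis by (auto simp: indicator_def PiE_iff intro!: prod.neutral)
next
  case False
  then have "\<exists>j\<in>J. (indicator (A j) (x j) :: 'b) = 0" by (auto simp: indicator_def)
  then have "(\<Prod>j\<in>J. indicator (A j) (x j) :: 'b) = 0" by (rule prod_zero[OF assms])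
  then show ?thesis using False by (auto simp: indicator_def PiE_iff)
qed

text \<open>Coordinates are moved one at a time from the exponential to the indicators.  For each move the remaining
  factors form a complex weight for the one-dimensional uniqueness theorem, dominated by the product of
  the indicators obtained so far.\<close>

lemma char_function_rectangles:
  fixes X :: "'i \<Rightarrow> 'a \<Rightarrow> real" and Y :: "'i \<Rightarrow> 'b \<Rightarrow> real"
  assumes M: "prob_space M" and M': "prob_space M'" and J: "finite J"
    and X [measurable]: "\<And>j. j \<in> J \<Longrightarrow> X j \<in> borel_measurable M"
    and Y [measurable]: "\<And>j. j \<in> J \<Longrightarrow> Y j \<in> borel_measurable M'"
    and eq: "\<And>\<xi>. (\<integral>x. iexp (\<Sum>j\<in>J. \<xi> j * X j x) \<partial>M) = (\<integral>x. iexp (\<Sum>j\<in>J. \<xi> j * Y j x) \<partial>M')"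
    and S: "S \<subseteq> J" and A: "\<And>j. j \<in> J \<Longrightarrow> A j \<in> sets borel"
  shows "(\<integral>x. (\<Prod>j\<in>S. indicator (A j) (X j x)) * iexp (\<Sum>j\<in>J - S. \<xi> j * X j x) \<partial>M) =
         (\<integral>x. (\<Prod>j\<in>S. indicator (A j) (Y j x)) * iexp (\<Sum>j\<in>J - S. \<xi> j * Y j x) \<partial>M')"
  using finite_subset[OF S J] S
proof (induction S arbitrary: \<xi> rule: finite_induct)
  case empty
  show ?case using eq[of \<xi>] by simp
next
  case (insert s S)
  have s: "s \<in> J" "s \<notin> S" "S \<subseteq> J" using insert by auto
  have IH: "(\<integral>x. (\<Prod>j\<in>S. indicator (A j) (X j x)) * iexp (\<Sum>j\<in>J - S. \<xi> j * X j x) \<partial>M) =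
         (\<integral>x. (\<Prod>j\<in>S. indicator (A j) (Y j x)) * iexp (\<Sum>j\<in>J - S. \<xi> j * Y j x) \<partial>M')" for \<xi>
    using insert.IH s by simp
  have J_S: "J - S = insert s (J - insert s S)" using s by auto
  have fin: "finite (J - insert s S)" using J by simp
  have sum_split: "(\<Sum>j\<in>J - S. (\<xi>(s := t)) j * Z j) = t * Z s + (\<Sum>j\<in>J - insert s S. \<xi> j * Z j)"
    for \<xi> t and Z :: "'i \<Rightarrow> real"
    unfolding J_S using fin by (subst sum.insert) (auto intro!: sum.cong)
  have [measurable]: "X j \<in> borel_measurable M" "Y j \<in> borel_measurable M'" "A j \<in> sets borel"
    if "j \<in> insert s S" for j using that s X Y A by auto
  have [measurable]: "X j \<in> borel_measurable M" "Y j \<in> borel_measurable M'"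
    if "j \<in> J - insert s S" for j using that X Y by auto
  define f :: "'a \<Rightarrow> complex" where
    "f = (\<lambda>x. (\<Prod>j\<in>S. indicator (A j) (X j x)) * iexp (\<Sum>j\<in>J - insert s S. \<xi> j * X j x))"
  define g :: "'b \<Rightarrow> complex" where
    "g = (\<lambda>x. (\<Prod>j\<in>S. indicator (A j) (Y j x)) * iexp (\<Sum>j\<in>J - insert s S. \<xi> j * Y j x))"
  define p :: "'a \<Rightarrow> real" where "p = (\<lambda>x. \<Prod>j\<in>S. indicator (A j) (X j x))"
  define q :: "'b \<Rightarrow> real" where "q = (\<lambda>x. \<Prod>j\<in>S. indicator (A j) (Y j x))"
  have of_real_prod_ind: "complex_of_real (\<Prod>j\<in>S. indicator (B j) (z j)) = (\<Prod>j\<in>S. indicator (B j) (z j))"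
    for B :: "'i \<Rightarrow> real set" and z
    unfolding of_real_prod by (intro prod.cong) (simp_all add: indicator_def)
  have "(\<integral>x. f x * indicator (A s) (X s x) \<partial>M) = (\<integral>x. g x * indicator (A s) (Y s x) \<partial>M')"
  proof (rule weighted_law_eqI[OF M M', where p = p and q = q])
    show "f \<in> borel_measurable M" "g \<in> borel_measurable M'" "p \<in> borel_measurable M" "q \<in> borel_measurable M'"
      unfolding f_def g_def p_def q_def by measurable
    show "cmod (f x) \<le> p x" "p x \<le> 1" for x
      unfolding f_def p_def norm_mult of_real_prod_ind[symmetric] norm_of_real abs_prod
      by (auto simp: prod_nonneg intro!: prod_le_1)
    show "cmod (g x) \<le> q x" "q x \<le> 1" for x
      unfolding g_def q_def norm_mult of_real_prod_ind[symmetric] norm_of_real abs_prod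
      by (auto simp: prod_nonneg intro!: prod_le_1)
    fix t
    show "(\<integral>x. f x * iexp (t * X s x) \<partial>M) = (\<integral>x. g x * iexp (t * Y s x) \<partial>M')"
      using IH[of "\<xi>(s := t)"] unfolding sum_split f_def g_def
      by (simp only: of_real_add distrib_left exp_add mult.assoc mult.left_commute mult.commute)
    show "(\<integral>x. complex_of_real (p x) * iexp (t * X s x) \<partial>M) = (\<integral>x. complex_of_real (q x) * iexp (t * Y s x) \<partial>M')"
      using IH[of "(\<lambda>_. 0)(s := t)"] unfolding sum_split p_def q_def of_real_prod_ind by simp
  qed (use s in auto)
  then show ?case
    unfolding f_def g_def using insert.hyps by (simp add: mult.assoc mult.left_commute mult.commute)
qed

lemma law_eqI_char_function:
  fixes X :: "'i \<Rightarrow> 'a \<Rightarrow> real" and Y :: "'i \<Rightarrow> 'b \<Rightarrow> real"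
  assumes M: "prob_space M" and M': "prob_space M'" and J: "finite J"
    and X: "\<And>j. j \<in> J \<Longrightarrow> X j \<in> borel_measurable M"
    and Y: "\<And>j. j \<in> J \<Longrightarrow> Y j \<in> borel_measurable M'"
    and eq: "\<And>\<xi>. (\<integral>x. iexp (\<Sum>j\<in>J. \<xi> j * X j x) \<partial>M) = (\<integral>x. iexp (\<Sum>j\<in>J. \<xi> j * Y j x) \<partial>M')"
  shows "distr M (PiM J (\<lambda>_. borel)) (\<lambda>x. \<lambda>j\<in>J. X j x) = distr M' (PiM J (\<lambda>_. borel)) (\<lambda>x. \<lambda>j\<in>J. Y j x)"
    (is "?P = ?Q")
proof -
  interpret M: prob_space M by fact
  interpret M': prob_space M' by fact
  have X' [measurable]: "(\<lambda>x. \<lambda>j\<in>J. X j x) \<in> measurable M (PiM J (\<lambda>_. borel))"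
    by (intro measurable_restrict X)
  have Y' [measurable]: "(\<lambda>x. \<lambda>j\<in>J. Y j x) \<in> measurable M' (PiM J (\<lambda>_. borel))"
    by (intro measurable_restrict Y)
  interpret P: prob_space ?P by (rule M.prob_space_distr) measurable
  interpret Q: prob_space ?Q by (rule M'.prob_space_distr) measurable
  have rect: "measure N (Pi\<^sub>E J A) = Re (\<integral>x. (\<Prod>j\<in>J. indicator (A j) (Z j x)) \<partial>L)"
    if A: "\<And>j. j \<in> J \<Longrightarrow> A j \<in> sets borel" and L: "prob_space L"
      and Z [measurable]: "(\<lambda>x. \<lambda>j\<in>J. Z j x) \<in> measurable L (PiM J (\<lambda>_. borel))"
      and N: "N = distr L (PiM J (\<lambda>_. borel)) (\<lambda>x. \<lambda>j\<in>J. Z j x)"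
    for A and L :: "'c measure" and Z :: "'i \<Rightarrow> 'c \<Rightarrow> real" and N
  proof -
    interpret L: prob_space L by fact
    have [measurable]: "Pi\<^sub>E J A \<in> sets (PiM J (\<lambda>_. borel))" using A J by (intro sets_PiM_I_finite) auto
    have "(\<integral>x. (\<Prod>j\<in>J. indicator (A j) (Z j x)) \<partial>L) = (\<integral>x. complex_of_real (indicator (Pi\<^sub>E J A) (\<lambda>j\<in>J. Z j x)) \<partial>L)"
      unfolding prod_indicator_eq_indicator_PiE[OF J]
      by (intro Bochner_Integration.integral_cong) (auto simp: indicator_def)
    also have "\<dots> = complex_of_real (\<integral>x. indicator (Pi\<^sub>E J A) (\<lambda>j\<in>J. Z j x) \<partial>L)" by (rule integral_complex_of_real)
    also have "(\<integral>x. (indicator (Pi\<^sub>E J A) (\<lambda>j\<in>J. Z j x) :: real) \<partial>L) = (\<integral>z. indicator (Pi\<^sub>E J A) z \<partial>N)"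
      unfolding N by (rule integral_distr[OF Z, symmetric]) simp
    also have "\<dots> = measure N (Pi\<^sub>E J A)" unfolding N by simp
    finally show ?thesis by simp
  qed
  show ?thesis
  proof (rule measure_eqI_PiM_finite[OF J])
    fix A :: "'i \<Rightarrow> real set" assume "\<And>j. j \<in> J \<Longrightarrow> A j \<in> sets borel"
    note A = this
    have "(\<integral>x. (\<Prod>j\<in>J. indicator (A j) (X j x)) \<partial>M) = (\<integral>x. (\<Prod>j\<in>J. indicator (A j) (Y j x) :: complex) \<partial>M')"
      using char_function_rectangles[where \<xi> = "\<lambda>_. 0" and A = A, OF M M' J X Y eq subset_refl A] by simp
    then show "emeasure ?P (Pi\<^sub>E J A) = emeasure ?Q (Pi\<^sub>E J A)"
      unfolding P.emeasure_eq_measure Q.emeasure_eq_measure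
      using rect[OF A M X' refl] rect[OF A M' Y' refl] by simp
  next
    show "range (\<lambda>_::nat. Pi\<^sub>E J (\<lambda>_. UNIV)) \<subseteq> prod_algebra J (\<lambda>_. borel :: real measure)"
      using J by (auto intro!: prod_algebraI_finite)
  qed (auto simp: space_PiM)
qed

text \<open>The real version for the real and imaginary parts, which are indexed by an additional boolean.\<close>

lemma complex_law_eqI_char_function:
  fixes Z :: "'i \<Rightarrow> 'a \<Rightarrow> complex" and W :: "'i \<Rightarrow> 'b \<Rightarrow> complex"
  assumes M: "prob_space M" and M': "prob_space M'" and I: "finite I"
    and Z: "\<And>i. i \<in> I \<Longrightarrow> Z i \<in> borel_measurable M"
    and W: "\<And>i. i \<in> I \<Longrightarrow> W i \<in> borel_measurable M'"
    and eq: "\<And>\<zeta>. (\<integral>x. iexp (Re (\<Sum>i\<in>I. cnj (\<zeta> i) * Z i x)) \<partial>M) = (\<integral>x. iexp (Re (\<Sum>i\<in>I. cnj (\<zeta> i) * W i x)) \<partial>M')"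
  shows "distr M (PiM I (\<lambda>_. borel)) (\<lambda>x. \<lambda>i\<in>I. Z i x) = distr M' (PiM I (\<lambda>_. borel)) (\<lambda>x. \<lambda>i\<in>I. W i x)"
proof -
  let ?J = "I \<times> (UNIV :: bool set)"
  define part where "part b = (if b then Re else Im)" for b
  have [measurable]: "part b \<in> borel_measurable borel" for b by (cases b) (simp_all add: part_def)
  define join :: "('i \<times> bool \<Rightarrow> real) \<Rightarrow> 'i \<Rightarrow> complex" where "join r = (\<lambda>i\<in>I. of_real (r (i, True)) + \<i> * of_real (r (i, False)))" for r
  have join [measurable]: "join \<in> measurable (PiM ?J (\<lambda>_. borel)) (PiM I (\<lambda>_. borel))"
    unfolding join_def by (intro measurable_restrict) measurable
  have sum_part: "(\<Sum>j\<in>?J. \<xi> j * part (snd j) (z (fst j))) = Re (\<Sum>i\<in>I. cnj (Complex (\<xi> (i, True)) (\<xi> (i, False))) * z i)"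
    for \<xi> :: "'i \<times> bool \<Rightarrow> real" and z
  proof -
    have "(\<Sum>j\<in>?J. \<xi> j * part (snd j) (z (fst j))) = (\<Sum>(i, b)\<in>?J. \<xi> (i, b) * part b (z i))"
      by (rule sum.cong) auto
    also have "\<dots> = (\<Sum>i\<in>I. \<Sum>b\<in>UNIV. \<xi> (i, b) * part b (z i))"
      by (rule sum.cartesian_product[symmetric])
    also have "\<dots> = Re (\<Sum>i\<in>I. cnj (Complex (\<xi> (i, True)) (\<xi> (i, False))) * z i)"
      unfolding Re_sum by (rule sum.cong) (auto simp: UNIV_bool part_def)
    finally show ?thesis .
  qed
  have Z': "(\<lambda>x. part (snd j) (Z (fst j) x)) \<in> borel_measurable M" if "j \<in> ?J" for j
    by (rule measurable_compose[OF Z]) (use that in auto)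
  have W': "(\<lambda>x. part (snd j) (W (fst j) x)) \<in> borel_measurable M'" if "j \<in> ?J" for j
    by (rule measurable_compose[OF W]) (use that in auto)
  have parts: "distr M (PiM ?J (\<lambda>_. borel)) (\<lambda>x. \<lambda>j\<in>?J. part (snd j) (Z (fst j) x)) =
      distr M' (PiM ?J (\<lambda>_. borel)) (\<lambda>x. \<lambda>j\<in>?J. part (snd j) (W (fst j) x))"
  proof (rule law_eqI_char_function[OF M M'])
    show "finite ?J" using I by simp
    fix \<xi> :: "'i \<times> bool \<Rightarrow> real"
    have "(\<Sum>j\<in>?J. \<xi> j * part (snd j) (Z (fst j) x)) = Re (\<Sum>i\<in>I. cnj (Complex (\<xi> (i, True)) (\<xi> (i, False))) * Z i x)" for x
      by (rule sum_part)
    moreover have "(\<Sum>j\<in>?J. \<xi> j * part (snd j) (W (fst j) x)) = Re (\<Sum>i\<in>I. cnj (Complex (\<xi> (i, True)) (\<xi> (i, False))) * W i x)" for x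
      by (rule sum_part)
    ultimately show "(\<integral>x. iexp (\<Sum>j\<in>?J. \<xi> j * part (snd j) (Z (fst j) x)) \<partial>M) =
        (\<integral>x. iexp (\<Sum>j\<in>?J. \<xi> j * part (snd j) (W (fst j) x)) \<partial>M')"
      by (simp only: eq)
  qed (rule Z' W', assumption)+
  have join_part: "join (\<lambda>j\<in>?J. part (snd j) (z (fst j))) = (\<lambda>i\<in>I. z i)" for z
    by (rule ext) (auto simp: join_def part_def complex_eq_iff)
  have mZ: "(\<lambda>x. \<lambda>j\<in>?J. part (snd j) (Z (fst j) x)) \<in> measurable M (PiM ?J (\<lambda>_. borel))"
    by (intro measurable_restrict Z')
  have mW: "(\<lambda>x. \<lambda>j\<in>?J. part (snd j) (W (fst j) x)) \<in> measurable M' (PiM ?J (\<lambda>_. borel))"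
    by (intro measurable_restrict W')
  have "join (\<lambda>j\<in>?J. part (snd j) (Z (fst j) x)) = (\<lambda>i\<in>I. Z i x)" for x by (rule join_part)
  moreover have "join (\<lambda>j\<in>?J. part (snd j) (W (fst j) x)) = (\<lambda>i\<in>I. W i x)" for x by (rule join_part)
  ultimately show ?thesis
    using arg_cong[OF parts, of "\<lambda>L. distr L (PiM I (\<lambda>_. borel)) join"]
    by (simp only: distr_distr[OF join mZ] distr_distr[OF join mW] comp_def)
qed

section \<open>Independence of random elements of different spaces\<close>

context prob_space
begin

text \<open>Independence of two random elements whose values may have different types, like the past and the
  innovation of a process.\<close>

definition indep_pair :: "'s measure \<Rightarrow> ('a \<Rightarrow> 's) \<Rightarrow> 't measure \<Rightarrow> ('a \<Rightarrow> 't) \<Rightarrow> bool" where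
  "indep_pair S X T Y \<longleftrightarrow> random_variable S X \<and> random_variable T Y \<and>
     indep_set {X -` A \<inter> space M |A. A \<in> sets S} {Y -` A \<inter> space M |A. A \<in> sets T}"

lemma indep_pairD:
  assumes "indep_pair S X T Y"
  shows "random_variable S X" "random_variable T Y"
    and "A \<in> sets S \<Longrightarrow> B \<in> sets T \<Longrightarrow>
      prob ((X -` A \<inter> space M) \<inter> (Y -` B \<inter> space M)) = prob (X -` A \<inter> space M) * prob (Y -` B \<inter> space M)"
  using assms unfolding indep_pair_def indep_sets2_eq by blast+

lemma indep_pairI:
  assumes X: "random_variable S X" and Y: "random_variable T Y"
    and prod: "\<And>A B. A \<in> sets S \<Longrightarrow> B \<in> sets T \<Longrightarrow>
      prob ((X -` A \<inter> space M) \<inter> (Y -` B \<inter> space M)) = prob (X -` A \<inter> space M) * prob (Y -` B \<inter> space M)"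
  shows "indep_pair S X T Y"
  unfolding indep_pair_def indep_sets2_eq
  using X Y measurable_sets[OF X] measurable_sets[OF Y] prod by blast

lemma indep_pair_of_indep_var:
  assumes "indep_var S X T Y"
  shows "indep_pair S X T Y"
proof (rule indep_pairI)
  fix A B assume AB: "A \<in> sets S" "B \<in> sets T"
  have "(\<lambda>x. (X x, Y x)) -` (A \<times> B) \<inter> space M = (X -` A \<inter> space M) \<inter> (Y -` B \<inter> space M)" by auto
  then show "prob ((X -` A \<inter> space M) \<inter> (Y -` B \<inter> space M)) = prob (X -` A \<inter> space M) * prob (Y -` B \<inter> space M)"
    using indep_varD[OF assms AB] by (simp only:)
qed (use assms in \<open>auto dest: indep_var_rv1 indep_var_rv2\<close>)

lemma indep_pair_compose:
  assumes XY: "indep_pair S X T Y" and f: "f \<in> measurable S S'" and g: "g \<in> measurable T T'"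
  shows "indep_pair S' (\<lambda>\<omega>. f (X \<omega>)) T' (\<lambda>\<omega>. g (Y \<omega>))"
proof (rule indep_pairI)
  note rv = indep_pairD(1,2)[OF XY]
  show "random_variable S' (\<lambda>\<omega>. f (X \<omega>))" "random_variable T' (\<lambda>\<omega>. g (Y \<omega>))"
    using rv f g by (auto intro: measurable_compose)
  fix A B assume AB: "A \<in> sets S'" "B \<in> sets T'"
  have "(\<lambda>\<omega>. f (X \<omega>)) -` A \<inter> space M = X -` (f -` A \<inter> space S) \<inter> space M"
    and "(\<lambda>\<omega>. g (Y \<omega>)) -` B \<inter> space M = Y -` (g -` B \<inter> space T) \<inter> space M"
    using measurable_space[OF rv(1)] measurable_space[OF rv(2)] by auto
  then show "prob (((\<lambda>\<omega>. f (X \<omega>)) -` A \<inter> space M) \<inter> ((\<lambda>\<omega>. g (Y \<omega>)) -` B \<inter> space M)) =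
      prob ((\<lambda>\<omega>. f (X \<omega>)) -` A \<inter> space M) * prob ((\<lambda>\<omega>. g (Y \<omega>)) -` B \<inter> space M)"
    using indep_pairD(3)[OF XY measurable_sets[OF f AB(1)] measurable_sets[OF g AB(2)]] by (simp only:)
qed

lemma distr_indep_pair:
  assumes XY: "indep_pair S X T Y"
  shows "distr M S X \<Otimes>\<^sub>M distr M T Y = distr M (S \<Otimes>\<^sub>M T) (\<lambda>\<omega>. (X \<omega>, Y \<omega>))"
proof (rule pair_measure_eqI)
  note rv [measurable] = indep_pairD(1,2)[OF XY]
  interpret X: prob_space "distr M S X" by (rule prob_space_distr) (rule rv)
  interpret Y: prob_space "distr M T Y" by (rule prob_space_distr) (rule rv)
  show "sigma_finite_measure (distr M S X)" "sigma_finite_measure (distr M T Y)" by unfold_locales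
  show "sets (distr M S X \<Otimes>\<^sub>M distr M T Y) = sets (distr M (S \<Otimes>\<^sub>M T) (\<lambda>\<omega>. (X \<omega>, Y \<omega>)))"
    by (simp cong: sets_pair_measure_cong)
  fix A B assume "A \<in> sets (distr M S X)" "B \<in> sets (distr M T Y)"
  then have A [measurable]: "A \<in> sets S" and B [measurable]: "B \<in> sets T" by auto
  have "(\<lambda>\<omega>. (X \<omega>, Y \<omega>)) -` (A \<times> B) \<inter> space M = (X -` A \<inter> space M) \<inter> (Y -` B \<inter> space M)" by auto
  then show "emeasure (distr M S X) A * emeasure (distr M T Y) B = emeasure (distr M (S \<Otimes>\<^sub>M T) (\<lambda>\<omega>. (X \<omega>, Y \<omega>))) (A \<times> B)"
    using indep_pairD(3)[OF XY A B]
    by (simp add: emeasure_distr emeasure_eq_measure ennreal_mult)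
qed

lemma indep_pair_AE_cong:
  assumes indep: "indep_pair S X T Y" and X': "random_variable S X'" and Y': "random_variable T Y'"
    and "AE \<omega> in M. X \<omega> = X' \<omega>" "AE \<omega> in M. Y \<omega> = Y' \<omega>"
  shows "indep_pair S X' T Y'"
proof (rule indep_pairI[OF X' Y'])
  fix A B assume AB: "A \<in> sets S" "B \<in> sets T"
  note rvs = indep_pairD(1)[OF indep] indep_pairD(2)[OF indep]
  note ms = measurable_sets[OF X' AB(1)] measurable_sets[OF Y' AB(2)] measurable_sets[OF rvs(1) AB(1)] measurable_sets[OF rvs(2) AB(2)]
  have "prob ((X' -` A \<inter> space M) \<inter> (Y' -` B \<inter> space M)) = prob ((X -` A \<inter> space M) \<inter> (Y -` B \<inter> space M))"
    using assms(4,5) ms by (intro finite_measure_eq_AE) auto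
  moreover have "prob (X' -` A \<inter> space M) = prob (X -` A \<inter> space M)"
    using assms(4) ms by (intro finite_measure_eq_AE) auto
  moreover have "prob (Y' -` B \<inter> space M) = prob (Y -` B \<inter> space M)"
    using assms(5) ms by (intro finite_measure_eq_AE) auto
  ultimately show "prob ((X' -` A \<inter> space M) \<inter> (Y' -` B \<inter> space M)) = prob (X' -` A \<inter> space M) * prob (Y' -` B \<inter> space M)"
    using indep_pairD(3)[OF indep AB] by simp
qed

lemma indep_pair_const_left:
  assumes c: "c \<in> space S" and Y: "random_variable T Y"
  shows "indep_pair S (\<lambda>_. c) T Y"
  using c Y by (intro indep_pairI) (auto simp: vimage_def prob_space)

lemma indep_pair_const_right:
  assumes c: "c \<in> space T" and X: "random_variable S X"
  shows "indep_pair S X T (\<lambda>_. c)"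
  using c X by (intro indep_pairI) (auto simp: vimage_def prob_space)

text \<open>If each member of an independent family splits into two independent parts, then the family of first
  parts is independent of the family of second parts.  By \<open>\<pi>\<close>-\<open>\<lambda>\<close> it suffices to consider rectangles,
  where all probabilities factorise over the index set and the parts.\<close>

lemma indep_pair_families:
  fixes X :: "'i \<Rightarrow> 'a \<Rightarrow> 's" and f :: "'i \<Rightarrow> 's \<Rightarrow> 'p" and g :: "'i \<Rightarrow> 's \<Rightarrow> 'q"
  assumes I: "finite I" "I \<noteq> {}" and X: "indep_vars S X I"
    and f: "\<And>i. i \<in> I \<Longrightarrow> f i \<in> measurable (S i) (P i)" and g: "\<And>i. i \<in> I \<Longrightarrow> g i \<in> measurable (S i) (Q i)"
    and fg: "\<And>i. i \<in> I \<Longrightarrow> indep_pair (P i) (\<lambda>\<omega>. f i (X i \<omega>)) (Q i) (\<lambda>\<omega>. g i (X i \<omega>))"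
  shows "indep_pair (PiM I P) (\<lambda>\<omega>. \<lambda>i\<in>I. f i (X i \<omega>)) (PiM I Q) (\<lambda>\<omega>. \<lambda>i\<in>I. g i (X i \<omega>))"
proof -
  have Xm: "random_variable (S i) (X i)" if "i \<in> I" for i using X that by (auto simp: indep_vars_def)
  have gen: "{(\<lambda>\<omega>. \<lambda>i\<in>I. h i (X i \<omega>)) -` A \<inter> space M | A. A \<in> sets (PiM I R)} =
      sigma_sets (space M) {(\<lambda>\<omega>. \<lambda>i\<in>I. h i (X i \<omega>)) -` A \<inter> space M | A. A \<in> prod_algebra I R}"
    if h: "\<And>i. i \<in> I \<Longrightarrow> h i \<in> measurable (S i) (R i)" for h :: "'i \<Rightarrow> 's \<Rightarrow> 'z" and R
    unfolding sets_PiM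
  proof (rule sigma_sets_vimage_commute)
    show "(\<lambda>\<omega>. \<lambda>i\<in>I. h i (X i \<omega>)) \<in> space M \<rightarrow> (\<Pi>\<^sub>E i\<in>I. space (R i))"
      using measurable_space[OF h measurable_space[OF Xm]] by auto
  qed
  have stable: "Int_stable {(\<lambda>\<omega>. \<lambda>i\<in>I. h i (X i \<omega>)) -` A \<inter> space M | A. A \<in> prod_algebra I R}"
    for h :: "'i \<Rightarrow> 's \<Rightarrow> 'z" and R
  proof (rule Int_stableI, clarify)
    let ?H = "\<lambda>\<omega>. \<lambda>i\<in>I. h i (X i \<omega>)"
    fix A B assume "A \<in> prod_algebra I R" "B \<in> prod_algebra I R"
    then have "A \<inter> B \<in> prod_algebra I R" using Int_stable_prod_algebra by (rule Int_stableD[rotated])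
    moreover have "(?H -` A \<inter> space M) \<inter> (?H -` B \<inter> space M) = ?H -` (A \<inter> B) \<inter> space M" by auto
    ultimately show "\<exists>C. (?H -` A \<inter> space M) \<inter> (?H -` B \<inter> space M) = ?H -` C \<inter> space M \<and> C \<in> prod_algebra I R"
      by blast
  qed
  have vim: "(\<lambda>\<omega>. \<lambda>i\<in>I. h i (X i \<omega>)) -` (Pi\<^sub>E I A) \<inter> space M = (\<Inter>i\<in>I. X i -` (h i -` A i \<inter> space (S i)) \<inter> space M)"
    for h :: "'i \<Rightarrow> 's \<Rightarrow> 'z" and A
    using I(2) measurable_space[OF Xm] by (auto simp: PiE_iff)
  let ?F = "\<lambda>\<omega>. \<lambda>i\<in>I. f i (X i \<omega>)" and ?G = "\<lambda>\<omega>. \<lambda>i\<in>I. g i (X i \<omega>)"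
  have F: "random_variable (PiM I P) ?F" by (intro measurable_restrict measurable_compose[OF Xm f])
  have G: "random_variable (PiM I Q) ?G" by (intro measurable_restrict measurable_compose[OF Xm g])
  have "indep_set (sigma_sets (space M) {?F -` A \<inter> space M |A. A \<in> prod_algebra I P})
       (sigma_sets (space M) {?G -` A \<inter> space M |A. A \<in> prod_algebra I Q})"
    proof (intro indep_set_sigma_sets stable)
      show "indep_set {?F -` A \<inter> space M |A. A \<in> prod_algebra I P} {?G -` A \<inter> space M |A. A \<in> prod_algebra I Q}"
        unfolding indep_sets2_eq
      proof (intro conjI ballI)
        show "{?F -` A \<inter> space M |A. A \<in> prod_algebra I P} \<subseteq> events"
          using measurable_sets[OF F] by (auto simp: sets_PiM)
        show "{?G -` A \<inter> space M |A. A \<in> prod_algebra I Q} \<subseteq> events"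
          using measurable_sets[OF G] by (auto simp: sets_PiM)
        fix a b assume "a \<in> {?F -` A \<inter> space M |A. A \<in> prod_algebra I P}" "b \<in> {?G -` A \<inter> space M |A. A \<in> prod_algebra I Q}"
        then obtain A B where a: "a = ?F -` (Pi\<^sub>E I A) \<inter> space M" and A: "A \<in> (\<Pi> j\<in>I. sets (P j))"
          and b: "b = ?G -` (Pi\<^sub>E I B) \<inter> space M" and B: "B \<in> (\<Pi> j\<in>I. sets (Q j))"
          unfolding prod_algebra_eq_finite[OF I(1)] by blast
        let ?A = "\<lambda>i. f i -` A i \<inter> space (S i)" and ?B = "\<lambda>i. g i -` B i \<inter> space (S i)"
        have mA: "?A i \<in> sets (S i)" and mB: "?B i \<in> sets (S i)" if "i \<in> I" for i
          using that A B measurable_sets[OF f[OF that]] measurable_sets[OF g[OF that]] by (auto simp: Pi_iff)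
        have "prob (a \<inter> b) = prob (\<Inter>i\<in>I. X i -` (?A i \<inter> ?B i) \<inter> space M)"
          unfolding a b vim using I(2) by (intro arg_cong[where f = prob]) auto
        also have "\<dots> = (\<Prod>i\<in>I. prob (X i -` (?A i \<inter> ?B i) \<inter> space M))"
          using mA mB by (intro indep_varsD_finite[OF X I(2,1)]) auto
        also have "\<dots> = (\<Prod>i\<in>I. prob (X i -` ?A i \<inter> space M) * prob (X i -` ?B i \<inter> space M))"
        proof (rule prod.cong[OF refl])
          fix i assume i: "i \<in> I"
          have AB: "A i \<in> sets (P i)" "B i \<in> sets (Q i)" using A B i by (auto simp: Pi_iff)
          have "X i -` ?A i \<inter> space M = (\<lambda>\<omega>. f i (X i \<omega>)) -` A i \<inter> space M"
            and "X i -` ?B i \<inter> space M = (\<lambda>\<omega>. g i (X i \<omega>)) -` B i \<inter> space M"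
            using measurable_space[OF Xm[OF i]] by auto
          moreover have "X i -` (?A i \<inter> ?B i) \<inter> space M = (X i -` ?A i \<inter> space M) \<inter> (X i -` ?B i \<inter> space M)"
            by auto
          ultimately show "prob (X i -` (?A i \<inter> ?B i) \<inter> space M) =
              prob (X i -` ?A i \<inter> space M) * prob (X i -` ?B i \<inter> space M)"
            using indep_pairD(3)[OF fg[OF i] AB] by (simp only:)
        qed
        also have "\<dots> = (\<Prod>i\<in>I. prob (X i -` ?A i \<inter> space M)) * (\<Prod>i\<in>I. prob (X i -` ?B i \<inter> space M))"
          by (rule prod.distrib)
        also have "(\<Prod>i\<in>I. prob (X i -` ?A i \<inter> space M)) = prob a"
          unfolding a vim using mA by (intro indep_varsD_finite[OF X I(2,1), symmetric]) auto
        also have "(\<Prod>i\<in>I. prob (X i -` ?B i \<inter> space M)) = prob b"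
          unfolding b vim using mB by (intro indep_varsD_finite[OF X I(2,1), symmetric]) auto
        finally show "prob (a \<inter> b) = prob a * prob b" .
      qed
    qed
  moreover have "{?F -` A \<inter> space M | A. A \<in> sets (PiM I P)} = sigma_sets (space M) {?F -` A \<inter> space M | A. A \<in> prod_algebra I P}"
    by (rule gen) (rule f)
  moreover have "{?G -` A \<inter> space M | A. A \<in> sets (PiM I Q)} = sigma_sets (space M) {?G -` A \<inter> space M | A. A \<in> prod_algebra I Q}"
    by (rule gen) (rule g)
  ultimately show ?thesis
    unfolding indep_pair_def using F G by (simp only: simp_thms)
qed

end

section \<open>Past and increments of a Brownian motion\<close>

context prob_space
begin

lemma standard_bm_measurable:
  "standard_brownian_motion M b \<Longrightarrow> 0 \<le> t \<Longrightarrow> b t \<in> borel_measurable M"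
  by (simp add: standard_brownian_motion_def)

text \<open>The times of \<open>T\<close> together with \<open>0\<close> and \<open>s\<close>, listed increasingly, and followed by \<open>u\<close>, are the times in
  the definition of independent increments.  The values on \<open>T\<close> are sums of the increments before the
  last one, up to the initial value, which vanishes almost surely.\<close>

lemma standard_bm_past_increment:
  assumes bm: "standard_brownian_motion M b" and T: "finite T" "\<And>r. r \<in> T \<Longrightarrow> 0 \<le> r \<and> r \<le> s"
    and su: "0 \<le> s" "s \<le> u"
  shows "indep_pair (PiM T (\<lambda>_. borel)) (\<lambda>\<omega>. \<lambda>r\<in>T. b r \<omega>) borel (\<lambda>\<omega>. b u \<omega> - b s \<omega>)"
proof (cases "s = u")
  case True
  have "indep_pair (PiM T (\<lambda>_. borel)) (\<lambda>\<omega>. \<lambda>r\<in>T. b r \<omega>) borel (\<lambda>_. 0::real)"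
    using T bm by (intro indep_pair_const_right measurable_restrict standard_bm_measurable) auto
  then show ?thesis using True by simp
next
  case False
  then have su': "s < u" using su by simp
  define L where "L = sorted_list_of_set (insert 0 (insert s T))"
  have set_L: "set L = insert 0 (insert s T)" unfolding L_def by (rule set_sorted_list_of_set) (use T in simp)
  have sorted_L: "sorted_wrt (<) L" unfolding L_def by (rule strict_sorted_list_of_set)
  define n where "n = length L - 1"
  have len: "length L = Suc n" using set_L by (cases L) (auto simp: n_def)
  have L_less: "i < j \<Longrightarrow> j \<le> n \<Longrightarrow> L ! i < L ! j" for i j
    using sorted_wrt_nth_less[OF sorted_L, of i j] len by simp
  have L_le: "i \<le> j \<Longrightarrow> j \<le> n \<Longrightarrow> L ! i \<le> L ! j" for i j
    using L_less[of i j] by (cases "i = j") auto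
  have L0: "L ! 0 = 0"
  proof -
    obtain i where "i \<le> n" "L ! i = 0" using set_L len by (metis in_set_conv_nth insertI1 less_Suc_eq_le)
    moreover have "L ! 0 \<in> insert 0 (insert s T)" unfolding set_L[symmetric] using len by simp
    then have "0 \<le> L ! 0" using T su by auto
    ultimately show ?thesis using L_le[of 0 i] by simp
  qed
  have Ln: "L ! n = s"
  proof -
    obtain i where "i \<le> n" "L ! i = s" using set_L len by (metis in_set_conv_nth insertI1 insertI2 less_Suc_eq_le)
    moreover have "L ! n \<in> insert 0 (insert s T)" unfolding set_L[symmetric] using len by simp
    then have "L ! n \<le> s" using T su by auto
    ultimately show ?thesis using L_le[of i n] by simp
  qed
  \<comment> \<open>The last of these times in \<open>L\<close> is \<open>s\<close>; the time \<open>u\<close> follows it.\<close>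
  define \<tau> where "\<tau> i = (if i \<le> n then L ! i else u)" for i
  have \<tau>_less: "\<tau> i < \<tau> (Suc i)" if "i < Suc n" for i
    using that L_less[of i "Suc i"] Ln su' by (cases "i = n") (auto simp: \<tau>_def)
  have \<tau>0: "\<tau> 0 = 0" using L0 by (simp add: \<tau>_def)
  let ?D = "\<lambda>i \<omega>. b (\<tau> (Suc i)) \<omega> - b (\<tau> i) \<omega>"
  have "indep_vars (\<lambda>_. borel) ?D {..<Suc n}"
    using bm \<tau>_less \<tau>0 unfolding standard_brownian_motion_def by auto
  then have "indep_var (PiM {..<n} (\<lambda>_. borel)) (\<lambda>\<omega>. \<lambda>i\<in>{..<n}. ?D i \<omega>) (PiM {n} (\<lambda>_. borel)) (\<lambda>\<omega>. \<lambda>i\<in>{n}. ?D i \<omega>)"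
    by (rule indep_var_restrict) auto
  then have ip: "indep_pair (PiM {..<n} (\<lambda>_. borel)) (\<lambda>\<omega>. \<lambda>i\<in>{..<n}. ?D i \<omega>) (PiM {n} (\<lambda>_. borel)) (\<lambda>\<omega>. \<lambda>i\<in>{n}. ?D i \<omega>)"
    by (rule indep_pair_of_indep_var)
  have "\<exists>i\<le>n. L ! i = r" if "r \<in> T" for r
    using that set_L len by (metis in_set_conv_nth insertI2 less_Suc_eq_le)
  then obtain pos where pos: "\<And>r. r \<in> T \<Longrightarrow> pos r \<le> n" "\<And>r. r \<in> T \<Longrightarrow> L ! pos r = r" by metis
  have "indep_pair (PiM T (\<lambda>_. borel)) (\<lambda>\<omega>. \<lambda>r\<in>T. \<Sum>i<pos r. (\<lambda>i\<in>{..<n}. ?D i \<omega>) i) borel (\<lambda>\<omega>. (\<lambda>i\<in>{n}. ?D i \<omega>) n)"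
  proof (rule indep_pair_compose[OF ip])
    show "(\<lambda>d. \<lambda>r\<in>T. \<Sum>i<pos r. d i) \<in> measurable (PiM {..<n} (\<lambda>_. borel)) (PiM T (\<lambda>_. borel :: real measure))"
      using pos(1) by (intro measurable_restrict borel_measurable_sum measurable_component_singleton) fastforce
    show "(\<lambda>d. d n) \<in> borel_measurable (PiM {n} (\<lambda>_. borel :: real measure))"
      by (rule measurable_component_singleton) simp
  qed
  then show ?thesis
  proof (rule indep_pair_AE_cong)
    show "random_variable (PiM T (\<lambda>_. borel)) (\<lambda>\<omega>. \<lambda>r\<in>T. b r \<omega>)"
      using T bm by (intro measurable_restrict standard_bm_measurable) auto
    show "random_variable borel (\<lambda>\<omega>. b u \<omega> - b s \<omega>)"
      using bm su by (intro borel_measurable_diff standard_bm_measurable) auto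
    have tele: "(\<Sum>i<pos r. (\<lambda>i\<in>{..<n}. ?D i \<omega>) i) = b r \<omega> - b 0 \<omega>" if "r \<in> T" for r \<omega>
    proof -
      have "(\<Sum>i<pos r. (\<lambda>i\<in>{..<n}. ?D i \<omega>) i) = (\<Sum>i<pos r. ?D i \<omega>)"
        using pos(1)[OF that] by (intro sum.cong) auto
      also have "\<dots> = b (\<tau> (pos r)) \<omega> - b (\<tau> 0) \<omega>"
        by (rule sum_lessThan_telescope)
      finally show ?thesis using pos[OF that] \<tau>0 by (simp add: \<tau>_def)
    qed
    have "AE \<omega> in M. b 0 \<omega> = 0" using bm by (simp add: standard_brownian_motion_def)
    then show "AE \<omega> in M. (\<lambda>r\<in>T. \<Sum>i<pos r. (\<lambda>i\<in>{..<n}. ?D i \<omega>) i) = (\<lambda>r\<in>T. b r \<omega>)"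
    proof eventually_elim
      case (elim \<omega>)
      show ?case by (rule restrict_ext) (simp only: tele elim diff_zero)
    qed
    show "AE \<omega> in M. (\<lambda>i\<in>{n}. ?D i \<omega>) n = b u \<omega> - b s \<omega>"
      using Ln by (simp add: \<tau>_def)
  qed
qed

lemma standard_bm_char:
  assumes bm: "standard_brownian_motion M b" and su: "0 \<le> s" "s \<le> u"
  shows "(\<integral>\<omega>. iexp (\<xi> * (b u \<omega> - b s \<omega>)) \<partial>M) = exp (- (u - s) * \<xi>\<^sup>2 / 2)"
proof (cases "s = u")
  case True
  then show ?thesis by (simp add: prob_space)
next
  case False
  then have su': "s < u" using su by simp
  define \<sigma> where "\<sigma> = sqrt (u - s)"
  have \<sigma>: "\<sigma> > 0" using su' by (simp add: \<sigma>_def)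
  define Y where "Y = (\<lambda>\<omega>. (b u \<omega> - b s \<omega> - 0) / \<sigma>)"
  have "distributed M lborel (\<lambda>\<omega>. b u \<omega> - b s \<omega>) (normal_density 0 \<sigma>)"
    using bm su' su unfolding standard_brownian_motion_def \<sigma>_def by auto
  then have Y: "distributed M lborel Y std_normal_density"
    unfolding Y_def by (rule normal_standard_normal_convert[OF \<sigma>, THEN iffD1])
  then have Ym [measurable]: "Y \<in> borel_measurable M" using distributed_measurable by fastforce
  have "(\<integral>\<omega>. iexp (\<xi> * (b u \<omega> - b s \<omega>)) \<partial>M) = (\<integral>\<omega>. iexp ((\<xi> * \<sigma>) * Y \<omega>) \<partial>M)"
    using \<sigma> by (simp add: Y_def)
  also have "\<dots> = (\<integral>x. iexp ((\<xi> * \<sigma>) * x) \<partial>distr M lborel Y)"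
    by (rule integral_distr[symmetric]) measurable
  also have "\<dots> = char std_normal_distribution (\<xi> * \<sigma>)"
    unfolding char_def distributed_distr_eq_density[OF Y] ..
  also have "\<dots> = exp (- (u - s) * \<xi>\<^sup>2 / 2)"
    using su' by (simp add: char_std_normal_distribution \<sigma>_def power_mult_distrib mult.commute) (simp add: algebra_simps)
  finally show ?thesis .
qed

lemma path_increment_measurable:
  "0 \<le> s \<Longrightarrow> 0 \<le> u \<Longrightarrow> (\<lambda>p. p u - p s) \<in> borel_measurable (path_space :: (real \<Rightarrow> 'b::{second_countable_topology, real_normed_vector}) measure)"
  by (intro borel_measurable_diff measurable_component_singleton) auto

lemma complex_bm_measurable:
  assumes bm: "complex_brownian_motion M B" and t: "0 \<le> t"
  shows "B t \<in> borel_measurable M"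
proof -
  obtain b b' where b: "standard_brownian_motion M b" "standard_brownian_motion M b'"
    and B: "\<And>\<omega>. \<omega> \<in> space M \<Longrightarrow> B t \<omega> = complex_of_real (b t \<omega>) / complex_of_real (sqrt 2)
                 + \<i> * complex_of_real (b' t \<omega>) / complex_of_real (sqrt 2)"
    using bm t unfolding complex_brownian_motion_def by blast
  have [measurable]: "b t \<in> borel_measurable M" "b' t \<in> borel_measurable M"
    using b t by (auto intro: standard_bm_measurable)
  show ?thesis by (subst measurable_cong[OF B]) measurable
qed

text \<open>Splitting the real and the imaginary part into past and increment splits the complex process.\<close>

lemma complex_bm_past_increment:
  assumes bm: "complex_brownian_motion M B" and T: "finite T" "\<And>r. r \<in> T \<Longrightarrow> 0 \<le> r \<and> r \<le> s"
    and su: "0 \<le> s" "s \<le> u"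
  shows "indep_pair (PiM T (\<lambda>_. borel)) (\<lambda>\<omega>. \<lambda>r\<in>T. B r \<omega>) borel (\<lambda>\<omega>. B u \<omega> - B s \<omega>)"
proof -
  obtain b b' where b: "standard_brownian_motion M b" "standard_brownian_motion M b'"
    and bb': "indep_var path_space (path_of b) path_space (path_of b')"
    and B: "\<And>t \<omega>. 0 \<le> t \<Longrightarrow> \<omega> \<in> space M \<Longrightarrow> B t \<omega> = complex_of_real (b t \<omega>) / complex_of_real (sqrt 2)
                 + \<i> * complex_of_real (b' t \<omega>) / complex_of_real (sqrt 2)"
    using bm unfolding complex_brownian_motion_def by blast
  have T0: "T \<subseteq> {0..}" using T by auto
  let ?X = "case_bool (path_of b) (path_of b')"
  define c where "c = case_bool b b'"
  have X_app: "restrict (?X i \<omega>) T = (\<lambda>r\<in>T. c i r \<omega>)" "?X i \<omega> u - ?X i \<omega> s = c i u \<omega> - c i s \<omega>" for i \<omega>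
    using T0 su by (auto simp: c_def path_of_def fun_eq_iff split: bool.split)
  have c: "standard_brownian_motion M (c i)" for i using b by (cases i) (simp_all add: c_def)
  have S: "case_bool path_space path_space = (\<lambda>_. path_space :: (real \<Rightarrow> real) measure)"
    by (auto simp: fun_eq_iff split: bool.split)
  have "indep_pair (PiM UNIV (\<lambda>_. PiM T (\<lambda>_. borel))) (\<lambda>\<omega>. \<lambda>i\<in>UNIV. restrict (?X i \<omega>) T)
      (PiM UNIV (\<lambda>_. borel)) (\<lambda>\<omega>. \<lambda>i\<in>UNIV. ?X i \<omega> u - ?X i \<omega> s)"
  proof (rule indep_pair_families[where f = "\<lambda>_ p. restrict p T" and g = "\<lambda>_ p. p u - p s" and X = ?X
        and S = "\<lambda>_. path_space"])
    show "indep_vars (\<lambda>_. path_space) ?X UNIV" using bb' unfolding indep_var_def S .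
    show "(\<lambda>p. restrict p T) \<in> measurable path_space (PiM T (\<lambda>_. borel))"
      by (rule measurable_restrict_subset[OF T0])
    show "(\<lambda>p. p u - p s) \<in> borel_measurable (path_space :: (real \<Rightarrow> real) measure)"
      using su by (intro path_increment_measurable) auto
    show "indep_pair (PiM T (\<lambda>_. borel)) (\<lambda>\<omega>. restrict (?X i \<omega>) T) borel (\<lambda>\<omega>. ?X i \<omega> u - ?X i \<omega> s)" for i
      unfolding X_app by (rule standard_bm_past_increment[OF c T su])
  qed auto
  then have "indep_pair (PiM T (\<lambda>_. borel))
      (\<lambda>\<omega>. \<lambda>r\<in>T. complex_of_real ((\<lambda>i\<in>UNIV. restrict (?X i \<omega>) T) True r) / complex_of_real (sqrt 2)
        + \<i> * complex_of_real ((\<lambda>i\<in>UNIV. restrict (?X i \<omega>) T) False r) / complex_of_real (sqrt 2))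
      borel (\<lambda>\<omega>. complex_of_real ((\<lambda>i\<in>UNIV. ?X i \<omega> u - ?X i \<omega> s) True) / complex_of_real (sqrt 2)
        + \<i> * complex_of_real ((\<lambda>i\<in>UNIV. ?X i \<omega> u - ?X i \<omega> s) False) / complex_of_real (sqrt 2))"
  proof (rule indep_pair_compose)
    have [measurable]: "(\<lambda>h. h i r) \<in> borel_measurable (PiM (UNIV :: bool set) (\<lambda>_. PiM T (\<lambda>_. borel :: real measure)))"
      if "r \<in> T" for i r
    proof (rule measurable_compose[of "\<lambda>h. h i" _ "PiM T (\<lambda>_. borel)" "\<lambda>g. g r"])
      show "(\<lambda>h. h i) \<in> measurable (PiM (UNIV :: bool set) (\<lambda>_. PiM T (\<lambda>_. borel :: real measure))) (PiM T (\<lambda>_. borel))"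
        by (rule measurable_component_singleton) simp
      show "(\<lambda>g. g r) \<in> borel_measurable (PiM T (\<lambda>_. borel :: real measure))"
        using that by (rule measurable_component_singleton)
    qed
    show "(\<lambda>h. \<lambda>r\<in>T. complex_of_real (h True r) / complex_of_real (sqrt 2) + \<i> * complex_of_real (h False r) / complex_of_real (sqrt 2))
        \<in> measurable (PiM (UNIV :: bool set) (\<lambda>_. PiM T (\<lambda>_. borel))) (PiM T (\<lambda>_. borel))"
      by (intro measurable_restrict) measurable
    show "(\<lambda>h. complex_of_real (h True) / complex_of_real (sqrt 2) + \<i> * complex_of_real (h False) / complex_of_real (sqrt 2))
        \<in> borel_measurable (PiM (UNIV :: bool set) (\<lambda>_. borel))"
      by measurable
  qed
  then show ?thesis
  proof (rule indep_pair_AE_cong)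
    note Bm = complex_bm_measurable[OF bm]
    show "random_variable (PiM T (\<lambda>_. borel)) (\<lambda>\<omega>. \<lambda>r\<in>T. B r \<omega>)"
      using T by (intro measurable_restrict Bm) auto
    show "random_variable borel (\<lambda>\<omega>. B u \<omega> - B s \<omega>)"
      using su by (intro borel_measurable_diff Bm) auto
  qed (use T0 su in \<open>auto simp: B path_of_def fun_eq_iff field_simps subset_iff\<close>)
qed

lemma complex_bm_char:
  assumes bm: "complex_brownian_motion M B" and su: "0 \<le> s" "s \<le> u"
  shows "(\<integral>\<omega>. iexp (Re (cnj \<zeta> * (B u \<omega> - B s \<omega>))) \<partial>M) = exp (- (u - s) * (cmod \<zeta>)\<^sup>2 / 4)"
proof -
  obtain b b' where b: "standard_brownian_motion M b" "standard_brownian_motion M b'"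
    and bb': "indep_var path_space (path_of b) path_space (path_of b')"
    and B: "\<And>t \<omega>. 0 \<le> t \<Longrightarrow> \<omega> \<in> space M \<Longrightarrow> B t \<omega> = complex_of_real (b t \<omega>) / complex_of_real (sqrt 2)
                 + \<i> * complex_of_real (b' t \<omega>) / complex_of_real (sqrt 2)"
    using bm unfolding complex_brownian_motion_def by blast
  let ?x = "Re \<zeta> / sqrt 2" and ?y = "Im \<zeta> / sqrt 2"
  have iv: "indep_var borel (\<lambda>\<omega>. iexp (?x * (b u \<omega> - b s \<omega>))) borel (\<lambda>\<omega>. iexp (?y * (b' u \<omega> - b' s \<omega>)))"
  proof -
    have [measurable]: "(\<lambda>p. p u - p s) \<in> borel_measurable (path_space :: (real \<Rightarrow> real) measure)"
      using su by (intro path_increment_measurable) auto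
    have "(\<lambda>p. iexp (k * (p u - p s))) \<in> borel_measurable (path_space :: (real \<Rightarrow> real) measure)" for k
      by measurable
    then have "indep_var borel ((\<lambda>p. iexp (?x * (p u - p s))) \<circ> path_of b) borel ((\<lambda>p. iexp (?y * (p u - p s))) \<circ> path_of b')"
      by (intro indep_var_compose[OF bb'])
    then show ?thesis using su by (simp add: comp_def path_of_def)
  qed
  have int: "integrable M (\<lambda>\<omega>. iexp (k * (b'' u \<omega> - b'' s \<omega>)))" if "standard_brownian_motion M b''" for b'' k
  proof -
    have [measurable]: "b'' u \<in> borel_measurable M" "b'' s \<in> borel_measurable M"
      using that su by (auto intro: standard_bm_measurable)
    show ?thesis by (intro integrable_const_bound[of _ 1]) auto
  qed
  have "(\<integral>\<omega>. iexp (Re (cnj \<zeta> * (B u \<omega> - B s \<omega>))) \<partial>M) =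
      (\<integral>\<omega>. iexp (?x * (b u \<omega> - b s \<omega>)) * iexp (?y * (b' u \<omega> - b' s \<omega>)) \<partial>M)"
  proof (rule Bochner_Integration.integral_cong[OF refl])
    fix \<omega> assume "\<omega> \<in> space M"
    then have "Re (cnj \<zeta> * (B u \<omega> - B s \<omega>)) = ?x * (b u \<omega> - b s \<omega>) + ?y * (b' u \<omega> - b' s \<omega>)"
      using su by (simp add: B field_simps)
    then show "iexp (Re (cnj \<zeta> * (B u \<omega> - B s \<omega>))) = iexp (?x * (b u \<omega> - b s \<omega>)) * iexp (?y * (b' u \<omega> - b' s \<omega>))"
      by (simp only: of_real_add distrib_left exp_add)
  qed
  also have "\<dots> = (\<integral>\<omega>. iexp (?x * (b u \<omega> - b s \<omega>)) \<partial>M) * (\<integral>\<omega>. iexp (?y * (b' u \<omega> - b' s \<omega>)) \<partial>M)"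
    by (rule indep_var_lebesgue_integral[OF iv int[OF b(1)] int[OF b(2)]])
  also have "\<dots> = exp (- (u - s) * ?x\<^sup>2 / 2) * exp (- (u - s) * ?y\<^sup>2 / 2)"
    unfolding standard_bm_char[OF b(1) su] standard_bm_char[OF b(2) su] by (rule of_real_mult[symmetric])
  also have "\<dots> = exp (- (u - s) * (cmod \<zeta>)\<^sup>2 / 4)"
    unfolding exp_add[symmetric] cmod_power2
    by (simp add: power_divide field_simps)
  finally show ?thesis .
qed

lemma complex_bm_zero:
  assumes "complex_brownian_motion M B"
  shows "AE \<omega> in M. B 0 \<omega> = 0"
proof -
  obtain b b' where b: "standard_brownian_motion M b" "standard_brownian_motion M b'"
    and B: "\<And>t \<omega>. 0 \<le> t \<Longrightarrow> \<omega> \<in> space M \<Longrightarrow> B t \<omega> = complex_of_real (b t \<omega>) / complex_of_real (sqrt 2)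
                 + \<i> * complex_of_real (b' t \<omega>) / complex_of_real (sqrt 2)"
    using assms unfolding complex_brownian_motion_def by blast
  have "AE \<omega> in M. b 0 \<omega> = 0" "AE \<omega> in M. b' 0 \<omega> = 0"
    using b by (simp_all add: standard_brownian_motion_def)
  then show ?thesis using AE_space by eventually_elim (simp add: B)
qed

end

section \<open>Rotation invariance of Gaussian matrices\<close>

text \<open>The hypotheses say that \<open>U\<close> is unitary and commutes with the diagonal matrix of the weights, so that
  \<open>U\<^sup>* diag(\<sigma>) U = diag(\<sigma>)\<close>.\<close>

lemma weighted_norm_unitary:
  fixes U :: "'k \<Rightarrow> 'k \<Rightarrow> complex" and \<sigma> :: "'k \<Rightarrow> real"
  assumes K: "finite K"
    and orth: "\<And>i j. i \<in> K \<Longrightarrow> j \<in> K \<Longrightarrow> (\<Sum>k\<in>K. U k i * cnj (U k j)) = (if i = j then 1 else 0)"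
    and comm: "\<And>k i. k \<in> K \<Longrightarrow> i \<in> K \<Longrightarrow> U k i \<noteq> 0 \<Longrightarrow> \<sigma> k = \<sigma> i"
  shows "(\<Sum>k\<in>K. \<sigma> k * (cmod (\<Sum>i\<in>K. U k i * x i))\<^sup>2) = (\<Sum>i\<in>K. \<sigma> i * (cmod (x i))\<^sup>2)"
proof -
  have norm2: "complex_of_real ((cmod z)\<^sup>2) = z * cnj z" for z by (rule complex_norm_square)
  have "complex_of_real (\<Sum>k\<in>K. \<sigma> k * (cmod (\<Sum>i\<in>K. U k i * x i))\<^sup>2) =
      (\<Sum>k\<in>K. \<sigma> k * ((\<Sum>i\<in>K. U k i * x i) * cnj (\<Sum>j\<in>K. U k j * x j)))"
    by (simp only: of_real_sum of_real_mult norm2)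
  also have "\<dots> = (\<Sum>k\<in>K. \<Sum>i\<in>K. \<Sum>j\<in>K. \<sigma> i * x i * cnj (x j) * (U k i * cnj (U k j)))"
  proof (rule sum.cong[OF refl])
    fix k assume k: "k \<in> K"
    have "\<sigma> k * ((\<Sum>i\<in>K. U k i * x i) * cnj (\<Sum>j\<in>K. U k j * x j)) =
        (\<Sum>i\<in>K. \<Sum>j\<in>K. \<sigma> k * x i * cnj (x j) * (U k i * cnj (U k j)))"
      unfolding cnj_sum sum_product unfolding sum_distrib_left by (intro sum.cong refl) (simp add: mult_ac)
    also have "\<dots> = (\<Sum>i\<in>K. \<Sum>j\<in>K. \<sigma> i * x i * cnj (x j) * (U k i * cnj (U k j)))"
      using comm[OF k] by (intro sum.cong refl) (metis (no_types) mult_zero_left mult_zero_right)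
    finally show "\<sigma> k * ((\<Sum>i\<in>K. U k i * x i) * cnj (\<Sum>j\<in>K. U k j * x j)) =
        (\<Sum>i\<in>K. \<Sum>j\<in>K. \<sigma> i * x i * cnj (x j) * (U k i * cnj (U k j)))" .
  qed
  also have "\<dots> = (\<Sum>i\<in>K. \<Sum>j\<in>K. \<sigma> i * x i * cnj (x j) * (\<Sum>k\<in>K. U k i * cnj (U k j)))"
    unfolding sum_distrib_left by (rule trans[OF sum.swap]) (rule sum.cong[OF refl sum.swap])
  also have "\<dots> = (\<Sum>i\<in>K. \<sigma> i * (x i * cnj (x i)))"
    using K by (simp add: orth if_distrib sum.delta mult.assoc cong: if_cong)
  also have "\<dots> = complex_of_real (\<Sum>i\<in>K. \<sigma> i * (cmod (x i))\<^sup>2)"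
    by (simp only: of_real_sum of_real_mult norm2)
  finally show ?thesis by (simp only: of_real_eq_iff)
qed

lemma sum_entries:
  "(\<Sum>e\<in>{1..m} \<times> {1..n}. f e) = (\<Sum>i<m. \<Sum>j<n. f (Suc i, Suc j))" for f :: "nat \<times> nat \<Rightarrow> 'a::comm_monoid_add"
proof -
  have "(\<Sum>e\<in>{1..m} \<times> {1..n}. f e) = (\<Sum>i\<in>{1..m}. \<Sum>j\<in>{1..n}. f (i, j))"
    by (simp add: sum.cartesian_product)
  then show ?thesis by (simp add: sum.atLeast1_atMost_eq)
qed

lemma unitary_orthD:
  assumes "unitary n U" "i < n" "j < n"
  shows "(\<Sum>k<n. U $$ (k, i) * cnj (U $$ (k, j))) = (if i = j then 1 else 0)"
proof -
  have U: "U \<in> carrier_mat n n" "mat_adjoint U * U = 1\<^sub>m n" using assms(1) by (auto simp: unitary_def)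
  have "(\<Sum>k<n. U $$ (k, i) * cnj (U $$ (k, j))) = (mat_adjoint U * U) $$ (j, i)"
    using U(1) assms(2,3) by (simp add: scalar_prod_def lessThan_atLeast0 mult.commute)
  then show ?thesis using assms(2,3) by (auto simp: U(2))
qed

definition rotate_entries :: "nat \<Rightarrow> nat \<Rightarrow> complex mat \<Rightarrow> complex mat \<Rightarrow> (nat \<times> nat \<Rightarrow> complex) \<Rightarrow> nat \<times> nat \<Rightarrow> complex" where
  "rotate_entries m n U V z =
     (\<lambda>e\<in>{1..m} \<times> {1..n}. (mat_adjoint U * (matrix_of m n z * V)) $$ (fst e - 1, snd e - 1))"

lemma matrix_of_rotate_entries:
  assumes "U \<in> carrier_mat m m" "V \<in> carrier_mat n n"
  shows "matrix_of m n (rotate_entries m n U V z) = mat_adjoint U * (matrix_of m n z * V)"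
  using assms by (intro eq_matI) (simp_all add: rotate_entries_def)

lemma rotate_entries_index:
  assumes U: "U \<in> carrier_mat m m" and V: "V \<in> carrier_mat n n" and ij: "i < m" "j < n"
  shows "rotate_entries m n U V z (Suc i, Suc j) =
    (\<Sum>k<m. \<Sum>l<n. cnj (U $$ (k, i)) * z (Suc k, Suc l) * V $$ (l, j))"
  using assms
  by (simp add: rotate_entries_def scalar_prod_def lessThan_atLeast0 sum_distrib_left mult.assoc)

lemma rotate_entries_measurable:
  assumes "U \<in> carrier_mat m m" "V \<in> carrier_mat n n"
  shows "rotate_entries m n U V \<in> measurable (entry_space m n) (entry_space m n)"
proof -
  have "(\<lambda>z. rotate_entries m n U V z (Suc i, Suc j)) \<in> borel_measurable (entry_space m n)"
    if "i < m" "j < n" for i j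
    unfolding rotate_entries_index[OF assms that]
    by (intro borel_measurable_sum borel_measurable_times borel_measurable_const measurable_component_singleton) auto
  then have "(\<lambda>z. rotate_entries m n U V z e) \<in> borel_measurable (entry_space m n)" if "e \<in> {1..m} \<times> {1..n}" for e
    using that by (cases e) (metis SigmaD1 SigmaD2 Suc_le_D atLeastAtMost_iff less_eq_Suc_le One_nat_def)
  then have "(\<lambda>z. \<lambda>e\<in>{1..m} \<times> {1..n}. rotate_entries m n U V z e) \<in> measurable (entry_space m n) (entry_space m n)"
    by (intro measurable_restrict)
  moreover have "(\<lambda>e\<in>{1..m} \<times> {1..n}. rotate_entries m n U V z e) = rotate_entries m n U V z" for z
    by (auto simp: rotate_entries_def fun_eq_iff)
  ultimately show ?thesis by simp
qed

text \<open>The law of a matrix of independent centred complex Gaussian entries with variance \<open>\<sigma> i\<close> in row \<open>i\<close>,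
  described by its characteristic function.\<close>

definition gaussian_entries :: "nat \<Rightarrow> nat \<Rightarrow> (nat \<Rightarrow> real) \<Rightarrow> (nat \<times> nat \<Rightarrow> complex) measure \<Rightarrow> bool" where
  "gaussian_entries m n \<sigma> L \<longleftrightarrow> prob_space L \<and> sets L = sets (entry_space m n) \<and>
     (\<forall>\<zeta>. (\<integral>z. iexp (Re (\<Sum>e\<in>{1..m} \<times> {1..n}. cnj (\<zeta> e) * z e)) \<partial>L) =
       exp (- (\<Sum>e\<in>{1..m} \<times> {1..n}. \<sigma> (fst e) * (cmod (\<zeta> e))\<^sup>2) / 4))"

text \<open>The characteristic function at \<open>\<zeta>\<close> of the rotated matrix is the one of the original matrix at
  \<open>U \<zeta> V\<^sup>*\<close>.  It depends on its argument only through the row-weighted norm, which the unitary \<open>V\<close> preserves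
  within each row and the block structure of \<open>U\<close> preserves within each column.\<close>

lemma gaussian_rotation_invariant:
  assumes L: "gaussian_entries m n \<sigma> L" and U: "unitary m U" and V: "unitary n V"
    and comm: "\<And>i j. i < m \<Longrightarrow> j < m \<Longrightarrow> U $$ (i, j) \<noteq> 0 \<Longrightarrow> \<sigma> (Suc i) = \<sigma> (Suc j)"
  shows "distr L (entry_space m n) (rotate_entries m n U V) = L"
proof -
  let ?I = "{1..m} \<times> {1..n}"
  have UV: "U \<in> carrier_mat m m" "V \<in> carrier_mat n n" using U V by (auto simp: unitary_def)
  have setsL [measurable_cong]: "sets L = sets (entry_space m n)" and pL: "prob_space L"
    using L by (auto simp: gaussian_entries_def)
  have char_L: "(\<integral>z. iexp (Re (\<Sum>e\<in>?I. cnj (\<zeta> e) * z e)) \<partial>L) = exp (- (\<Sum>e\<in>?I. \<sigma> (fst e) * (cmod (\<zeta> e))\<^sup>2) / 4)" for \<zeta>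
    using L unfolding gaussian_entries_def by blast
  have comp: "(\<lambda>z. z e) \<in> borel_measurable L" if "e \<in> ?I" for e
    using that by (simp add: measurable_cong_sets[OF setsL refl] measurable_component_singleton)
  have rot: "rotate_entries m n U V \<in> measurable L (entry_space m n)"
    using rotate_entries_measurable[OF UV] by (simp add: measurable_cong_sets[OF setsL refl])
  have "distr L (entry_space m n) (\<lambda>z. \<lambda>e\<in>?I. rotate_entries m n U V z e) = distr L (entry_space m n) (\<lambda>z. \<lambda>e\<in>?I. z e)"
  proof (rule complex_law_eqI_char_function[OF pL pL])
    fix \<zeta> :: "nat \<times> nat \<Rightarrow> complex"
    \<comment> \<open>The dual parameter \<open>U \<zeta> V\<^sup>*\<close>.\<close>
    define \<zeta>' where "\<zeta>' e = (\<Sum>i<m. U $$ (fst e - 1, i) * (\<Sum>j<n. cnj (V $$ (snd e - 1, j)) * \<zeta> (Suc i, Suc j)))" for e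
    have lin: "(\<Sum>e\<in>?I. cnj (\<zeta> e) * rotate_entries m n U V z e) = (\<Sum>e\<in>?I. cnj (\<zeta>' e) * z e)" for z
    proof -
      have "(\<Sum>e\<in>?I. cnj (\<zeta> e) * rotate_entries m n U V z e) =
          (\<Sum>i<m. \<Sum>j<n. \<Sum>k<m. \<Sum>l<n. cnj (\<zeta> (Suc i, Suc j)) * (cnj (U $$ (k, i)) * z (Suc k, Suc l) * V $$ (l, j)))"
        unfolding sum_entries
        by (intro sum.cong refl) (simp add: rotate_entries_index[OF UV] sum_distrib_left)
      also have "\<dots> = (\<Sum>k<m. \<Sum>l<n. \<Sum>i<m. \<Sum>j<n. cnj (\<zeta> (Suc i, Suc j)) * (cnj (U $$ (k, i)) * z (Suc k, Suc l) * V $$ (l, j)))"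
      proof -
        have swap4: "(\<Sum>i<m. \<Sum>j<n. \<Sum>k<m. \<Sum>l<n. F i j k l) = (\<Sum>k<m. \<Sum>l<n. \<Sum>i<m. \<Sum>j<n. F i j k l)"
          for F :: "nat \<Rightarrow> nat \<Rightarrow> nat \<Rightarrow> nat \<Rightarrow> complex"
        proof -
          have "(\<Sum>i<m. \<Sum>j<n. \<Sum>k<m. \<Sum>l<n. F i j k l) = (\<Sum>i<m. \<Sum>k<m. \<Sum>j<n. \<Sum>l<n. F i j k l)"
            by (rule sum.cong[OF refl sum.swap])
          also have "\<dots> = (\<Sum>k<m. \<Sum>i<m. \<Sum>j<n. \<Sum>l<n. F i j k l)" by (rule sum.swap)
          also have "\<dots> = (\<Sum>k<m. \<Sum>i<m. \<Sum>l<n. \<Sum>j<n. F i j k l)"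
            by (rule sum.cong[OF refl], rule sum.cong[OF refl sum.swap])
          also have "\<dots> = (\<Sum>k<m. \<Sum>l<n. \<Sum>i<m. \<Sum>j<n. F i j k l)"
            by (rule sum.cong[OF refl sum.swap])
          finally show ?thesis .
        qed
        show ?thesis by (rule swap4)
      qed
      also have "\<dots> = (\<Sum>e\<in>?I. cnj (\<zeta>' e) * z e)"
        unfolding sum_entries \<zeta>'_def
        by (intro sum.cong refl) (simp add: sum_distrib_left sum_distrib_right mult_ac)
      finally show ?thesis .
    qed
    have row: "(\<Sum>l<n. 1 * (cmod (\<Sum>j<n. cnj (V $$ (l, j)) * \<zeta> (Suc i, Suc j)))\<^sup>2) =
        (\<Sum>j<n. 1 * (cmod (\<zeta> (Suc i, Suc j)))\<^sup>2)" for i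
    proof (rule weighted_norm_unitary[of "{..<n}" "\<lambda>l j. cnj (V $$ (l, j))" "\<lambda>_. 1" "\<lambda>j. \<zeta> (Suc i, Suc j)"])
      fix j j' assume "j \<in> {..<n}" "j' \<in> {..<n}"
      then have "(\<Sum>k<n. V $$ (k, j') * cnj (V $$ (k, j))) = (if j' = j then 1 else 0)"
        by (intro unitary_orthD[OF V]) auto
      then show "(\<Sum>k<n. cnj (V $$ (k, j)) * cnj (cnj (V $$ (k, j')))) = (if j = j' then 1 else 0)"
        by (simp add: mult.commute eq_commute[of j j'])
    qed auto
    have "(\<Sum>e\<in>?I. \<sigma> (fst e) * (cmod (\<zeta>' e))\<^sup>2) = (\<Sum>l<n. \<Sum>k<m. \<sigma> (Suc k) * (cmod (\<zeta>' (Suc k, Suc l)))\<^sup>2)"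
      unfolding sum_entries fst_conv by (rule sum.swap)
    also have "\<dots> = (\<Sum>l<n. \<Sum>i<m. \<sigma> (Suc i) * (cmod (\<Sum>j<n. cnj (V $$ (l, j)) * \<zeta> (Suc i, Suc j)))\<^sup>2)"
    proof (rule sum.cong[OF refl])
      fix l
      show "(\<Sum>k<m. \<sigma> (Suc k) * (cmod (\<zeta>' (Suc k, Suc l)))\<^sup>2) =
          (\<Sum>i<m. \<sigma> (Suc i) * (cmod (\<Sum>j<n. cnj (V $$ (l, j)) * \<zeta> (Suc i, Suc j)))\<^sup>2)"
        unfolding \<zeta>'_def fst_conv snd_conv diff_Suc_1
        by (rule weighted_norm_unitary) (use comm unitary_orthD[OF U] in auto)
    qed
    also have "\<dots> = (\<Sum>i<m. \<sigma> (Suc i) * (\<Sum>l<n. 1 * (cmod (\<Sum>j<n. cnj (V $$ (l, j)) * \<zeta> (Suc i, Suc j)))\<^sup>2))"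
      by (subst sum.swap) (simp add: sum_distrib_left)
    also have "\<dots> = (\<Sum>i<m. \<sigma> (Suc i) * (\<Sum>j<n. 1 * (cmod (\<zeta> (Suc i, Suc j)))\<^sup>2))"
      by (simp only: row)
    also have "\<dots> = (\<Sum>e\<in>?I. \<sigma> (fst e) * (cmod (\<zeta> e))\<^sup>2)"
      unfolding sum_entries by (simp add: sum_distrib_left)
    finally show "(\<integral>z. iexp (Re (\<Sum>e\<in>?I. cnj (\<zeta> e) * rotate_entries m n U V z e)) \<partial>L) =
        (\<integral>z. iexp (Re (\<Sum>e\<in>?I. cnj (\<zeta> e) * z e)) \<partial>L)"
      by (simp only: lin char_L)
  next
    show "(\<lambda>z. rotate_entries m n U V z e) \<in> borel_measurable L" if "e \<in> ?I" for e
      by (rule measurable_compose[OF rot measurable_component_singleton[OF that]])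
  qed (use comp in auto)
  also have "distr L (entry_space m n) (\<lambda>z. \<lambda>e\<in>?I. z e) = distr L L (\<lambda>z. z)"
  proof (rule distr_cong[OF refl setsL[symmetric]])
    fix z assume "z \<in> space L"
    then have "z \<in> extensional ?I" using sets_eq_imp_space_eq[OF setsL] by (auto simp: space_PiM PiE_def)
    then show "(\<lambda>e\<in>?I. z e) = z" by (rule extensional_restrict)
  qed
  also have "\<dots> = L" by (rule distr_id)
  also have "(\<lambda>z. \<lambda>e\<in>?I. rotate_entries m n U V z e) = rotate_entries m n U V"
    by (auto simp: rotate_entries_def fun_eq_iff)
  finally show ?thesis .
qed

definition add_entries :: "nat \<Rightarrow> nat \<Rightarrow> (nat \<times> nat \<Rightarrow> complex) \<Rightarrow> (nat \<times> nat \<Rightarrow> complex) \<Rightarrow> nat \<times> nat \<Rightarrow> complex" where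
  "add_entries m n z y = (\<lambda>e\<in>{1..m} \<times> {1..n}. z e + y e)"

lemma matrix_of_add_entries: "matrix_of m n (add_entries m n z y) = matrix_of m n z + matrix_of m n y"
  by (rule eq_matI) (simp_all add: add_entries_def)

lemma add_entries_measurable [measurable]:
  "(\<lambda>(z, y). add_entries m n z y) \<in> measurable (entry_space m n \<Otimes>\<^sub>M entry_space m n) (entry_space m n)"
  unfolding add_entries_def case_prod_beta
  by (intro measurable_restrict borel_measurable_add
      measurable_compose[OF measurable_fst measurable_component_singleton]
      measurable_compose[OF measurable_snd measurable_component_singleton])

definition diagonal_entries :: "nat \<Rightarrow> nat \<Rightarrow> (nat \<Rightarrow> real) \<Rightarrow> nat \<times> nat \<Rightarrow> complex" where
  "diagonal_entries m n x = (\<lambda>(i, j)\<in>{1..m} \<times> {1..n}. if i = j then complex_of_real (sqrt (x j)) else 0)"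

lemma diagonal_entries_measurable [measurable]:
  "diagonal_entries m n \<in> measurable (PiM {1..n} (\<lambda>_. borel)) (entry_space m n)"
proof -
  have "(\<lambda>x. if fst e = snd e then complex_of_real (sqrt (x (snd e))) else 0) \<in> borel_measurable (PiM {1..n} (\<lambda>_. borel))"
    if "e \<in> {1..m} \<times> {1..n}" for e
  proof -
    have [measurable]: "(\<lambda>x. x (snd e)) \<in> borel_measurable (PiM {1..n} (\<lambda>_. borel :: real measure))"
      using that by (intro measurable_component_singleton) auto
    show ?thesis by measurable
  qed
  then show ?thesis
    unfolding diagonal_entries_def[abs_def] case_prod_beta by (intro measurable_restrict)
qed

lemma gram_spectrum_eqI:
  "ordered_eigenvalues (mat_adjoint (matrix_of m n z) * matrix_of m n z) =
   ordered_eigenvalues (mat_adjoint (matrix_of m' n z') * matrix_of m' n z') \<Longrightarrow>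
   gram_spectrum m n z = gram_spectrum m' n z'"
  by (simp add: gram_spectrum_def)

text \<open>The transition probability from the matrix with entries \<open>z\<close> into the set \<open>E\<close> of spectra, for an
  innovation with law \<open>L\<close>.\<close>

definition spectrum_kernel where
  "spectrum_kernel m n L E z = (\<integral>y. indicator E (gram_spectrum m n (add_entries m n z y)) \<partial>L :: real)"

text \<open>A singular value decomposition of \<open>z\<close> replaces it by its diagonal matrix of
  singular values at the price of rotating the innovation, whose law is invariant.  Since the
  singular values are square roots of the spectrum, the transition probability is a function of the
  spectrum of \<open>z\<close>.\<close>

lemma spectrum_kernel_diagonal:
  assumes L: "gaussian_entries m n \<sigma> L" and np: "n \<le> p" and pm: "p \<le> m"
    and \<sigma>: "\<And>i j. i < m \<Longrightarrow> j < m \<Longrightarrow> (i < p) = (j < p) \<Longrightarrow> \<sigma> (Suc i) = \<sigma> (Suc j)"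
    and zero: "\<And>i j. p \<le> i \<Longrightarrow> i < m \<Longrightarrow> j < n \<Longrightarrow> z (Suc i, Suc j) = 0"
    and E: "E \<in> sets (PiM {1..n} (\<lambda>_. borel))"
  shows "spectrum_kernel m n L E z = spectrum_kernel m n L E (diagonal_entries m n (gram_spectrum m n z))"
proof -
  let ?A = "matrix_of m n z"
  let ?d = "diagonal_entries m n (gram_spectrum m n z)"
  obtain U V where U: "unitary m U" and V: "unitary n V"
    and block: "\<And>i j. i < m \<Longrightarrow> j < m \<Longrightarrow> (i < p) \<noteq> (j < p) \<Longrightarrow> U $$ (i, j) = 0"
    and AV: "?A * V = U * Matrix.mat m n (\<lambda>(i, j). if i = j then complex_of_real (sqrt (ordered_eigenvalues (mat_adjoint ?A * ?A) ! j)) else 0)"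
    using singular_value_decomposition[OF matrix_of_carrier[of m n z] np pm] zero by auto
  have Uc: "U \<in> carrier_mat m m" "mat_adjoint U \<in> carrier_mat m m" and Vc: "V \<in> carrier_mat n n"
    and UU: "U * mat_adjoint U = 1\<^sub>m m"
    using U V by (auto simp: unitary_def)
  have "Matrix.mat m n (\<lambda>(i, j). if i = j then complex_of_real (sqrt (ordered_eigenvalues (mat_adjoint ?A * ?A) ! j)) else 0) = matrix_of m n ?d"
    by (rule eq_matI) (simp_all add: diagonal_entries_def gram_spectrum_def)
  with AV have AV: "?A * V = U * matrix_of m n ?d" by simp
  have gs: "gram_spectrum m n (add_entries m n z y) = gram_spectrum m n (add_entries m n ?d (rotate_entries m n U V y))" for y
  proof (rule gram_spectrum_eqI)
    let ?Y = "matrix_of m n y" and ?D = "matrix_of m n ?d"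
    have "(?A + ?Y) * V = ?A * V + ?Y * V" by (rule add_mult_distrib_mat[OF _ _ Vc]) auto
    also have "?Y * V = (U * mat_adjoint U) * (?Y * V)"
      unfolding UU using Vc by (intro left_mult_one_mat[symmetric] mult_carrier_mat[of _ m n]) auto
    also have "\<dots> = U * (mat_adjoint U * (?Y * V))"
      using Uc Vc by (intro assoc_mult_mat[of _ m m _ m _ n] mult_carrier_mat[of _ m n]) auto
    also have "?A * V + U * (mat_adjoint U * (?Y * V)) = U * (?D + mat_adjoint U * (?Y * V))"
      unfolding AV using Uc Vc
      by (intro mult_add_distrib_mat[symmetric, of _ m m _ n] mult_carrier_mat[of _ m m] mult_carrier_mat[of _ m n]) auto
    finally have eq: "(?A + ?Y) * V = U * (?D + mat_adjoint U * (?Y * V))" .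
    have "ordered_eigenvalues (mat_adjoint (?A + ?Y) * (?A + ?Y)) =
        ordered_eigenvalues (mat_adjoint ((?A + ?Y) * V) * ((?A + ?Y) * V))"
      by (rule ordered_eigenvalues_gram_unitary_right[where m = m, OF _ V, symmetric]) (rule add_carrier_mat, simp)
    also have "mat_adjoint ((?A + ?Y) * V) * ((?A + ?Y) * V) =
        mat_adjoint (?D + mat_adjoint U * (?Y * V)) * (?D + mat_adjoint U * (?Y * V))"
      unfolding eq
      by (rule gram_unitary_left[where n = n, OF _ U])
        (intro add_carrier_mat mult_carrier_mat[OF Uc(2)] mult_carrier_mat[OF _ Vc] matrix_of_carrier)
    finally show "ordered_eigenvalues (mat_adjoint (matrix_of m n (add_entries m n z y)) * matrix_of m n (add_entries m n z y)) =
        ordered_eigenvalues (mat_adjoint (matrix_of m n (add_entries m n ?d (rotate_entries m n U V y)))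
          * matrix_of m n (add_entries m n ?d (rotate_entries m n U V y)))"
      unfolding matrix_of_add_entries matrix_of_rotate_entries[OF Uc(1) Vc] .
  qed
  have setsL [measurable_cong]: "sets L = sets (entry_space m n)" using L by (simp add: gaussian_entries_def)
  have [measurable]: "rotate_entries m n U V \<in> measurable L (entry_space m n)"
    using rotate_entries_measurable[OF Uc(1) Vc] by (simp add: measurable_cong_sets[OF setsL refl])
  have d: "?d \<in> space (entry_space m n)"
    by (auto simp: diagonal_entries_def space_PiM)
  have [measurable]: "(\<lambda>y. add_entries m n ?d y) \<in> measurable (entry_space m n) (entry_space m n)"
    using measurable_compose[OF measurable_Pair1'[OF d] add_entries_measurable] by simp
  note E [measurable]
  have "spectrum_kernel m n L E z =
      (\<integral>y. indicator E (gram_spectrum m n (add_entries m n ?d (rotate_entries m n U V y))) \<partial>L)"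
    unfolding spectrum_kernel_def gs ..
  also have "\<dots> = (\<integral>y. indicator E (gram_spectrum m n (add_entries m n ?d y)) \<partial>distr L (entry_space m n) (rotate_entries m n U V))"
    by (rule integral_distr[symmetric]) measurable
  also have "distr L (entry_space m n) (rotate_entries m n U V) = L"
    using block \<sigma> by (intro gaussian_rotation_invariant[OF L U V]) blast
  finally show ?thesis unfolding spectrum_kernel_def .
qed

section \<open>Conditional expectation given an independent past\<close>

context prob_space
begin

text \<open>The law of \<open>(U, W)\<close> is a product, so integrating out \<open>W\<close> first gives the conditional expectation of
  \<open>\<psi> (U, W)\<close> given \<open>U\<close>.  If the result happens to be measurable for a smaller \<open>\<sigma>\<close>-algebra \<open>F\<close>, then it is
  also the conditional expectation given \<open>F\<close>.\<close>

lemma real_cond_exp_indep_pair: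
  assumes ind: "indep_pair P U Q W" and F: "subalgebra M F"
    and FU: "\<And>A. A \<in> sets F \<Longrightarrow> \<exists>A'\<in>sets P. A = U -` A' \<inter> space M"
    and \<psi> [measurable]: "\<psi> \<in> borel_measurable (P \<Otimes>\<^sub>M Q)" and bound: "\<And>z. \<bar>\<psi> z\<bar> \<le> (1::real)"
    and gF: "g \<in> borel_measurable F"
    and g: "\<And>\<omega>. \<omega> \<in> space M \<Longrightarrow> (\<integral>y. \<psi> (U \<omega>, y) \<partial>distr M Q W) = g \<omega>"
  shows "AE \<omega> in M. real_cond_exp M F (\<lambda>\<omega>. \<psi> (U \<omega>, W \<omega>)) \<omega> = g \<omega>"
proof -
  interpret F: finite_measure_subalgebra M F by unfold_locales (rule F)
  have [measurable]: "U \<in> measurable M P" "W \<in> measurable M Q" using indep_pairD[OF ind] by auto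
  interpret U: prob_space "distr M P U" by (rule prob_space_distr) measurable
  interpret W: prob_space "distr M Q W" by (rule prob_space_distr) measurable
  interpret UW: pair_prob_space "distr M P U" "distr M Q W" by unfold_locales
  have [measurable]: "g \<in> borel_measurable M" by (rule measurable_from_subalg[OF F gF])
  let ?G = "\<lambda>x. \<integral>y. \<psi> (x, y) \<partial>distr M Q W"
  have G [measurable]: "?G \<in> borel_measurable P"
    by (rule W.borel_measurable_lebesgue_integral) measurable
  have "\<bar>g \<omega>\<bar> \<le> 1" if "\<omega> \<in> space M" for \<omega>
  proof -
    have U\<omega> [measurable]: "U \<omega> \<in> space P" using that measurable_space[of U M P] by simp
    have int: "integrable (distr M Q W) (\<lambda>y. \<psi> (U \<omega>, y))"
      by (intro W.integrable_const_bound[of _ 1]) (use bound in auto)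
    have "\<bar>?G (U \<omega>)\<bar> \<le> (\<integral>y. \<bar>\<psi> (U \<omega>, y)\<bar> \<partial>distr M Q W)" by (rule integral_abs_bound)
    also have "\<dots> \<le> (\<integral>y. 1 \<partial>distr M Q W)" by (intro integral_mono integrable_abs int) (use bound in auto)
    finally show ?thesis using g[OF that] W.prob_space by simp
  qed
  then have gint: "integrable M g" by (intro integrable_const_bound[of _ 1] AE_I2) auto
  have \<psi>int: "integrable M (\<lambda>\<omega>. \<psi> (U \<omega>, W \<omega>))"
    by (intro integrable_const_bound[of _ 1]) (use bound in auto)
  show ?thesis
  proof (rule F.real_cond_exp_charact[OF _ \<psi>int gint gF])
    fix A assume "A \<in> sets F"
    then obtain A' where A' [measurable]: "A' \<in> sets P" and A: "A = U -` A' \<inter> space M" using FU by blast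
    let ?f = "\<lambda>(x, y). indicator A' x * \<psi> (x, y)"
    have f [measurable]: "?f \<in> borel_measurable (P \<Otimes>\<^sub>M Q)" by measurable
    have fint: "integrable (distr M P U \<Otimes>\<^sub>M distr M Q W) ?f"
      by (intro UW.integrable_const_bound[of _ 1] AE_I2) (use bound in \<open>auto simp: indicator_def\<close>)
    have "(\<integral>x\<in>A. \<psi> (U x, W x) \<partial>M) = (\<integral>\<omega>. ?f (U \<omega>, W \<omega>) \<partial>M)"
      unfolding set_lebesgue_integral_def A
      by (intro Bochner_Integration.integral_cong) (auto simp: indicator_def)
    also have "\<dots> = (\<integral>z. ?f z \<partial>distr M (P \<Otimes>\<^sub>M Q) (\<lambda>\<omega>. (U \<omega>, W \<omega>)))"
      by (rule integral_distr[symmetric]) measurable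
    also have "\<dots> = (\<integral>z. ?f z \<partial>(distr M P U \<Otimes>\<^sub>M distr M Q W))" unfolding distr_indep_pair[OF ind] ..
    also have "\<dots> = (\<integral>x. \<integral>y. ?f (x, y) \<partial>distr M Q W \<partial>distr M P U)"
      by (rule UW.integral_fst'[OF fint, symmetric])
    also have "\<dots> = (\<integral>x. indicator A' x * ?G x \<partial>distr M P U)" by simp
    also have "\<dots> = (\<integral>\<omega>. indicator A' (U \<omega>) * ?G (U \<omega>) \<partial>M)"
      by (rule integral_distr) measurable
    also have "\<dots> = (\<integral>x\<in>A. g x \<partial>M)"
      unfolding set_lebesgue_integral_def A
      by (intro Bochner_Integration.integral_cong) (auto simp: indicator_def g)
    finally show "(\<integral>x\<in>A. \<psi> (U x, W x) \<partial>M) = (\<integral>x\<in>A. g x \<partial>M)" .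
  qed
qed

end


section \<open>The innovation of the matrix process\<close>

text \<open>The row index \<open>i\<close> decides between an old row (\<open>i \<le> p\<close>), which contributes an increment, and a new row,
  which is added to the zero matrix with its full value at time \<open>u\<close>.\<close>

definition innovation :: "nat \<Rightarrow> real \<Rightarrow> real \<Rightarrow> nat \<Rightarrow> (real \<Rightarrow> complex) \<Rightarrow> complex" where
  "innovation p s u i w = w u - (if i \<le> p then w s else 0)"

lemma innovation_measurable:
  assumes "0 \<le> s" "0 \<le> u"
  shows "innovation p s u i \<in> borel_measurable path_space"
proof -
  have [measurable]: "(\<lambda>w :: real \<Rightarrow> complex. w s) \<in> borel_measurable path_space"
    "(\<lambda>w :: real \<Rightarrow> complex. w u) \<in> borel_measurable path_space"
    using assms by (auto intro: measurable_component_singleton)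
  show ?thesis unfolding innovation_def[abs_def] by measurable
qed

definition innovation_entries ::
    "(nat \<Rightarrow> nat \<Rightarrow> real \<Rightarrow> 'w \<Rightarrow> complex) \<Rightarrow> nat \<Rightarrow> nat \<Rightarrow> nat \<Rightarrow> real \<Rightarrow> real \<Rightarrow> 'w \<Rightarrow> nat \<times> nat \<Rightarrow> complex" where
  "innovation_entries B m n p s u \<omega> =
     (\<lambda>e\<in>{1..m} \<times> {1..n}. innovation p s u (fst e) (path_of (B (fst e) (snd e)) \<omega>))"

text \<open>The rows beyond \<open>p\<close> carry the trivial path on the empty set of times: they have no past.\<close>

definition past_entries ::
    "(nat \<Rightarrow> nat \<Rightarrow> real \<Rightarrow> 'w \<Rightarrow> complex) \<Rightarrow> nat \<Rightarrow> nat \<Rightarrow> nat \<Rightarrow> real set \<Rightarrow> 'w \<Rightarrow> nat \<times> nat \<Rightarrow> real \<Rightarrow> complex" where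
  "past_entries B m n p T \<omega> =
     (\<lambda>e\<in>{1..m} \<times> {1..n}. restrict (path_of (B (fst e) (snd e)) \<omega>) (if fst e \<le> p then T else {}))"

abbreviation past_space :: "nat \<Rightarrow> nat \<Rightarrow> nat \<Rightarrow> real set \<Rightarrow> (nat \<times> nat \<Rightarrow> real \<Rightarrow> complex) measure" where
  "past_space m n p T \<equiv> PiM ({1..m} \<times> {1..n}) (\<lambda>e. PiM (if fst e \<le> p then T else {}) (\<lambda>_. borel))"

context prob_space
begin

lemma iid_complex_bmD:
  assumes "iid_complex_brownian_motions M B"
  shows "e \<in> {1..m} \<times> {1..n} \<Longrightarrow> complex_brownian_motion M (B (fst e) (snd e))"
    and "indep_vars (\<lambda>_. path_space) (\<lambda>e. path_of (B (fst e) (snd e))) ({1..m} \<times> {1..n})"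
proof -
  show "complex_brownian_motion M (B (fst e) (snd e))" if "e \<in> {1..m} \<times> {1..n}"
    using that assms by (auto simp: iid_complex_brownian_motions_def)
  have "indep_vars (\<lambda>_. path_space) (\<lambda>e. path_of (B (fst e) (snd e))) ({1..} \<times> {1..})"
    using assms unfolding iid_complex_brownian_motions_def case_prod_beta' by blast
  then show "indep_vars (\<lambda>_. path_space) (\<lambda>e. path_of (B (fst e) (snd e))) ({1..m} \<times> {1..n})"
    by (rule indep_vars_subset) auto
qed

lemma innovation_path_of:
  "0 \<le> s \<Longrightarrow> 0 \<le> u \<Longrightarrow> innovation p s u i (path_of b \<omega>) = b u \<omega> - (if i \<le> p then b s \<omega> else 0)"
  by (simp add: innovation_def path_of_def)

lemma past_innovation_indep:
  assumes B: "iid_complex_brownian_motions M B" and mn: "1 \<le> m" "1 \<le> n"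
    and T: "finite T" "\<And>r. r \<in> T \<Longrightarrow> 0 \<le> r \<and> r \<le> s" and su: "0 \<le> s" "s \<le> u"
  shows "indep_pair (past_space m n p T) (past_entries B m n p T) (entry_space m n) (innovation_entries B m n p s u)"
  unfolding past_entries_def[abs_def] innovation_entries_def[abs_def]
proof (rule indep_pair_families[where S = "\<lambda>_. path_space" and X = "\<lambda>e. path_of (B (fst e) (snd e))"
      and f = "\<lambda>e w. restrict w (if fst e \<le> p then T else {})" and g = "\<lambda>e. innovation p s u (fst e)"])
  show "finite ({1..m} \<times> {1..n})" "{1..m} \<times> {1..n} \<noteq> {}" using mn by auto
  show "indep_vars (\<lambda>_. path_space) (\<lambda>e. path_of (B (fst e) (snd e))) ({1..m} \<times> {1..n})"
    by (rule iid_complex_bmD[OF B])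
  fix e assume e: "e \<in> {1..m} \<times> {1..n}"
  note bm = iid_complex_bmD(1)[OF B e]
  have T0: "T \<subseteq> {0..}" using T by auto
  show "(\<lambda>w. restrict w (if fst e \<le> p then T else {})) \<in> measurable path_space (PiM (if fst e \<le> p then T else {}) (\<lambda>_. borel :: complex measure))"
    by (rule measurable_restrict_subset) (use T0 in auto)
  show "innovation p s u (fst e) \<in> borel_measurable path_space" using su by (intro innovation_measurable) auto
  have inn: "innovation p s u (fst e) (path_of (B (fst e) (snd e)) \<omega>) =
      B (fst e) (snd e) u \<omega> - (if fst e \<le> p then B (fst e) (snd e) s \<omega> else 0)" for \<omega>
    using su by (intro innovation_path_of) auto
  show "indep_pair (PiM (if fst e \<le> p then T else {}) (\<lambda>_. borel))
      (\<lambda>\<omega>. restrict (path_of (B (fst e) (snd e)) \<omega>) (if fst e \<le> p then T else {}))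
      borel (\<lambda>\<omega>. innovation p s u (fst e) (path_of (B (fst e) (snd e)) \<omega>))"
  proof (cases "fst e \<le> p")
    case True
    have "restrict (path_of (B (fst e) (snd e)) \<omega>) T = (\<lambda>r\<in>T. B (fst e) (snd e) r \<omega>)" for \<omega>
      using T0 by (auto simp: path_of_def fun_eq_iff)
    then show ?thesis using True complex_bm_past_increment[OF bm T su] unfolding inn by simp
  next
    case False
    have "indep_pair (PiM {} (\<lambda>_. borel)) (\<lambda>_. (\<lambda>_. undefined) :: real \<Rightarrow> complex) borel (\<lambda>\<omega>. B (fst e) (snd e) u \<omega>)"
      using complex_bm_measurable[OF bm] su by (intro indep_pair_const_left) (auto simp: space_PiM)
    moreover have "restrict (path_of (B (fst e) (snd e)) \<omega>) {} = (\<lambda>_. undefined)" for \<omega> by (simp add: restrict_def)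
    ultimately show ?thesis using False unfolding inn by simp
  qed
qed

text \<open>For new rows, the value at time \<open>u\<close> is almost surely an increment from time \<open>0\<close>, which gives the
  variance \<open>u\<close>.\<close>

lemma innovation_gaussian:
  assumes B: "iid_complex_brownian_motions M B" and su: "0 \<le> s" "s \<le> u"
  shows "gaussian_entries m n (\<lambda>i. if i \<le> p then u - s else u) (distr M (entry_space m n) (innovation_entries B m n p s u))"
proof -
  let ?I = "{1..m} \<times> {1..n}" and ?\<sigma> = "\<lambda>i. if i \<le> p then u - s else u"
  let ?D = "\<lambda>e \<omega>. innovation p s u (fst e) (path_of (B (fst e) (snd e)) \<omega>)"
  have inn: "?D e \<omega> = B (fst e) (snd e) u \<omega> - (if fst e \<le> p then B (fst e) (snd e) s \<omega> else 0)" for e \<omega>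
    using su by (intro innovation_path_of) auto
  have meas: "innovation p s u i \<in> borel_measurable path_space" for i using su by (intro innovation_measurable) auto
  have path: "path_of (B (fst e) (snd e)) \<in> measurable M path_space" if "e \<in> ?I" for e
    using iid_complex_bmD(2)[OF B, of m n] that by (auto simp: indep_vars_def)
  have D: "?D e \<in> borel_measurable M" if "e \<in> ?I" for e
    by (rule measurable_compose[OF path[OF that] meas])
  have N: "innovation_entries B m n p s u \<in> measurable M (entry_space m n)"
    unfolding innovation_entries_def[abs_def] by (intro measurable_restrict D)
  have char_D: "(\<integral>\<omega>. iexp (Re (cnj z * ?D e \<omega>)) \<partial>M) = exp (- (?\<sigma> (fst e) * (cmod z)\<^sup>2) / 4)"
    if e: "e \<in> ?I" for e z
  proof -
    note bm = iid_complex_bmD(1)[OF B e]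
    show ?thesis
    proof (cases "fst e \<le> p")
      case True
      then show ?thesis using complex_bm_char[OF bm su, of z] by (simp only: inn if_True minus_mult_left)
    next
      case False
      have [measurable]: "B (fst e) (snd e) u \<in> borel_measurable M" "B (fst e) (snd e) 0 \<in> borel_measurable M"
        using complex_bm_measurable[OF bm] su by auto
      have "(\<integral>\<omega>. iexp (Re (cnj z * ?D e \<omega>)) \<partial>M) = (\<integral>\<omega>. iexp (Re (cnj z * (B (fst e) (snd e) u \<omega> - B (fst e) (snd e) 0 \<omega>))) \<partial>M)"
        using complex_bm_zero[OF bm] False unfolding inn
        by (intro integral_cong_AE) auto
      also have "\<dots> = exp (- (u - 0) * (cmod z)\<^sup>2 / 4)" using su by (intro complex_bm_char[OF bm]) auto
      finally show ?thesis using False by simp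
    qed
  qed
  show ?thesis
    unfolding gaussian_entries_def
  proof (intro conjI allI)
    show "prob_space (distr M (entry_space m n) (innovation_entries B m n p s u))" by (rule prob_space_distr[OF N])
    fix \<zeta> :: "nat \<times> nat \<Rightarrow> complex"
    have [measurable]: "(\<lambda>z. z e) \<in> borel_measurable (entry_space m n)" if "e \<in> ?I" for e
      using that by (rule measurable_component_singleton)
    have "(\<integral>z. iexp (Re (\<Sum>e\<in>?I. cnj (\<zeta> e) * z e)) \<partial>distr M (entry_space m n) (innovation_entries B m n p s u)) =
        (\<integral>\<omega>. iexp (Re (\<Sum>e\<in>?I. cnj (\<zeta> e) * innovation_entries B m n p s u \<omega> e)) \<partial>M)"
      by (rule integral_distr[OF N]) measurable
    also have "\<dots> = (\<integral>\<omega>. iexp (1 * (\<Sum>e\<in>?I. Re (cnj (\<zeta> e) * ?D e \<omega>))) \<partial>M)"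
      unfolding innovation_entries_def Re_sum by simp
    also have "\<dots> = char (distr M borel (\<lambda>\<omega>. \<Sum>e\<in>?I. Re (cnj (\<zeta> e) * ?D e \<omega>))) 1"
      unfolding char_def
      by (rule integral_distr[symmetric]) (use D in \<open>auto intro!: borel_measurable_sum\<close>)
    also have "\<dots> = (\<Prod>e\<in>?I. char (distr M borel (\<lambda>\<omega>. Re (cnj (\<zeta> e) * ?D e \<omega>))) 1)"
    proof (rule char_distr_sum)
      have [measurable]: "innovation p s u i \<in> borel_measurable path_space" for i by (rule meas)
      show "indep_vars (\<lambda>_. borel) (\<lambda>e \<omega>. Re (cnj (\<zeta> e) * ?D e \<omega>)) ?I"
        by (rule indep_vars_compose2[OF iid_complex_bmD(2)[OF B], where Y = "\<lambda>e w. Re (cnj (\<zeta> e) * innovation p s u (fst e) w)"])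
          measurable
    qed
    also have "\<dots> = (\<Prod>e\<in>?I. complex_of_real (exp (- (?\<sigma> (fst e) * (cmod (\<zeta> e))\<^sup>2) / 4)))"
    proof (rule prod.cong[OF refl])
      fix e assume e: "e \<in> ?I"
      have [measurable]: "?D e \<in> borel_measurable M" by (rule D[OF e])
      have "char (distr M borel (\<lambda>\<omega>. Re (cnj (\<zeta> e) * ?D e \<omega>))) 1 = (\<integral>\<omega>. iexp (1 * Re (cnj (\<zeta> e) * ?D e \<omega>)) \<partial>M)"
        unfolding char_def by (rule integral_distr) measurable
      then show "char (distr M borel (\<lambda>\<omega>. Re (cnj (\<zeta> e) * ?D e \<omega>))) 1 = complex_of_real (exp (- (?\<sigma> (fst e) * (cmod (\<zeta> e))\<^sup>2) / 4))"
        using char_D[OF e, of "\<zeta> e"] by (simp only: mult_1_left)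
    qed
    also have "\<dots> = exp (- (\<Sum>e\<in>?I. ?\<sigma> (fst e) * (cmod (\<zeta> e))\<^sup>2) / 4)"
      unfolding of_real_prod[symmetric]
      by (simp only: exp_sum[symmetric] finite_cartesian_product finite_atLeastAtMost sum_negf[symmetric] sum_divide_distrib)
    finally show "(\<integral>z. iexp (Re (\<Sum>e\<in>?I. cnj (\<zeta> e) * z e)) \<partial>distr M (entry_space m n) (innovation_entries B m n p s u)) =
        exp (- (\<Sum>e\<in>?I. ?\<sigma> (fst e) * (cmod (\<zeta> e))\<^sup>2) / 4)" .
  qed simp
qed

end

section \<open>The Markov property\<close>

lemma squared_singular_values_eq_gram_spectrum:
  "squared_singular_values B N \<alpha> t \<omega> = gram_spectrum (N + \<alpha>) N (\<lambda>e. B (fst e) (snd e) t \<omega>)"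
proof -
  have "brownian_matrix B N \<alpha> t \<omega> = matrix_of (N + \<alpha>) N (\<lambda>e. B (fst e) (snd e) t \<omega>)"
    by (rule eq_matI) (simp_all add: brownian_matrix_def)
  then show ?thesis by (simp add: squared_singular_values_def gram_spectrum_def)
qed

lemma gram_spectrum_cong:
  assumes "\<And>e. e \<in> {1..m} \<times> {1..n} \<Longrightarrow> z e = z' e"
  shows "gram_spectrum m n z = gram_spectrum m n z'"
proof -
  have "matrix_of m n z = matrix_of m n z'" by (rule eq_matI) (simp_all add: assms)
  then show ?thesis by (simp add: gram_spectrum_def)
qed

text \<open>Adding zero rows does not change \<open>A\<^sup>* A\<close>.  Matrices with different numbers of rows can thus be compared
  within the larger format.\<close>

lemma gram_spectrum_zero_rows:
  assumes pm: "p \<le> m"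
  shows "gram_spectrum m n (\<lambda>e. if fst e \<le> p then z e else 0) = gram_spectrum p n z"
proof -
  let ?z = "\<lambda>e. if fst e \<le> p then z e else 0"
  have "mat_adjoint (matrix_of m n ?z) * matrix_of m n ?z = mat_adjoint (matrix_of p n z) * matrix_of p n z"
  proof (rule eq_matI)
    fix i j assume "i < dim_row (mat_adjoint (matrix_of p n z) * matrix_of p n z)"
      "j < dim_col (mat_adjoint (matrix_of p n z) * matrix_of p n z)"
    then have ij: "i < n" "j < n" by simp_all
    have "(\<Sum>r<m. cnj (?z (Suc r, Suc i)) * ?z (Suc r, Suc j)) = (\<Sum>r<p. cnj (z (Suc r, Suc i)) * z (Suc r, Suc j))"
      using pm by (intro sum.mono_neutral_cong_right) auto
    then show "(mat_adjoint (matrix_of m n ?z) * matrix_of m n ?z) $$ (i, j) =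
        (mat_adjoint (matrix_of p n z) * matrix_of p n z) $$ (i, j)"
      using ij by (simp add: scalar_prod_def lessThan_atLeast0)
  qed simp_all
  then show ?thesis by (simp add: gram_spectrum_def)
qed

lemma sets_generated_algebra:
  "sets (generated_algebra M S X I) = sigma_sets (space M) (\<Union>i\<in>I. {X i -` E \<inter> space M | E. E \<in> sets S})"
  "space (generated_algebra M S X I) = space M"
  unfolding generated_algebra_def by (auto intro!: sets_measure_of space_measure_of)

lemma measurable_generated_algebra:
  assumes "k \<in> I" "X k \<in> measurable M S"
  shows "X k \<in> measurable (generated_algebra M S X I) S"
proof (rule measurableI)
  fix E assume "E \<in> sets S"
  then show "X k -` E \<inter> space (generated_algebra M S X I) \<in> sets (generated_algebra M S X I)"
    using assms(1) unfolding sets_generated_algebra by (intro sigma_sets.Basic) auto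
qed (use assms(2) in \<open>auto simp: sets_generated_algebra dest: measurable_space\<close>)

lemma generated_algebra_subset_vimage:
  assumes U: "U \<in> space M \<rightarrow> space P" and X: "\<And>k. k \<in> I \<Longrightarrow> f k \<in> measurable P S"
    and eq: "\<And>k \<omega>. k \<in> I \<Longrightarrow> \<omega> \<in> space M \<Longrightarrow> X k \<omega> = f k (U \<omega>)"
    and A: "A \<in> sets (generated_algebra M S X I)"
  shows "\<exists>A'\<in>sets P. A = U -` A' \<inter> space M"
proof -
  have "sets (generated_algebra M S X I) \<subseteq> sets (vimage_algebra (space M) U P)"
    unfolding sets_generated_algebra(1)
  proof (rule sets.sigma_sets_subset')
    show "space M \<in> sets (vimage_algebra (space M) U P)"
      using sets.top[of "vimage_algebra (space M) U P"] by simp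
    show "(\<Union>i\<in>I. {X i -` E \<inter> space M | E. E \<in> sets S}) \<subseteq> sets (vimage_algebra (space M) U P)"
    proof safe
      fix k E assume k: "k \<in> I" and E: "E \<in> sets S"
      have "X k -` E \<inter> space M = U -` (f k -` E \<inter> space P) \<inter> space M"
        using U eq[OF k] by auto
      then show "X k -` E \<inter> space M \<in> sets (vimage_algebra (space M) U P)"
        using in_vimage_algebra[OF measurable_sets[OF X[OF k] E], of U "space M"] by (simp only:)
    qed
  qed
  then show ?thesis using A sets_vimage_algebra2[OF U] by blast
qed

lemma spectrum_kernel_measurable:
  assumes L: "prob_space L" "sets L = sets (entry_space m n)" and E [measurable]: "E \<in> sets (PiM {1..n} (\<lambda>_. borel))"
  shows "spectrum_kernel m n L E \<in> borel_measurable (entry_space m n)"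
proof -
  interpret prob_space L by fact
  note L(2) [measurable_cong]
  have "(\<lambda>(z, y). indicator E (gram_spectrum m n (add_entries m n z y)) :: real) \<in> borel_measurable (entry_space m n \<Otimes>\<^sub>M entry_space m n)"
    unfolding case_prod_beta
    by (rule measurable_compose[OF measurable_compose[OF add_entries_measurable[unfolded case_prod_beta] gram_spectrum_measurable]])
      (rule borel_measurable_indicator[OF E])
  then have "(\<lambda>(z, y). indicator E (gram_spectrum m n (add_entries m n z y)) :: real) \<in> borel_measurable (entry_space m n \<Otimes>\<^sub>M L)"
    by (simp only: measurable_cong_sets[OF sets_pair_measure_cong[OF refl L(2)] refl])
  then show ?thesis
    unfolding spectrum_kernel_def[abs_def] by (rule borel_measurable_lebesgue_integral)
qed

lemma time_like_path_mono:
  assumes "time_like_path m \<alpha> t" "1 \<le> k" "k \<le> l" "l \<le> m"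
  shows "\<alpha> k \<le> \<alpha> l" "t k \<le> t l"
proof -
  have "\<alpha> k \<le> \<alpha> l \<and> t k \<le> t l"
    using assms(3,4)
  proof (induction l rule: dec_induct)
    case (step l)
    then have "\<alpha> l \<le> \<alpha> (Suc l) \<and> t l \<le> t (Suc l)"
      using assms(1,2) unfolding time_like_path_def by auto
    then show ?case using step by auto
  qed simp
  then show "\<alpha> k \<le> \<alpha> l" "t k \<le> t l" by auto
qed

context prob_space
begin

lemma squared_singular_values_measurable:
  assumes B: "iid_complex_brownian_motions M B" and t: "0 \<le> t"
  shows "squared_singular_values B N \<alpha> t \<in> measurable M (PiM {1..N} (\<lambda>_. borel))"
proof -
  let ?z = "\<lambda>\<omega>. \<lambda>e\<in>{1..N + \<alpha>} \<times> {1..N}. B (fst e) (snd e) t \<omega>"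
  have "?z \<in> measurable M (entry_space (N + \<alpha>) N)"
    by (intro measurable_restrict complex_bm_measurable iid_complex_bmD(1)[OF B] t)
  then have "(\<lambda>\<omega>. gram_spectrum (N + \<alpha>) N (?z \<omega>)) \<in> measurable M (PiM {1..N} (\<lambda>_. borel))"
    by (rule measurable_compose[OF _ gram_spectrum_measurable])
  moreover have "gram_spectrum (N + \<alpha>) N (?z \<omega>) = squared_singular_values B N \<alpha> t \<omega>" for \<omega>
    unfolding squared_singular_values_eq_gram_spectrum by (rule gram_spectrum_cong) simp
  ultimately show ?thesis by simp
qed

text \<open>The kernel evaluated at the current spectrum is measurable for the current spectrum alone, and it is
  the conditional expectation given the whole Brownian past.  The spectra at the times in \<open>I\<close> generate
  a \<open>\<sigma>\<close>-algebra between these two, so it is also the conditional expectation given them.\<close>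

lemma real_cond_exp_squared_singular_values:
  fixes \<alpha> :: "nat \<Rightarrow> nat" and t :: "nat \<Rightarrow> real"
  assumes B: "iid_complex_brownian_motions M B" and N: "1 \<le> N"
    and t0: "\<And>l. l \<in> {1..Suc k} \<Longrightarrow> 0 < t l" and path: "time_like_path (Suc k) \<alpha> t" and k: "1 \<le> k"
    and E: "E \<in> sets (PiM {1..N} (\<lambda>_. borel))" and I: "k \<in> I" "I \<subseteq> {1..k}"
  defines "X \<equiv> \<lambda>k \<omega>. squared_singular_values B N (\<alpha> k) (t k) \<omega>"
    and "m \<equiv> N + \<alpha> (Suc k)" and "p \<equiv> N + \<alpha> k"
  defines "L \<equiv> distr M (entry_space m N) (innovation_entries B m N p (t k) (t (Suc k)))"
  shows "AE \<omega> in M. real_cond_exp M (generated_algebra M (PiM {1..N} (\<lambda>_. borel)) X I) (\<lambda>\<omega>. indicator E (X (Suc k) \<omega>)) \<omega>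
     = spectrum_kernel m N L E (diagonal_entries m N (X k \<omega>))"
proof -
  let ?S = "PiM {1..N} (\<lambda>_. borel) :: (nat \<Rightarrow> real) measure"
  let ?I = "{1..m} \<times> {1..N}"
  let ?F = "generated_algebra M ?S X I"
  define s u where "s = t k" and "u = t (Suc k)"
  define T where "T = t ` {1..k}"
  have su: "0 \<le> s" "s \<le> u" and pm: "p \<le> m"
    using t0[of k] k time_like_path_mono[OF path k, of "Suc k"] by (auto simp: s_def u_def p_def m_def)
  have "0 \<le> r \<and> r \<le> s" if r: "r \<in> T" for r
  proof -
    obtain l where l: "1 \<le> l" "l \<le> k" "r = t l" using r by (auto simp: T_def)
    then show ?thesis using t0[of l] time_like_path_mono(2)[OF path, of l k] by (simp add: s_def)
  qed
  then have T: "finite T" "\<And>r. r \<in> T \<Longrightarrow> 0 \<le> r \<and> r \<le> s" by (simp_all add: T_def)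
  have sT: "s \<in> T" using k by (simp add: s_def T_def)
  let ?U = "past_entries B m N p T" and ?W = "innovation_entries B m N p s u"
  let ?P = "past_space m N p T"
  have m1: "1 \<le> m" using N by (simp add: m_def)
  have ind: "indep_pair ?P ?U (entry_space m N) ?W"
    by (rule past_innovation_indep[OF B m1 N T su])
  have U: "?U \<in> measurable M ?P" by (rule indep_pairD(1)[OF ind])
  have L: "gaussian_entries m N (\<lambda>i. if i \<le> p then u - s else u) L"
    unfolding L_def s_def[symmetric] u_def[symmetric] by (rule innovation_gaussian[OF B su])
  then have L': "prob_space L" "sets L = sets (entry_space m N)" by (auto simp: gaussian_entries_def)
  have U_at: "?U \<omega> e r = B (fst e) (snd e) r \<omega>" if "e \<in> ?I" "fst e \<le> p" "r \<in> T" for \<omega> e r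
    using that T(2)[OF that(3)] by (simp add: past_entries_def path_of_def)
  have eval: "(\<lambda>h. h e r) \<in> borel_measurable ?P" if "e \<in> ?I" "fst e \<le> p" "r \<in> T" for e r
  proof (rule measurable_compose[of "\<lambda>h. h e" _ "PiM T (\<lambda>_. borel)" "\<lambda>g. g r"])
    show "(\<lambda>h. h e) \<in> measurable ?P (PiM T (\<lambda>_. borel))"
      using measurable_component_singleton[OF that(1), of "\<lambda>e. PiM (if fst e \<le> p then T else {}) (\<lambda>_. borel)"] that(2) by simp
    show "(\<lambda>g. g r) \<in> borel_measurable (PiM T (\<lambda>_. borel :: complex measure))"
      using that(3) by (rule measurable_component_singleton)
  qed
  have X_meas: "X l \<in> measurable M ?S" if "l \<in> {1..Suc k}" for l
    unfolding X_def using squared_singular_values_measurable[OF B] t0[OF that] by simp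
  define f where "f l h = gram_spectrum (N + \<alpha> l) N (\<lambda>e\<in>{1..N + \<alpha> l} \<times> {1..N}. h e (t l))"
    for l and h :: "nat \<times> nat \<Rightarrow> real \<Rightarrow> complex"
  have rows: "{1..N + \<alpha> l} \<times> {1..N} \<subseteq> {e \<in> ?I. fst e \<le> p}" if "l \<in> {1..k}" for l
    using that time_like_path_mono(1)[OF path, of l k] pm by (auto simp: p_def)
  have f_meas: "f l \<in> measurable ?P ?S" if l: "l \<in> {1..k}" for l
    unfolding f_def
  proof (rule measurable_compose[OF _ gram_spectrum_measurable], rule measurable_restrict)
    fix e assume "e \<in> {1..N + \<alpha> l} \<times> {1..N}"
    then show "(\<lambda>h. h e (t l)) \<in> borel_measurable ?P"
      using rows[OF l] l by (intro eval) (auto simp: T_def)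
  qed
  have X_eq: "X l \<omega> = f l (?U \<omega>)" if l: "l \<in> {1..k}" for l \<omega>
    unfolding X_def f_def squared_singular_values_eq_gram_spectrum
  proof (rule gram_spectrum_cong)
    fix e assume e: "e \<in> {1..N + \<alpha> l} \<times> {1..N}"
    then have "?U \<omega> e (t l) = B (fst e) (snd e) (t l) \<omega>"
      using rows[OF l] l by (intro U_at) (auto simp: T_def)
    then show "B (fst e) (snd e) (t l) \<omega> = (\<lambda>e\<in>{1..N + \<alpha> l} \<times> {1..N}. ?U \<omega> e (t l)) e"
      using e by (simp only: restrict_apply if_True)
  qed
  \<comment> \<open>The current matrix, extended by zero rows, as a function of the past.\<close>
  define pad where "pad h = (\<lambda>e\<in>?I. if fst e \<le> p then h e s else 0)" for h :: "nat \<times> nat \<Rightarrow> real \<Rightarrow> complex"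
  have pad [measurable]: "pad \<in> measurable ?P (entry_space m N)"
    unfolding pad_def[abs_def]
  proof (rule measurable_restrict)
    fix e assume "e \<in> ?I"
    then show "(\<lambda>h. if fst e \<le> p then h e s else 0) \<in> borel_measurable ?P"
      using eval[of e s] sT by (cases "fst e \<le> p") auto
  qed
  have pad_U: "gram_spectrum m N (pad (?U \<omega>)) = X k \<omega>" for \<omega>
  proof -
    have "gram_spectrum m N (pad (?U \<omega>)) = gram_spectrum m N (\<lambda>e. if fst e \<le> p then B (fst e) (snd e) s \<omega> else 0)"
      by (rule gram_spectrum_cong) (simp add: pad_def U_at sT)
    also have "\<dots> = gram_spectrum p N (\<lambda>e. B (fst e) (snd e) s \<omega>)" by (rule gram_spectrum_zero_rows[OF pm])
    finally show ?thesis by (simp add: X_def squared_singular_values_eq_gram_spectrum p_def s_def)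
  qed
  have next_eq: "gram_spectrum m N (add_entries m N (pad (?U \<omega>)) (?W \<omega>)) = X (Suc k) \<omega>" for \<omega>
    unfolding X_def squared_singular_values_eq_gram_spectrum m_def[symmetric] u_def[symmetric]
    by (rule gram_spectrum_cong)
      (use su in \<open>simp add: add_entries_def pad_def U_at sT innovation_entries_def innovation_path_of\<close>)
  define \<psi> where "\<psi> = (\<lambda>(h, y). indicator E (gram_spectrum m N (add_entries m N (pad h) y)) :: real)"
  define g where "g = (\<lambda>\<omega>. spectrum_kernel m N L E (diagonal_entries m N (X k \<omega>)))"
  have "AE \<omega> in M. real_cond_exp M ?F (\<lambda>\<omega>. \<psi> (?U \<omega>, ?W \<omega>)) \<omega> = g \<omega>"
  proof (rule real_cond_exp_indep_pair[OF ind])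
    show "subalgebra M ?F"
      unfolding subalgebra_def sets_generated_algebra
    proof (intro conjI refl sets.sigma_sets_subset)
      show "(\<Union>i\<in>I. {X i -` E \<inter> space M |E. E \<in> sets ?S}) \<subseteq> sets M"
        using measurable_sets[OF X_meas] I by auto
    qed
    show "\<exists>A'\<in>sets ?P. A = ?U -` A' \<inter> space M" if "A \<in> sets ?F" for A
    proof (rule generated_algebra_subset_vimage[OF _ _ _ that])
      show "?U \<in> space M \<rightarrow> space ?P" using measurable_space[OF U] by auto
      show "f l \<in> measurable ?P ?S" if "l \<in> I" for l using f_meas I that by auto
      show "X l \<omega> = f l (?U \<omega>)" if "l \<in> I" for l \<omega> using X_eq I that by auto
    qed
    have "(\<lambda>z. (pad (fst z), snd z)) \<in> measurable (?P \<Otimes>\<^sub>M entry_space m N) (entry_space m N \<Otimes>\<^sub>M entry_space m N)"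
      by (intro measurable_Pair measurable_compose[OF measurable_fst pad] measurable_snd)
    from measurable_compose[OF this add_entries_measurable]
    have "(\<lambda>z. add_entries m N (pad (fst z)) (snd z)) \<in> measurable (?P \<Otimes>\<^sub>M entry_space m N) (entry_space m N)"
      by (simp only: case_prod_conv)
    from measurable_compose[OF measurable_compose[OF this gram_spectrum_measurable] borel_measurable_indicator[OF E]]
    show "\<psi> \<in> borel_measurable (?P \<Otimes>\<^sub>M entry_space m N)"
      by (simp only: \<psi>_def case_prod_beta')
    show "\<bar>\<psi> z\<bar> \<le> 1" for z by (cases z) (simp add: \<psi>_def)
    have "X k \<in> measurable ?F ?S" using I X_meas k by (intro measurable_generated_algebra) auto
    then show "g \<in> borel_measurable ?F"
      unfolding g_def
      by (intro measurable_compose[OF _ spectrum_kernel_measurable[OF L' E]] measurable_compose[OF _ diagonal_entries_measurable])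
    show "(\<integral>y. \<psi> (?U \<omega>, y) \<partial>distr M (entry_space m N) ?W) = g \<omega>" for \<omega>
    proof -
      have "(\<integral>y. \<psi> (?U \<omega>, y) \<partial>distr M (entry_space m N) ?W) = spectrum_kernel m N L E (pad (?U \<omega>))"
        by (simp add: \<psi>_def spectrum_kernel_def L_def s_def u_def)
      also have "\<dots> = g \<omega>"
        unfolding g_def pad_U[symmetric]
        by (rule spectrum_kernel_diagonal[OF L _ pm _ _ E]) (auto simp: p_def pad_def m_def)
      finally show ?thesis .
    qed
  qed
  then show ?thesis by (simp add: \<psi>_def next_eq g_def)
qed

end

theorem lemma3p1:
  fixes M :: "'w measure"
    and B :: "nat \<Rightarrow> nat \<Rightarrow> real \<Rightarrow> 'w \<Rightarrow> complex"
    and N m :: nat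
    and \<alpha> :: "nat \<Rightarrow> nat"
    and t :: "nat \<Rightarrow> real"
  assumes "prob_space M"
    and "iid_complex_brownian_motions M B"
    and "N \<ge> 1" and "m \<ge> 1"
    and "\<And>k. k \<in> {1..m} \<Longrightarrow> t k > 0"
    and "time_like_path m \<alpha> t"
  shows "markov_process M (PiM {1..N} (\<lambda>_. borel)) m
           (\<lambda>k \<omega>. squared_singular_values B N (\<alpha> k) (t k) \<omega>)"
proof -
  interpret prob_space M by fact
  note B = assms(2) and N = assms(3) and pos = assms(5) and path = assms(6)
  show ?thesis
    unfolding markov_process_def
  proof (intro conjI ballI)
    fix k assume "k \<in> {1..m}"
    then show "squared_singular_values B N (\<alpha> k) (t k) \<in> measurable M (PiM {1..N} (\<lambda>_. borel))"
      using pos[of k] by (intro squared_singular_values_measurable[OF B]) simp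
  next
    fix k E assume k: "k \<in> {1..<m}" and E: "E \<in> sets (PiM {1..N} (\<lambda>_. borel) :: (nat \<Rightarrow> real) measure)"
    have pos': "0 < t l" if "l \<in> {1..Suc k}" for l using pos k that by auto
    have path': "time_like_path (Suc k) \<alpha> t" using path k by (auto simp: time_like_path_def)
    have k1: "1 \<le> k" using k by simp
    note cond = real_cond_exp_squared_singular_values[OF B N pos' path' k1 E]
    show "AE \<omega> in M.
        real_cond_exp M (generated_algebra M (PiM {1..N} (\<lambda>_. borel)) (\<lambda>k \<omega>. squared_singular_values B N (\<alpha> k) (t k) \<omega>) {1..k})
          (\<lambda>\<omega>. indicator E (squared_singular_values B N (\<alpha> (Suc k)) (t (Suc k)) \<omega>)) \<omega> =
        real_cond_exp M (generated_algebra M (PiM {1..N} (\<lambda>_. borel)) (\<lambda>k \<omega>. squared_singular_values B N (\<alpha> k) (t k) \<omega>) {k})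
          (\<lambda>\<omega>. indicator E (squared_singular_values B N (\<alpha> (Suc k)) (t (Suc k)) \<omega>)) \<omega>"
      using cond[of "{1..k}"] cond[of "{k}"] k1 by (auto elim!: eventually_elim2)
  qed
qed

end
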